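(* Consider $m$ agents running the distributed online estimation algorithm described in the context, with communication period $\zeta$, stopping time $S$ and $T\ge1$ communication steps. Fix $\hat{\delta}>0$ and let $t\ge\max(t_1,t_2,t_3)$, where $t_1=8n+16\log\frac{2}{\hat\delta}$, $t_2=\left(\frac{16\hat{\mu}(\sqrt{4n}+\sqrt{2\log\frac{2}{\hat\delta}})}{\sigma_x}\right)^2$, $t_3=2(n+l)\log\frac{1}{\hat\delta}$, and suppose $t\bmod\zeta=0$ and $t\le S$. Fix $\delta>0$ and let $\bar\mu_t=\frac{4}{mt\sigma_x^2}\sum_{i=1}^m\sum_{j=1}^t\mu_{i,j}\mu_{i,j}^*$. Then with probability at least $1-4m\hat\delta-4\delta$, for all $i\in\{1,\ldots,m\}$, $$\|\bar\Theta_{i,t+1}-\Theta\|\le(\rho(W))^TC_0+\frac{C_1}{\sqrt{mt}\,\sigma_x^2\,\lambda_{\min}(I_n+\bar\mu_t)},$$ where $C_0=c_3(c_1+t^{-1/2}c_2)+\frac{8m^{3/2}\sqrt l\,(c_1+t^{-1/2}c_2)}{\sigma_x^2}+(\rho(W))^Tm^{3/2}\sqrt l\,c_3(c_1+t^{-1/2}c_2)$, $C_1=8\sigma_\eta\left(4\sigma_x\sqrt{(n+l)\log\frac{9}{\delta}}+\hat{\mu}\big(\sqrt{2(l+n)}+2\sqrt{\log\frac{2}{\delta}}\big)\right)$, $c_1=\|\Theta\|\big(\frac{19}{8}\sigma_x^2+\hat\mu^2\big)$, $c_2=\sigma_\eta\Big(4\sigma_x\sqrt{(n+l)\log\frac{9}{\hat\delta}}+\hat{\mu}\big(\sqrt{2(l+n)}+\sqrt{2\log\frac{2}{\hat\delta}}\big)\Big)$,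 and $c_3=\frac{152m^{3/2}\sqrt{5n}}{\sigma_x^2}+\frac{64m^{3/2}\sqrt{5n}}{\sigma_x^4}\hat\mu^2$.
   Context: Data model: each agent $i\in\{1,\dots,m\}$ observes at times $j=1,2,\ldots$ pairs $(x_{i,j},y_{i,j})$ with $y_{i,j}=\Theta x_{i,j}+\eta_{i,j}$, $\Theta\in\mathbb{R}^{l\times n}$ unknown, $x_{i,j}\sim\mathcal{N}(\mu_{i,j},\sigma_x^2I_n)$, $\eta_{i,j}\sim\mathcal{N}(0,\sigma_\eta^2I_l)$, all mutually independent over time and agents, with deterministic means and $\sup_{i,j}\|\mu_{i,j}\|=\hat\mu<\infty$; $\sigma_x,\sigma_\eta>0$. Communication graph and weights: the agents are connected by an undirected connected graph; $W\in\mathbb{R}^{m\times m}$ satisfies $W(i,j)\ge0$, $W(i,j)=0$ if $j$ is not a neighbor of $i$ and $i\ne j$, $W\mathbf 1_m=\mathbf 1_m$, $W=W^*$, and $\rho(W)=\max\{\lambda_2(W),-\lambda_m(W)\}<1$, where $\lambda_1(W)\ge\cdots\ge\lambda_m(W)$ are the real eigenvalues of $W$. Algorithm: each agent maintains $\alpha_{i,t+1}=\sum_{j=1}^ty_{i,j}x_{i,j}^*$ and $\beta_{i,t+1}=\sum_{j=1}^tx_{i,j}x_{i,j}^*$. At a time $t$ with $t\bmod\zeta=0$ and $t\le S$ ($\zeta\ge1$, $S\ge0$ integers), the agents set $\alpha^0_{i,t+1}=\alpha_{i,t+1}$, $\beta^0_{i,t+1}=\beta_{i,t+1}$ and perform,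 for $k=0,\ldots,T-1$, $\alpha^{k+1}_{i,t+1}=\sum_{j=1}^mW(i,j)\alpha^k_{j,t+1}$ and $\beta^{k+1}_{i,t+1}=\sum_{j=1}^mW(i,j)\beta^k_{j,t+1}$ (using only neighbors' values), and set $\bar\Theta_{i,t+1}=\alpha^T_{i,t+1}(\beta^T_{i,t+1})^\dagger$. $\|\cdot\|$ is the spectral norm, $A^*$ the transpose, $A^\dagger$ the pseudoinverse, $\lambda_{\min}$ the smallest eigenvalue. *)

theory Defs
  imports "HOL-Probability.Probability" "HOL-Computational_Algebra.Polynomial"
begin

definition spec_norm :: "real^'n^'k \<Rightarrow> real" where
  "spec_norm A = onorm (\<lambda>v. A *v v)"

definition char_poly_mat :: "real^'n^'n \<Rightarrow> real poly" where
  "char_poly_mat A = det (\<chi> i j. (if i = j then [:0, 1:] else 0) - [:A $ i $ j:])"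

definition eigs_sorted :: "real^'n^'n \<Rightarrow> real list" where
  "eigs_sorted A = sorted_list_of_multiset (proots (char_poly_mat A))"

text \<open>k-th largest eigenvalue lambda_k (k = 1..n) of a symmetric matrix.\<close>
definition eig_k :: "real^'n^'n \<Rightarrow> nat \<Rightarrow> real" where
  "eig_k A k = eigs_sorted A ! (CARD('n) - k)"

definition lambda_min :: "real^'n^'n \<Rightarrow> real" where
  "lambda_min A = eig_k A CARD('n)"

definition rho :: "real^'m^'m \<Rightarrow> real" where
  "rho W = max (eig_k W 2) (- eig_k W CARD('m))"

definition pinv :: "real^'n^'k \<Rightarrow> real^'k^'n" where
  "pinv A = (THE B. A ** B ** A = A \<and> B ** A ** B = B \<and>
       transpose (A ** B) = A ** B \<and> transpose (B ** A) = B ** A)"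

definition outer :: "real^'k \<Rightarrow> real^'n \<Rightarrow> real^'n^'k" where
  "outer u v = (\<chi> a b. u $ a * v $ b)"

primrec consensus :: "real^'m^'m \<Rightarrow> nat \<Rightarrow> ('m \<Rightarrow> 'b::real_vector) \<Rightarrow> 'm \<Rightarrow> 'b" where
  "consensus W 0 f = f"
| "consensus W (Suc k) f = (\<lambda>i. \<Sum>j\<in>UNIV. W $ i $ j *\<^sub>R consensus W k f j)"

definition alpha_acc :: "('m \<Rightarrow> nat \<Rightarrow> real^'l) \<Rightarrow> ('m \<Rightarrow> nat \<Rightarrow> real^'n) \<Rightarrow> nat \<Rightarrow> 'm \<Rightarrow> real^'n^'l" where
  "alpha_acc y x t i = (\<Sum>j=1..t. outer (y i j) (x i j))"

definition beta_acc :: "('m \<Rightarrow> nat \<Rightarrow> real^'n) \<Rightarrow> nat \<Rightarrow> 'm \<Rightarrow> real^'n^'n" where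
  "beta_acc x t i = (\<Sum>j=1..t. outer (x i j) (x i j))"

text \<open>Estimate bar Theta_{i,t+1} = alpha^T_{i,t+1} (beta^T_{i,t+1})^dagger, computed at a
  communication time t (t mod zeta = 0, t <= S).\<close>
definition theta_bar :: "real^'m^'m \<Rightarrow> nat \<Rightarrow> ('m \<Rightarrow> nat \<Rightarrow> real^'l) \<Rightarrow> ('m \<Rightarrow> nat \<Rightarrow> real^'n)
    \<Rightarrow> nat \<Rightarrow> 'm \<Rightarrow> real^'n^'l" where
  "theta_bar W T y x t i =
     consensus W T (alpha_acc y x t) i ** pinv (consensus W T (beta_acc x t) i)"

definition gauss_iso_density :: "real^'n \<Rightarrow> real \<Rightarrow> real^'n \<Rightarrow> ennreal" where
  "gauss_iso_density mu s v =
     ennreal ((2 * pi * s\<^sup>2) powr (- real CARD('n) / 2) * exp (- (norm (v - mu))\<^sup>2 / (2 * s\<^sup>2)))"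

end

theory Submission
  imports Defs
begin

text \<open>
  Since every observation is \<open>\<Theta> x + \<eta>\<close>, the error at agent \<open>i\<close> is \<open>(\<Sum>k. p k N\<^sub>k) (\<Sum>k. p k \<beta>\<^sub>k)\<inverse>\<close>
  with \<open>N\<^sub>k = \<Sum>j. \<eta> x\<^sup>*\<close>, \<open>\<beta>\<^sub>k = \<Sum>j. x x\<^sup>*\<close>, where \<open>p\<close> is row \<open>i\<close> of \<open>W\<^sup>T\<close> and
  \<open>\<bar>p k - 1/m\<bar> \<le> \<rho>(W)\<^sup>T\<close> by the spectral theorem. Two facts suffice. Outside an event of
  probability \<open>2 \<delta>\<close>-hat, \<open>\<beta>\<^sub>k\<close> dominates \<open>t \<sigma>\<^sup>2/64 + \<Sum>j. \<mu> \<mu>\<^sup>*\<close> (Chernoff bounds on a net of the sphere).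
  Conditionally on the \<open>x\<close>, the noise \<open>N\<close> normalised by \<open>\<beta>\<close> is a standard Gaussian matrix, so
  \<open>\<bar>N w\<bar>\<^sup>2\<close> is bounded by a multiple of \<open>w \<bullet> \<beta> w\<close> uniformly in \<open>w\<close>, without any upper bound on
  \<open>\<beta>\<close>; this is used for each agent with \<open>\<delta>\<close>-hat and once for the whole network with \<open>\<delta>\<close>.
\<close>

section \<open>Spectral theory of symmetric matrices\<close>

text \<open>Applied to \<open>v\<close>, the error is the weighted noise at \<open>w\<close>, where
  the weighted Gram matrix maps \<open>w\<close> to \<open>v\<close>; the Gram form at
  \<open>w\<close> is thus \<open>w \<bullet> v\<close>, at most \<open>norm w * norm v\<close>. A
  noise bound by \<open>g^2\<close> times the form and a coercivity bound
  \<open>kappa * norm w ^ 2\<close> below the form combine to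
  \<open>g / sqrt kappa * norm v\<close>. The obstacle: network-wide noise is normalised by the
  plain sum of the local forms, while the estimate inverts the weighted one. Comparing the two costs
  \<open>1 / (1 - m r)\<close> with \<open>r = rho W ^ T\<close>, which the leading term cannot
  absorb. The averaged noise is therefore split into fractions \<open>1 - m r\<close> and
  \<open>m r\<close>: the first cancels the loss exactly, the second is charged to local bounds and
  joins the consensus term. The result decays like the inverse square root of \<open>L\<close>, the
  least eigenvalue in the claim, whereas the claim has \<open>1 / L\<close>; the bound on the means
  limits \<open>L\<close> and permits the exchange. Two definitions need a bridge: eigenvalues are
  roots of the characteristic polynomial, and the pseudoinverse is discontinuous, so measurability
  of the good event is not automatic.\<close>

lemma outer_mult_vec: "outer u v *v w = (v \<bullet> w) *\<^sub>R u"
  by (simp add: outer_def vec_eq_iff matrix_vector_mult_def inner_vec_def sum_distrib_left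
      sum_distrib_right ac_simps)

lemma inner_outer_mult_vec: "w \<bullet> (outer u v *v z) = (w \<bullet> u) * (v \<bullet> z)"
  by (simp add: outer_mult_vec ac_simps)

lemma transpose_outer [simp]: "transpose (outer u v) = outer v u"
  by (simp add: outer_def transpose_def vec_eq_iff)

lemma sum_matrix_vector_mult: "(\<Sum>i\<in>I. A i) *v v = (\<Sum>i\<in>I. A i *v (v :: real^'n))"
  by (induction I rule: infinite_finite_induct) (auto simp: matrix_vector_mult_add_rdistrib)

lemma matrix_matrix_mult_sum: "B ** (\<Sum>i\<in>I. A i) = (\<Sum>i\<in>I. B ** (A i :: real^'n^'k))"
  by (induction I rule: infinite_finite_induct)
    (auto simp: matrix_matrix_mult_def vec_eq_iff sum.distrib ring_distribs)

lemma transpose_sum: "transpose (\<Sum>i\<in>I. A i :: real^'n^'k) = (\<Sum>i\<in>I. transpose (A i))"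
  by (induction I rule: infinite_finite_induct) (auto simp: transpose_def vec_eq_iff)

lemma transpose_scaleR: "transpose (c *\<^sub>R A :: real^'n^'k) = c *\<^sub>R transpose A"
  by (simp add: transpose_def vec_eq_iff)

lemma inner_symmetric_matrix:
  "transpose A = (A :: real^'n^'n) \<Longrightarrow> v \<bullet> (A *v w) = (A *v v) \<bullet> w"
  by (metis dot_lmul_matrix vector_transpose_matrix)

text \<open>The index type is that of the coordinates, so there are as many vectors as dimensions
  and orthonormality alone makes the family a basis.\<close>

definition orthonormal_family :: "('n \<Rightarrow> real^'n) \<Rightarrow> bool" where
  "orthonormal_family p \<longleftrightarrow> (\<forall>a b. p a \<bullet> p b = (if a = b then 1 else 0))"

text \<open>Functional calculus: with the eigenbasis \<open>p\<close> fixed, products, powers and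
  pseudoinverses become pointwise operations on the eigenvalue function \<open>f\<close>.\<close>

definition spectral_matrix :: "('n \<Rightarrow> real^'n) \<Rightarrow> ('n \<Rightarrow> real) \<Rightarrow> real^'n^'n" where
  "spectral_matrix p f = (\<Sum>a\<in>UNIV. f a *\<^sub>R outer (p a) (p a))"

text \<open>The eigenvector maximises the quadratic form on the unit sphere of the invariant subspace.\<close>

lemma symmetric_invariant_subspace_eigenvector:
  fixes A :: "real^'n^'n"
  assumes sym: "transpose A = A" and V: "subspace V" "\<And>v. v \<in> V \<Longrightarrow> A *v v \<in> V"
    and ne: "u \<in> V" "u \<noteq> 0"
  obtains v c where "v \<in> V" "norm v = 1" "A *v v = c *\<^sub>R v"
proof -
  let ?K = "V \<inter> sphere 0 1"
  have "compact ?K"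
    using closed_subspace[OF V(1)] by (simp add: closed_Int_compact)
  moreover have "u /\<^sub>R norm u \<in> ?K"
    using ne V(1) by (auto simp: subspace_scale)
  moreover have "continuous_on ?K (\<lambda>v. v \<bullet> (A *v v))"
    by (intro continuous_intros linear_continuous_on_compose matrix_vector_mul_linear)
  ultimately obtain v where v: "v \<in> ?K" and max: "\<And>w. w \<in> ?K \<Longrightarrow> w \<bullet> (A *v w) \<le> v \<bullet> (A *v v)"
    using continuous_attains_sup[of ?K] by blast
  define c where "c = v \<bullet> (A *v v)"
  have le: "w \<bullet> (A *v w) \<le> c * (w \<bullet> w)" if "w \<in> V" for w
  proof (cases "w = 0")
    case False
    have "(w /\<^sub>R norm w) \<bullet> (A *v (w /\<^sub>R norm w)) \<le> c"
      unfolding c_def using False that V(1) by (intro max) (auto simp: subspace_scale)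
    then have "(w \<bullet> (A *v w)) / (norm w)\<^sup>2 \<le> c"
      by (simp add: matrix_vector_mult_scaleR power2_eq_square divide_simps)
    then show ?thesis
      using False by (simp add: divide_le_eq power2_norm_eq_inner)
  qed auto
  \<comment> \<open>The residual of the eigenvalue equation. Maximality of \<open>v\<close>, tested
    along \<open>v + s w\<close>, has linear coefficient exactly \<open>2 * (w \<bullet> w)\<close>
    and so forces the residual to vanish.\<close>
  define w where "w = c *\<^sub>R v - A *v v"
  have w: "w \<in> V"
    using v V by (auto simp: w_def subspace_diff subspace_scale)
  have "norm v = 1" using v by simp
  then have vv: "v \<bullet> v = 1" by (simp add: norm_eq_1)
  have quad: "0 \<le> 2 * s * (w \<bullet> w) + s\<^sup>2 * (c * (w \<bullet> w) - w \<bullet> (A *v w))" for s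
  proof -
    have e1: "(v + s *\<^sub>R w) \<bullet> (A *v (v + s *\<^sub>R w)) \<le> c * ((v + s *\<^sub>R w) \<bullet> (v + s *\<^sub>R w))"
      using w v V by (intro le) (auto simp: subspace_add subspace_scale)
    have e2: "v \<bullet> (A *v w) = w \<bullet> (A *v v)"
      using inner_symmetric_matrix[OF sym] by (simp add: inner_commute)
    have e3: "w \<bullet> w = c * (v \<bullet> w) - w \<bullet> (A *v v)"
      by (subst (2) w_def) (simp add: inner_diff_right inner_commute)
    have e4: "(v + s *\<^sub>R w) \<bullet> (A *v (v + s *\<^sub>R w))
        = c + s * (v \<bullet> (A *v w)) + s * (w \<bullet> (A *v v)) + s\<^sup>2 * (w \<bullet> (A *v w))"
      by (simp add: matrix_vector_right_distrib matrix_vector_mult_scaleR inner_add_left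
          inner_add_right power2_eq_square c_def distrib_left mult.assoc)
    have e5: "(v + s *\<^sub>R w) \<bullet> (v + s *\<^sub>R w) = 1 + 2 * s * (v \<bullet> w) + s\<^sup>2 * (w \<bullet> w)"
      by (simp add: inner_add_left inner_add_right power2_eq_square vv inner_commute)
    have "c + 2 * (s * (w \<bullet> (A *v v))) + s\<^sup>2 * (w \<bullet> (A *v w))
        \<le> c * (1 + 2 * s * (v \<bullet> w) + s\<^sup>2 * (w \<bullet> w))"
      using e1 unfolding e4 e5 e2 by linarith
    moreover have "2 * s * (w \<bullet> w) = 2 * s * (c * (v \<bullet> w) - w \<bullet> (A *v v))"
      unfolding e3 by (rule refl)
    ultimately show ?thesis by (simp add: algebra_simps)
  qed
  define q where "q = c * (w \<bullet> w) - w \<bullet> (A *v w)"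
  have "q \<ge> 0" using le[OF w] by (simp add: q_def)
  have "w \<bullet> w = 0"
  proof (rule ccontr)
    assume "w \<bullet> w \<noteq> 0"
    then have pos: "w \<bullet> w > 0" using inner_ge_zero[of w] by linarith
    \<comment> \<open>A small negative step lets the linear term win; the \<open>+ 1\<close> keeps
      the denominator positive when \<open>q = 0\<close>.\<close>
    define s where "s = - (w \<bullet> w) / (q + 1)"
    have "0 \<le> 2 * s * (w \<bullet> w) + s\<^sup>2 * q" using quad[of s] by (simp add: q_def)
    moreover have "s\<^sup>2 * q \<le> s\<^sup>2 * (q + 1)" by (simp add: mult_left_mono)
    moreover have "s * (q + 1) = - (w \<bullet> w)"
      using \<open>q \<ge> 0\<close> by (simp add: s_def)
    then have "s\<^sup>2 * (q + 1) = - s * (w \<bullet> w)"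
      by (simp add: power2_eq_square mult.assoc)
    moreover have "s * (w \<bullet> w) < 0"
      using pos \<open>q \<ge> 0\<close> by (simp add: s_def divide_less_0_iff mult_neg_pos)
    ultimately show False by linarith
  qed
  then have "A *v v = c *\<^sub>R v" by (simp add: w_def)
  with v that show ?thesis by auto
qed

text \<open>A largest orthonormal set of eigenvectors exists because the dimension bounds its
  cardinality. If it fell short, its orthogonal complement would be a nonzero subspace, invariant by
  symmetry, and would supply one more eigenvector.\<close>

theorem symmetric_matrix_spectral_basis:
  fixes A :: "real^'n^'n"
  assumes sym: "transpose A = A"
  obtains p d where "orthonormal_family p" "\<And>a. A *v p a = d a *\<^sub>R p a"
proof -
  define good where "good B \<longleftrightarrow> pairwise orthogonal B \<and> (\<forall>b\<in>B. norm b = 1 \<and> (\<exists>c. A *v b = c *\<^sub>R b))"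
    for B :: "(real^'n) set"
  have indep: "independent B" if "good B" for B
    using that by (intro pairwise_orthogonal_independent) (auto simp: good_def)
  have bound: "finite B \<and> card B \<le> CARD('n)" if "good B" for B
    using independent_bound[OF indep[OF that]] by simp
  have "good {}" by (simp add: good_def)
  then obtain B where B: "good B" and max: "\<And>C. good C \<Longrightarrow> card C \<le> card B"
    using ex_has_greatest_nat[of good "{}" card "Suc CARD('n)"] bound
    by (metis le_imp_less_Suc)
  have fin: "finite B" using bound B by blast
  have "card B = CARD('n)"
  proof (rule ccontr)
    assume "card B \<noteq> CARD('n)"
    then have "dim B < DIM(real^'n)"
      using bound[OF B] dim_eq_card_independent[OF indep[OF B]] by simp
    then obtain u where u: "u \<noteq> 0" "\<And>y. y \<in> span B \<Longrightarrow> orthogonal u y"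
      using orthogonal_to_subspace_exists by blast
    define V where "V = {w. \<forall>b\<in>B. b \<bullet> w = 0}"
    have sub: "subspace V"
      by (auto simp: V_def subspace_def inner_add_right)
    have inv: "A *v w \<in> V" if "w \<in> V" for w
      using that B by (auto simp: V_def good_def inner_symmetric_matrix[OF sym])
    have "u \<in> V"
      using u(2)[OF span_base] by (auto simp: V_def orthogonal_def inner_commute)
    then obtain v c where v: "v \<in> V" "norm v = 1" "A *v v = c *\<^sub>R v"
      using symmetric_invariant_subspace_eigenvector[OF sym sub inv _ u(1)] by metis
    have "v \<notin> B"
    proof
      assume "v \<in> B"
      with v(1) have "v \<bullet> v = 0" by (simp add: V_def)
      with v(2) show False by simp
    qed
    have "good (insert v B)"
      using B v by (auto simp: good_def pairwise_insert V_def orthogonal_def inner_commute)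
    with max[of "insert v B"] \<open>v \<notin> B\<close> fin show False by simp
  qed
  then obtain p where p: "bij_betw p (UNIV :: 'n set) B"
    using fin by (metis finite_same_card_bij finite)
  have "orthonormal_family p"
    using B p unfolding orthonormal_family_def good_def pairwise_def orthogonal_def bij_betw_def inj_on_def
    by (metis UNIV_I image_eqI norm_eq_1)
  moreover have "\<forall>a. \<exists>c. A *v p a = c *\<^sub>R p a"
    using B p by (metis UNIV_I bij_betwE good_def)
  ultimately show ?thesis using that by metis
qed

lemma orthonormal_family_expand:
  assumes "orthonormal_family p"
  shows "v = (\<Sum>a\<in>UNIV. (p a \<bullet> v) *\<^sub>R p a)"
proof -
  have inj: "inj p"
    using assms by (auto simp: orthonormal_family_def inj_on_def) (metis zero_neq_one)
  have "independent (range p)"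
    using assms by (intro pairwise_orthogonal_independent)
      (auto simp: orthonormal_family_def pairwise_def orthogonal_def image_def, metis inner_zero_left zero_neq_one)
  then have "span (range p) = UNIV"
    using card_image[OF inj] by (metis DIM_cart DIM_real card_eq_dim dim_UNIV dim_eq_full
        independent_card_le_dim mult.right_neutral order_refl top.extremum_uniqueI top_greatest dim_eq_card_independent)
  then have "v \<in> span (range p)" by simp
  then obtain c' where "v = (\<Sum>b\<in>range p. c' b *\<^sub>R b)"
    by (auto simp: span_finite)
  then obtain c where c: "v = (\<Sum>a\<in>UNIV. c a *\<^sub>R p a)"
    using inj by (auto simp: sum.reindex)
  have "p b \<bullet> v = c b" for b
  proof -
    have "c a * (p b \<bullet> p a) = (if a = b then c b else 0)" for a
      using assms by (simp add: orthonormal_family_def)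
    then show ?thesis by (simp add: c inner_sum_right)
  qed
  with c show ?thesis by simp
qed

context
  fixes p :: "'n::finite \<Rightarrow> real^'n"
  assumes ortho: "orthonormal_family p"
begin

lemma inner_orthonormal [simp]: "p a \<bullet> p b = (if a = b then 1 else 0)"
  using ortho by (simp add: orthonormal_family_def)

lemma norm_orthonormal [simp]: "norm (p a) = 1"
  by (simp add: norm_eq_1)

lemma orthonormal_parseval: "(\<Sum>a\<in>UNIV. (p a \<bullet> v) * (p a \<bullet> w)) = v \<bullet> w"
  by (subst (3) orthonormal_family_expand[OF ortho])
    (simp add: inner_sum_right ac_simps inner_commute)

lemma spectral_matrix_mult_vec:
  "spectral_matrix p f *v v = (\<Sum>a\<in>UNIV. (f a * (p a \<bullet> v)) *\<^sub>R p a)"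
  by (simp add: spectral_matrix_def sum_matrix_vector_mult scaleR_matrix_vector_assoc[symmetric] outer_mult_vec)

lemma inner_spectral_matrix: "p a \<bullet> (spectral_matrix p f *v v) = f a * (p a \<bullet> v)"
  by (simp add: spectral_matrix_mult_vec inner_sum_right if_distrib cong: if_cong)

lemma spectral_matrix_quadratic:
  "v \<bullet> (spectral_matrix p f *v v) = (\<Sum>a\<in>UNIV. f a * (p a \<bullet> v)\<^sup>2)"
  by (simp add: spectral_matrix_mult_vec inner_sum_right power2_eq_square inner_commute ac_simps)

lemma spectral_matrix_eigen [simp]: "spectral_matrix p f *v p a = f a *\<^sub>R p a"
  by (simp add: spectral_matrix_mult_vec if_distrib if_distribR cong: if_cong)

lemma spectral_matrix_one: "spectral_matrix p (\<lambda>_. 1) = mat 1"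
  by (simp add: matrix_eq spectral_matrix_mult_vec flip: orthonormal_family_expand[OF ortho])

lemma spectral_matrix_mult:
  "spectral_matrix p f ** spectral_matrix p g = spectral_matrix p (\<lambda>a. f a * g a)"
proof -
  have "spectral_matrix p f *v (spectral_matrix p g *v v) = spectral_matrix p (\<lambda>a. f a * g a) *v v" for v
    by (simp add: spectral_matrix_mult_vec[of f] spectral_matrix_mult_vec[of "\<lambda>a. f a * g a"]
      inner_spectral_matrix mult.assoc)
  then show ?thesis by (simp add: matrix_eq matrix_vector_mul_assoc)
qed

lemma transpose_spectral_matrix: "transpose (spectral_matrix p f) = spectral_matrix p f"
  by (simp add: spectral_matrix_def transpose_sum transpose_scaleR)

end

lemma symmetric_matrix_spectral:
  fixes A :: "real^'n^'n"
  assumes "transpose A = A"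
  obtains p d where "orthonormal_family p" "A = spectral_matrix p d"
proof -
  obtain p d where p: "orthonormal_family p" and d: "\<And>a. A *v p a = d a *\<^sub>R p a"
    using symmetric_matrix_spectral_basis[OF assms] by blast
  have "A *v v = spectral_matrix p d *v v" for v
  proof -
    have "A *v v = (\<Sum>a\<in>UNIV. A *v ((p a \<bullet> v) *\<^sub>R p a))"
      by (subst orthonormal_family_expand[OF p, of v]) (simp add: vec.sum)
    then show ?thesis
      by (simp add: matrix_vector_mult_scaleR d spectral_matrix_mult_vec[OF p] mult.commute)
  qed
  then have "A = spectral_matrix p d" by (simp add: matrix_eq)
  with p show ?thesis by (rule that)
qed

text \<open>Links the determinant definition of eigenvalues to the spectral decomposition. At a real
  \<open>x\<close> the matrix is \<open>P\<close>, times the diagonal of the \<open>x - d a\<close>,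
  times \<open>transpose P\<close>; since \<open>P ** transpose P\<close> is the identity, only the
  diagonal contributes. Agreement at all \<open>x\<close> identifies the polynomials.\<close>

lemma char_poly_spectral_matrix:
  assumes p: "orthonormal_family p"
  shows "char_poly_mat (spectral_matrix p d) = (\<Prod>a\<in>UNIV. [:- d a, 1:])"
proof (rule poly_eq_poly_eq_iff[THEN iffD1], rule ext)
  fix x :: real
  let ?A = "spectral_matrix p d"
  let ?P = "\<chi> i j. p j $ i"
  have "poly (char_poly_mat ?A) x = det (\<chi> i j. (if i = j then x else 0) - ?A $ i $ j)"
    by (simp add: char_poly_mat_def det_def poly_sum poly_prod if_distrib[of "\<lambda>q. poly q x"] cong: if_cong)
  also have "(\<chi> i j. (if i = j then x else 0) - ?A $ i $ j) = spectral_matrix p (\<lambda>a. x - d a)"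
  proof -
    have "spectral_matrix p (\<lambda>a. x - d a) = x *\<^sub>R spectral_matrix p (\<lambda>_. 1) - ?A"
      by (simp add: spectral_matrix_def scaleR_left_diff_distrib sum_subtractf scaleR_sum_right)
    then show ?thesis
      by (simp add: spectral_matrix_one[OF p] vec_eq_iff mat_def)
  qed
  also have "\<dots> = ?P ** (\<chi> i j. if i = j then x - d i else 0) ** transpose ?P"
    by (simp add: vec_eq_iff matrix_matrix_mult_def transpose_def spectral_matrix_def outer_def
        if_distrib cong: if_cong) (simp add: ac_simps)
  also have "det \<dots> = det (?P ** transpose ?P) * (\<Prod>a\<in>UNIV. x - d a)"
    by (simp add: det_mul det_diagonal)
  also have "?P ** transpose ?P = spectral_matrix p (\<lambda>_. 1)"
    by (simp add: vec_eq_iff matrix_matrix_mult_def transpose_def spectral_matrix_def outer_def)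
  also have "det \<dots> * (\<Prod>a\<in>UNIV. x - d a) = poly (\<Prod>a\<in>UNIV. [:- d a, 1:]) x"
    by (simp add: spectral_matrix_one[OF p] poly_prod algebra_simps)
  finally show "poly (char_poly_mat ?A) x = poly (\<Prod>a\<in>UNIV. [:- d a, 1:]) x" .
qed

lemma eigs_sorted_spectral_matrix:
  assumes p: "orthonormal_family p"
  shows "mset (eigs_sorted (spectral_matrix p d)) = image_mset d (mset_set UNIV)"
proof -
  have "proots (\<Prod>a\<in>UNIV. [:- d a, 1:]) = (\<Sum>a\<in>UNIV. {#d a#})"
    by (subst proots_prod) auto
  also have "\<dots> = image_mset d (mset_set UNIV)"
    by (simp add: sum_unfold_sum_mset)
  finally show ?thesis
    by (simp add: eigs_sorted_def char_poly_spectral_matrix[OF p])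
qed

lemma sorted_eigs_sorted [simp]: "sorted (eigs_sorted A)"
  by (simp add: eigs_sorted_def)

lemma set_eigs_sorted_spectral_matrix:
  "orthonormal_family p \<Longrightarrow> set (eigs_sorted (spectral_matrix p d)) = range d"
  by (metis eigs_sorted_spectral_matrix finite finite_set_mset_mset_set set_image_mset set_mset_mset)

lemma length_eigs_sorted_spectral_matrix:
  fixes p :: "'n::finite \<Rightarrow> real^'n"
  shows "orthonormal_family p \<Longrightarrow> length (eigs_sorted (spectral_matrix p d)) = CARD('n)"
  by (metis eigs_sorted_spectral_matrix size_image_mset size_mset size_mset_set)

lemma eig_k_last_spectral_matrix:
  fixes p :: "'n::finite \<Rightarrow> real^'n"
  assumes p: "orthonormal_family p"
  shows "eig_k (spectral_matrix p d) CARD('n) = Min (range d)"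
proof -
  let ?xs = "eigs_sorted (spectral_matrix p d)"
  have "?xs \<noteq> []" using length_eigs_sorted_spectral_matrix[OF p, of d] by auto
  then have "?xs ! 0 \<in> set ?xs" "\<forall>x\<in>set ?xs. ?xs ! 0 \<le> x"
    by (auto simp: in_set_conv_nth sorted_nth_mono)
  then have "Min (set ?xs) = ?xs ! 0"
    by (intro Min_eqI) auto
  then show ?thesis
    by (simp add: eig_k_def set_eigs_sorted_spectral_matrix[OF p])
qed

text \<open>In the increasing list only the last position can exceed the entry at
  \<open>CARD('n) - 2\<close>, and the list records multiplicities, so two distinct indices cannot
  both lie above it. This is how a spectral gap singles out one eigenvector.\<close>

lemma spectral_eigenvalue_le_second:
  fixes p :: "'n::finite \<Rightarrow> real^'n"
  assumes p: "orthonormal_family p" and less: "eig_k (spectral_matrix p d) 2 < d b" and "a \<noteq> b"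
  shows "d a \<le> eig_k (spectral_matrix p d) 2"
proof (rule ccontr)
  let ?xs = "eigs_sorted (spectral_matrix p d)"
  let ?n = "CARD('n)"
  define s where "s = ?xs ! (?n - 2)"
  assume "\<not> ?thesis"
  then have gt: "s < d a" "s < d b" using less by (auto simp: s_def eig_k_def)
  have len: "length ?xs = ?n" by (rule length_eigs_sorted_spectral_matrix[OF p])
  have "card {a, b} \<le> card {c. s < d c}"
    using gt by (intro card_mono) auto
  also have "\<dots> = size (filter_mset (\<lambda>x. s < x) (mset ?xs))"
    by (simp add: eigs_sorted_spectral_matrix[OF p] filter_mset_image_mset)
  also have "\<dots> = card {i. i < ?n \<and> s < ?xs ! i}"
    by (simp flip: mset_filter add: length_filter_conv_card len)
  also have "\<dots> \<le> card {?n - 1}"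
  proof (intro card_mono subsetI)
    fix i assume "i \<in> {i. i < ?n \<and> s < ?xs ! i}"
    then have i: "i < ?n" "s < ?xs ! i" by auto
    have "\<not> i \<le> ?n - 2"
    proof
      assume "i \<le> ?n - 2"
      then have "?xs ! i \<le> s"
        unfolding s_def using i(1) len by (intro sorted_nth_mono) auto
      with i show False by simp
    qed
    with i(1) show "i \<in> {?n - 1}" by (auto simp: not_le)
  qed simp
  finally show False using \<open>a \<noteq> b\<close> by simp
qed

lemma lambda_min_quadratic_le:
  fixes A :: "real^'n^'n"
  assumes "transpose A = A"
  shows "lambda_min A * (v \<bullet> v) \<le> v \<bullet> (A *v v)"
proof -
  obtain p d where p: "orthonormal_family p" and A: "A = spectral_matrix p d"
    using symmetric_matrix_spectral[OF assms] by blast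
  have "lambda_min A \<le> d a" for a
    by (simp add: lambda_min_def A eig_k_last_spectral_matrix[OF p])
  then have "(\<Sum>a\<in>UNIV. lambda_min A * ((p a \<bullet> v) * (p a \<bullet> v))) \<le> (\<Sum>a\<in>UNIV. d a * (p a \<bullet> v)\<^sup>2)"
    by (intro sum_mono) (simp add: power2_eq_square mult_right_mono)
  then show ?thesis
    by (simp add: A spectral_matrix_quadratic[OF p] orthonormal_parseval[OF p] flip: sum_distrib_left)
qed

lemma lambda_min_attained:
  fixes A :: "real^'n^'n"
  assumes "transpose A = A"
  obtains v where "norm v = 1" "A *v v = lambda_min A *\<^sub>R v"
proof -
  obtain p d where p: "orthonormal_family p" and A: "A = spectral_matrix p d"
    using symmetric_matrix_spectral[OF assms] by blast
  have "Min (range d) \<in> range d" by (intro Min_in) auto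
  then obtain a where "d a = lambda_min A"
    unfolding lambda_min_def A eig_k_last_spectral_matrix[OF p] by (metis imageE)
  then show ?thesis
    using that[of "p a"] p by (simp add: A)
qed

section \<open>Pseudoinverses and consensus weights\<close>

lemma norm_matrix_vector_mult_le: "norm (A *v v) \<le> norm (A :: real^'n^'k) * norm v"
proof -
  have "norm ((A *v v) $ i) \<le> norm v * norm (A $ i)" for i
    using Cauchy_Schwarz_ineq2[of "A $ i" v] by (simp add: matrix_vector_mul_component mult.commute)
  then have "norm (A *v v) \<le> L2_set (\<lambda>i. norm v * norm (A $ i)) UNIV"
    unfolding norm_vec_def[of "A *v v"] by (intro L2_set_mono) auto
  then show ?thesis
    by (simp add: norm_vec_def[of A] L2_set_right_distrib mult.commute)
qed

text \<open>Uniqueness in the Penrose equations, which makes the \<open>THE\<close> in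
  \<open>pinv\<close> usable. Both \<open>A ** B\<close> and \<open>A ** C\<close> are symmetric, so
  transposing \<open>(A ** C) ** (A ** B) = A ** B\<close> shows that they coincide; likewise on the
  other side.\<close>

lemma pinv_eqI:
  fixes A :: "real^'n^'k"
  assumes "A ** B ** A = A" "B ** A ** B = B"
    "transpose (A ** B) = A ** B" "transpose (B ** A) = B ** A"
  shows "pinv A = B"
  unfolding pinv_def
proof (rule the_equality)
  fix C
  assume C: "A ** C ** A = A \<and> C ** A ** C = C \<and>
    transpose (A ** C) = A ** C \<and> transpose (C ** A) = C ** A"
  have "A ** B = transpose ((A ** C) ** (A ** B))"
    using assms C by (metis matrix_mul_assoc)
  also have "\<dots> = A ** C"
    using assms C by (metis matrix_mul_assoc matrix_transpose_mul)
  finally have AB: "A ** B = A ** C" .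
  have "B ** A = transpose ((B ** A) ** (C ** A))"
    using assms C by (metis matrix_mul_assoc)
  also have "\<dots> = C ** A"
    using assms C by (metis matrix_mul_assoc matrix_transpose_mul)
  finally have BA: "B ** A = C ** A" .
  show "C = B"
    using assms C AB BA by (metis matrix_mul_assoc)
qed (use assms in auto)

text \<open>The convention \<open>inverse 0 = 0\<close> lets one formula cover singular matrices:
  kernel directions are sent to zero, as the Penrose equations demand.\<close>

lemma pinv_spectral_matrix:
  assumes p: "orthonormal_family p"
  shows "pinv (spectral_matrix p d) = spectral_matrix p (\<lambda>a. inverse (d a))"
proof (rule pinv_eqI)
  have "d a * inverse (d a) * d a = d a" "inverse (d a) * d a * inverse (d a) = inverse (d a)" for a
    by (cases "d a = 0"; simp)+
  then show "spectral_matrix p d ** spectral_matrix p (\<lambda>a. inverse (d a)) ** spectral_matrix p d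
      = spectral_matrix p d"
    "spectral_matrix p (\<lambda>a. inverse (d a)) ** spectral_matrix p d ** spectral_matrix p (\<lambda>a. inverse (d a))
      = spectral_matrix p (\<lambda>a. inverse (d a))"
    unfolding spectral_matrix_mult[OF p] by (simp_all only:)
qed (simp_all add: spectral_matrix_mult[OF p] transpose_spectral_matrix[OF p])

lemma positive_definite_mult_pinv:
  fixes A :: "real^'n^'n"
  assumes sym: "transpose A = A" and pos: "\<And>v. v \<noteq> 0 \<Longrightarrow> 0 < v \<bullet> (A *v v)"
  shows "A ** pinv A = mat 1"
proof -
  obtain p d where p: "orthonormal_family p" and A: "A = spectral_matrix p d"
    using symmetric_matrix_spectral[OF sym] by blast
  have "d a \<noteq> 0" for a
  proof -
    have "p a \<noteq> 0" using norm_orthonormal[OF p, of a] by force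
    from pos[OF this] show ?thesis by (auto simp: A spectral_matrix_eigen[OF p])
  qed
  then show ?thesis
    by (simp add: A pinv_spectral_matrix[OF p] spectral_matrix_mult[OF p] spectral_matrix_one[OF p])
qed

text \<open>Landweber iteration: polynomials in \<open>A\<close> whose limit exhibits the pseudoinverse as a
  Borel function of a symmetric matrix.\<close>

primrec landweber :: "nat \<Rightarrow> real^'n^'n \<Rightarrow> real^'n^'n" where
  "landweber 0 A = 0"
| "landweber (Suc k) A = (1 / (1 + (norm A)\<^sup>2)) *\<^sub>R A
     + (mat 1 - (1 / (1 + (norm A)\<^sup>2)) *\<^sub>R (A ** A)) ** landweber k A"

text \<open>In the eigenbasis the iteration splits into scalar recursions with error factor
  \<open>(1 - c * (d a)^2) ^ k\<close>. The step size \<open>c\<close> is built from the Frobenius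
  norm, which dominates every eigenvalue, and the \<open>1\<close> in its denominator makes
  \<open>c * (d a)^2\<close> strictly less than 1. A zero eigenvalue stays at 0, which is
  \<open>inverse 0\<close>.\<close>

lemma landweber_tendsto_pinv:
  fixes A :: "real^'n^'n"
  assumes "transpose A = A"
  shows "(\<lambda>k. landweber k A) \<longlonglongrightarrow> pinv A"
proof -
  obtain p d where p: "orthonormal_family p" and A: "A = spectral_matrix p d"
    using symmetric_matrix_spectral[OF assms] by blast
  define c where "c = 1 / (1 + (norm A)\<^sup>2)"
  have c: "c > 0" by (simp add: c_def add_pos_nonneg)
  define x where "x k a = (1 - (1 - c * (d a)\<^sup>2) ^ k) * inverse (d a)" for k a
  have x_Suc: "c * d a + (1 - c * (d a)\<^sup>2) * x k a = x (Suc k) a" for k a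
    by (cases "d a = 0") (simp_all add: x_def field_simps power2_eq_square)
  have iter: "landweber k A = spectral_matrix p (x k)" for k
  proof (induction k)
    case 0
    then show ?case by (simp add: spectral_matrix_def x_def)
  next
    case (Suc k)
    have eq: "mat 1 - c *\<^sub>R spectral_matrix p (\<lambda>a. d a * d a) = spectral_matrix p (\<lambda>a. 1 - c * (d a)\<^sup>2)"
      unfolding spectral_matrix_one[OF p, symmetric] by (simp add: spectral_matrix_def power2_eq_square
          scaleR_sum_right sum_subtractf scaleR_left_diff_distrib)
    have "landweber (Suc k) A
        = c *\<^sub>R spectral_matrix p d + spectral_matrix p (\<lambda>a. (1 - c * (d a)\<^sup>2) * x k a)"
      by (simp add: Suc flip: c_def) (simp add: A spectral_matrix_mult[OF p] eq)
    also have "\<dots> = spectral_matrix p (x (Suc k))"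
      by (simp add: spectral_matrix_def scaleR_sum_right x_Suc flip: sum.distrib scaleR_left_distrib)
    finally show ?case .
  qed
  have lim: "(\<lambda>k. x k a) \<longlonglongrightarrow> inverse (d a)" for a
  proof (cases "d a = 0")
    case False
    have "\<bar>d a\<bar> \<le> norm A"
      using norm_matrix_vector_mult_le[of A "p a"] by (simp add: A p norm_orthonormal[OF p])
    then have "(d a)\<^sup>2 \<le> (norm A)\<^sup>2"
      by (metis abs_ge_zero power2_abs power_mono)
    then have "c * (d a)\<^sup>2 < 1"
      by (simp add: c_def divide_simps add_pos_nonneg)
    moreover have "c * (d a)\<^sup>2 > 0" using c False by simp
    ultimately have "norm (1 - c * (d a)\<^sup>2) < 1"
      unfolding real_norm_def by linarith
    then have "(\<lambda>k. (1 - c * (d a)\<^sup>2) ^ k) \<longlonglongrightarrow> 0"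
      by (rule LIMSEQ_power_zero)
    then have "(\<lambda>k. x k a) \<longlonglongrightarrow> (1 - 0) * inverse (d a)"
      unfolding x_def by (intro tendsto_mult tendsto_diff tendsto_const)
    then show ?thesis by simp
  qed (simp add: x_def)
  have "(\<lambda>k. spectral_matrix p (x k)) \<longlonglongrightarrow> spectral_matrix p (\<lambda>a. inverse (d a))"
    unfolding spectral_matrix_def by (intro tendsto_sum tendsto_scaleR tendsto_const lim)
  then show ?thesis unfolding iter by (simp add: A pinv_spectral_matrix[OF p])
qed

text \<open>Consensus is linear in the initial values, hence determined by its action on indicators.
  The coefficient is the entry in row \<open>i\<close>, column \<open>k\<close> of the
  \<open>T\<close>-th power of \<open>W\<close>; it is a real number even when the averaged values
  are matrices.\<close>

lemma consensus_eq_weights: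
  "consensus W T f i = (\<Sum>k\<in>UNIV. consensus W T (\<lambda>j. of_bool (j = k)) i *\<^sub>R f k)"
proof (induction T arbitrary: i)
  case 0
  have "of_bool (i = k) *\<^sub>R f k = (if i = k then f i else 0)" for k by simp
  then show ?case by simp
next
  case (Suc T)
  have "consensus W (Suc T) f i
      = (\<Sum>j\<in>UNIV. \<Sum>k\<in>UNIV. (W $ i $ j * consensus W T (\<lambda>j. of_bool (j = k)) j) *\<^sub>R f k)"
    by (simp add: Suc[of _] scaleR_sum_right)
  also have "\<dots> = (\<Sum>k\<in>UNIV. \<Sum>j\<in>UNIV. (W $ i $ j * consensus W T (\<lambda>j. of_bool (j = k)) j) *\<^sub>R f k)"
    by (rule sum.swap)
  finally show ?case by (simp add: scaleR_sum_left)
qed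

lemma consensus_nonneg:
  fixes f :: "'m::finite \<Rightarrow> real"
  shows "(\<And>i j. W $ i $ j \<ge> 0) \<Longrightarrow> (\<And>i. f i \<ge> 0) \<Longrightarrow> consensus W T f i \<ge> 0"
  by (induction T arbitrary: i) (auto intro!: sum_nonneg)

lemma stochastic_row_sum:
  fixes W :: "real^'m^'m"
  shows "W *v (\<chi> i. 1) = (\<chi> i. 1) \<Longrightarrow> (\<Sum>j\<in>UNIV. W $ i $ j) = 1"
  by (simp add: matrix_vector_mult_def vec_eq_iff)

lemma consensus_weights_sum:
  fixes W :: "real^'m^'m"
  assumes "W *v (\<chi> i. 1) = (\<chi> i. 1)"
  shows "(\<Sum>k\<in>UNIV. consensus W T (\<lambda>j. of_bool (j = k)) i :: real) = 1"
proof -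
  have "consensus W T (\<lambda>_. 1 :: real) i = 1" for i
    by (induction T arbitrary: i) (simp_all add: stochastic_row_sum[OF assms])
  then show ?thesis
    using consensus_eq_weights[of W T "\<lambda>_. 1 :: real" i] by simp
qed

lemma consensus_spectral_matrix:
  fixes p :: "'m::finite \<Rightarrow> real^'m"
  assumes p: "orthonormal_family p"
  shows "consensus (spectral_matrix p d) T (\<lambda>j. of_bool (j = k)) i
    = (\<Sum>a\<in>UNIV. d a ^ T * (p a $ i * p a $ k))"
proof -
  let ?P = "\<lambda>T. spectral_matrix p (\<lambda>a. d a ^ T)"
  have "consensus (spectral_matrix p d) T (\<lambda>j. of_bool (j = k)) i = ?P T $ i $ k"
  proof (induction T arbitrary: i)
    case 0
    show ?case by (simp add: spectral_matrix_one[OF p] mat_def)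
  next
    case (Suc T)
    have "consensus (spectral_matrix p d) (Suc T) (\<lambda>j. of_bool (j = k)) i
        = (spectral_matrix p d ** ?P T) $ i $ k"
      by (simp add: Suc matrix_matrix_mult_def)
    then show ?case by (simp add: spectral_matrix_mult[OF p])
  qed
  then show ?thesis by (simp add: spectral_matrix_def outer_def)
qed

text \<open>The all-ones vector has eigenvalue 1, and \<open>rho W < 1\<close> leaves room for only
  one such index \<open>b\<close>; its rank-one part is the constant matrix with entries
  \<open>1 / m\<close>. The other eigenvalues have modulus at most \<open>rho W\<close>, and the
  products \<open>p a $ i * p a $ k\<close> sum in modulus to at most 1 because the rows of an
  orthogonal matrix are unit vectors.\<close>

lemma consensus_weights_bound:
  fixes W :: "real^'m^'m"
  assumes sym: "transpose W = W" and stoch: "W *v (\<chi> i. 1) = (\<chi> i. 1)" and rho: "rho W < 1"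
  shows "rho W \<ge> 0"
    and "\<bar>consensus W T (\<lambda>j. of_bool (j = k)) i - 1 / real CARD('m)\<bar> \<le> rho W ^ T"
proof -
  obtain p d where p: "orthonormal_family p" and W: "W = spectral_matrix p d"
    using symmetric_matrix_spectral[OF sym] by blast
  let ?one = "(\<chi> i. 1) :: real^'m"
  have coeff: "p a \<bullet> ?one = 0" if "d a \<noteq> 1" for a
    using inner_spectral_matrix[OF p, of a d ?one] stoch that by (simp flip: W)
  obtain b where b: "p b \<bullet> ?one \<noteq> 0"
    using orthonormal_family_expand[OF p, of ?one]
    by (metis (mono_tags, lifting) scaleR_zero_left sum.neutral vec_lambda_beta zero_index zero_neq_one)
  with coeff have db: "d b = 1" by metis
  have second: "eig_k W 2 \<le> rho W" by (simp add: rho_def)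
  have le: "d a \<le> rho W" if "a \<noteq> b" for a
    using spectral_eigenvalue_le_second[OF p, of d b a] second rho db that by (auto simp: W)
  have ge: "- d a \<le> rho W" for a
  proof -
    have "eig_k W CARD('m) \<le> d a" by (simp add: W eig_k_last_spectral_matrix[OF p])
    then show ?thesis by (simp add: rho_def)
  qed
  \<comment> \<open>A maximum of the second eigenvalue and minus the last is nonnegative because the
    second is at least the last. Truncated subtraction keeps the index in range for a single
    agent.\<close>
  have "eigs_sorted W ! 0 \<le> eigs_sorted W ! (CARD('m) - 2)"
    by (intro sorted_nth_mono) (auto simp: W length_eigs_sorted_spectral_matrix[OF p])
  then show rho0: "rho W \<ge> 0"
    by (simp add: rho_def eig_k_def)
  have one: "?one = (p b \<bullet> ?one) *\<^sub>R p b"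
  proof -
    have "p a \<bullet> ?one = 0" if "a \<noteq> b" for a
      using coeff le[OF that] rho by force
    then have "(\<Sum>a\<in>UNIV. (p a \<bullet> ?one) *\<^sub>R p a) = (\<Sum>a\<in>{b}. (p a \<bullet> ?one) *\<^sub>R p a)"
      by (intro sum.mono_neutral_right) auto
    then show ?thesis using orthonormal_family_expand[OF p, of ?one] by simp
  qed
  define s where "s = p b \<bullet> ?one"
  have s: "s * p b $ i = 1" for i
    using one by (metis s_def vec_lambda_beta vector_scaleR_component real_scaleR_def)
  have "s\<^sup>2 = ?one \<bullet> ?one"
    by (subst one) (simp add: s_def power2_eq_square inner_commute)
  then have s2: "s\<^sup>2 = real CARD('m)" by (simp add: inner_vec_def)
  have pb: "p b $ i * p b $ k = 1 / real CARD('m)" for i k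
    using s[of i] s[of k] s2 b[folded s_def] by (simp add: field_simps power2_eq_square) (metis mult.left_commute mult.right_neutral)
  have unit: "(\<Sum>a\<in>UNIV. (p a $ i)\<^sup>2) = 1" for i
    using orthonormal_parseval[OF p, of "axis i 1" "axis i 1"]
    by (simp add: inner_axis power2_eq_square)
  have "consensus W T (\<lambda>j. of_bool (j = k)) i - 1 / real CARD('m)
      = (\<Sum>a\<in>UNIV - {b}. d a ^ T * (p a $ i * p a $ k))"
    unfolding W consensus_spectral_matrix[OF p]
    by (subst sum.remove[of _ b]) (auto simp: db pb)
  also have "\<bar>\<dots>\<bar> \<le> (\<Sum>a\<in>UNIV - {b}. rho W ^ T * (((p a $ i)\<^sup>2 + (p a $ k)\<^sup>2) / 2))"
  proof (intro sum_abs[THEN order_trans] sum_mono)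
    fix a assume a: "a \<in> UNIV - {b}"
    have "\<bar>d a\<bar> \<le> rho W" using le[of a] ge[of a] a by auto
    then have "\<bar>d a\<bar> ^ T \<le> rho W ^ T" by (intro power_mono) auto
    moreover have "\<bar>p a $ i * p a $ k\<bar> \<le> ((p a $ i)\<^sup>2 + (p a $ k)\<^sup>2) / 2"
      using sum_squares_bound[of "\<bar>p a $ i\<bar>" "\<bar>p a $ k\<bar>"] by (simp add: abs_mult)
    ultimately show "\<bar>d a ^ T * (p a $ i * p a $ k)\<bar>
        \<le> rho W ^ T * (((p a $ i)\<^sup>2 + (p a $ k)\<^sup>2) / 2)"
      unfolding abs_mult[of "d a ^ T"] power_abs by (intro mult_mono) (auto simp: rho0)
  qed
  also have "\<dots> \<le> (\<Sum>a\<in>UNIV. rho W ^ T * (((p a $ i)\<^sup>2 + (p a $ k)\<^sup>2) / 2))"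
    using rho0 by (intro sum_mono2) auto
  also have "\<dots> = rho W ^ T"
    by (simp add: unit sum.distrib flip: sum_distrib_left sum_divide_distrib)
  finally show "\<bar>consensus W T (\<lambda>j. of_bool (j = k)) i - 1 / real CARD('m)\<bar> \<le> rho W ^ T" .
qed

section \<open>Nets of the unit sphere\<close>

text \<open>Volume comparison: balls of radius \<open>e / 2\<close> around separated points are
  disjoint and all lie in the ball of radius \<open>1 + e / 2\<close> about the origin.\<close>

lemma separated_subset_sphere_card:
  fixes N :: "'a::euclidean_space set"
  assumes fin: "finite N" and N: "N \<subseteq> sphere 0 1" and e: "e > 0"
    and sep: "\<And>x y. x \<in> N \<Longrightarrow> y \<in> N \<Longrightarrow> x \<noteq> y \<Longrightarrow> e < dist x y"
  shows "real (card N) \<le> (1 + 2 / e) ^ DIM('a)"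
proof -
  let ?V = "unit_ball_vol (real DIM('a))"
  have V: "?V > 0" by simp
  have ball: "emeasure lborel (ball x r) \<noteq> \<top>" for x :: 'a and r
    using emeasure_lborel_ball_finite[of x r] by auto
  have disj: "disjoint_family_on (\<lambda>x. ball x (e / 2)) N"
    unfolding disjoint_family_on_def
  proof (intro ballI impI)
    fix x y assume "x \<in> N" "y \<in> N" "x \<noteq> y"
    then have "e < dist x y" by (rule sep)
    show "ball x (e / 2) \<inter> ball y (e / 2) = {}"
    proof (rule ccontr)
      assume "ball x (e / 2) \<inter> ball y (e / 2) \<noteq> {}"
      then obtain z where "dist x z < e / 2" "dist y z < e / 2" by auto
      then show False
        using \<open>e < dist x y\<close> dist_triangle2[of x y z] by linarith
    qed
  qed
  have "real (card N) * (?V * (e / 2) ^ DIM('a)) = (\<Sum>x\<in>N. measure lborel (ball x (e / 2)))"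
    using e by (simp add: content_ball)
  also have "\<dots> = measure lborel (\<Union>x\<in>N. ball x (e / 2))"
    using fin disj by (intro measure_finite_Union[symmetric])
      (auto simp: ball)
  also have "\<dots> \<le> measure lborel (ball (0::'a) (1 + e / 2))"
  proof (intro measure_mono_fmeasurable subsetI)
    fix z assume "z \<in> (\<Union>x\<in>N. ball x (e / 2))"
    then obtain x where x: "x \<in> N" "dist x z < e / 2" by auto
    then have "norm x = 1" using N by auto
    with x show "z \<in> ball 0 (1 + e / 2)"
      using dist_triangle[of 0 z x] by (simp add: dist_norm)
  next
    show "(\<Union>x\<in>N. ball x (e / 2)) \<in> sets lborel" by (intro sets.finite_UN fin) auto
    show "ball (0::'a) (1 + e / 2) \<in> fmeasurable lborel"
      using emeasure_lborel_ball_finite[of "0::'a" "1 + e / 2"] by (intro fmeasurableI) auto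
  qed
  also have "\<dots> = ?V * (1 + e / 2) ^ DIM('a)"
    using e by (simp add: content_ball)
  finally have "real (card N) * (e / 2) ^ DIM('a) \<le> (1 + e / 2) ^ DIM('a)"
    using V by (simp add: mult.left_commute)
  also have "\<dots> = (1 + 2 / e) ^ DIM('a) * (e / 2) ^ DIM('a)"
  proof -
    have "(1 + 2 / e) * (e / 2) = 1 + e / 2" using e by (simp add: field_simps)
    then show ?thesis unfolding power_mult_distrib[symmetric] by (simp only:)
  qed
  finally show ?thesis using e by simp
qed

text \<open>A separated set of greatest cardinality is already a net, since a unit vector farther
  than \<open>e\<close> from all its points could be added.\<close>

lemma sphere_net:
  assumes e: "e > 0"
  obtains N :: "'a::euclidean_space set" where "finite N" "N \<subseteq> sphere 0 1"
    "real (card N) \<le> (1 + 2 / e) ^ DIM('a)"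
    "\<And>v. norm v = 1 \<Longrightarrow> \<exists>w\<in>N. norm (w - v) \<le> e"
proof -
  define sep where "sep N \<longleftrightarrow> finite N \<and> N \<subseteq> sphere 0 1 \<and>
      (\<forall>x\<in>N. \<forall>y\<in>N. x \<noteq> y \<longrightarrow> e < dist x y)" for N :: "'a set"
  have card: "real (card N) \<le> (1 + 2 / e) ^ DIM('a)" if "sep N" for N
    using that e by (intro separated_subset_sphere_card) (auto simp: sep_def)
  have "sep {}" by (simp add: sep_def)
  moreover have "card N < Suc (nat \<lfloor>(1 + 2 / e) ^ DIM('a)\<rfloor>)" if "sep N" for N
    using card[OF that] by (simp add: le_nat_floor less_Suc_eq_le)
  ultimately obtain N where N: "sep N" and max: "\<And>N'. sep N' \<Longrightarrow> card N' \<le> card N"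
    using ex_has_greatest_nat[of sep "{}" card] by metis
  have "\<exists>w\<in>N. norm (w - v) \<le> e" if v: "norm v = 1" for v
  proof (rule ccontr)
    assume far: "\<not> ?thesis"
    then have "sep (insert v N)"
      using N v e by (auto simp: sep_def dist_norm norm_minus_commute not_le)
    moreover have "v \<notin> N" using far e by force
    ultimately show False
      using max[of "insert v N"] N by (simp add: sep_def)
  qed
  with N card show ?thesis by (intro that[of N]) (auto simp: sep_def)
qed

text \<open>At an extremal eigenvector the quadratic form is flat to first order, so a net of mesh
  \<open>e\<close> only costs \<open>e\<^sup>2\<close>.\<close>

lemma quadratic_form_near_eigenvector:
  fixes A :: "real^'n^'n"
  assumes sym: "transpose A = A" and Av: "A *v v = c *\<^sub>R v" and "norm v = 1" "norm w = 1"
  shows "w \<bullet> (A *v w) - c = (w - v) \<bullet> (A *v (w - v)) - c * (norm (w - v))\<^sup>2"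
proof -
  have "v \<bullet> v = 1" "w \<bullet> w = 1" using assms by (simp_all add: norm_eq_1)
  moreover have "v \<bullet> (A *v w) = c * (v \<bullet> w)"
    using inner_symmetric_matrix[OF sym, of v w] Av by simp
  ultimately show ?thesis
    by (simp add: power2_norm_eq_inner inner_diff_left inner_diff_right Av
        matrix_vector_mult_diff_distrib inner_commute algebra_simps)
qed

lemma symmetric_matrix_extremal_eigenvectors:
  fixes A :: "real^'n^'n"
  assumes "transpose A = A"
  obtains v w a b where "norm v = 1" "A *v v = a *\<^sub>R v" "norm w = 1" "A *v w = b *\<^sub>R w"
    "\<And>u. a * (norm u)\<^sup>2 \<le> u \<bullet> (A *v u)" "\<And>u. u \<bullet> (A *v u) \<le> b * (norm u)\<^sup>2"
proof -
  have sym': "transpose (- A) = - A"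
    using assms by (simp add: transpose_def vec_eq_iff)
  obtain v where v: "norm v = 1" "A *v v = lambda_min A *\<^sub>R v"
    using lambda_min_attained[OF assms] .
  obtain w where w: "norm w = 1" "(- A) *v w = lambda_min (- A) *\<^sub>R w"
    using lambda_min_attained[OF sym'] .
  have neg: "(- A) *v u = - (A *v u)" for u
    by (simp add: matrix_vector_mult_def vec_eq_iff sum_negf)
  show ?thesis
  proof (rule that[OF v w(1)])
    show "A *v w = (- lambda_min (- A)) *\<^sub>R w"
      using w(2) by (simp add: neg) (metis minus_minus)
    show "lambda_min A * (norm u)\<^sup>2 \<le> u \<bullet> (A *v u)" for u
      using lambda_min_quadratic_le[OF assms, of u] by (simp add: power2_norm_eq_inner)
    show "u \<bullet> (A *v u) \<le> (- lambda_min (- A)) * (norm u)\<^sup>2" for u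
      using lambda_min_quadratic_le[OF sym', of u] by (simp add: power2_norm_eq_inner neg)
  qed
qed

text \<open>With extreme eigenvalues \<open>s1\<close> and \<open>s2\<close>, net points near their
  eigenvectors show that \<open>a - s1\<close> and \<open>s2 - b\<close> are at most
  \<open>e^2 * (s2 - s1)\<close>. Adding the two bounds the spread \<open>s2 - s1\<close> by
  \<open>(b - a) / (1 - 2 * e^2)\<close>, so it is two-sided control on the net that yields a lower
  bound off it.\<close>

lemma quadratic_form_net_lower:
  fixes A :: "real^'n^'n"
  assumes sym: "transpose A = A" and N: "\<And>w. w \<in> N \<Longrightarrow> norm w = 1"
    and net: "\<And>v. norm v = 1 \<Longrightarrow> \<exists>w\<in>N. norm (w - v) \<le> e" and e: "0 \<le> e" "2 * e\<^sup>2 < 1"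
    and lower: "\<And>w. w \<in> N \<Longrightarrow> a \<le> w \<bullet> (A *v w)" and upper: "\<And>w. w \<in> N \<Longrightarrow> w \<bullet> (A *v w) \<le> b"
  shows "(a - e\<^sup>2 * (b - a) / (1 - 2 * e\<^sup>2)) * (norm u)\<^sup>2 \<le> u \<bullet> (A *v u)"
proof -
  obtain v1 v2 s1 s2 where v: "norm v1 = 1" "A *v v1 = s1 *\<^sub>R v1" "norm v2 = 1" "A *v v2 = s2 *\<^sub>R v2"
    and s: "\<And>u. s1 * (norm u)\<^sup>2 \<le> u \<bullet> (A *v u)" "\<And>u. u \<bullet> (A *v u) \<le> s2 * (norm u)\<^sup>2"
    using symmetric_matrix_extremal_eigenvectors[OF sym] by metis
  have "s1 \<le> s2" using s(1)[of v1] s(2)[of v1] v by simp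
  have small: "(s2 - s1) * (norm (w - v))\<^sup>2 \<le> (s2 - s1) * e\<^sup>2" if "norm (w - v) \<le> e" for w v
    using that \<open>s1 \<le> s2\<close> by (intro mult_left_mono power_mono) auto
  obtain w1 where w1: "w1 \<in> N" "norm (w1 - v1) \<le> e" using net v by blast
  have "a - s1 \<le> (s2 - s1) * e\<^sup>2"
    using quadratic_form_near_eigenvector[OF sym v(2) v(1) N[OF w1(1)]] s(2)[of "w1 - v1"]
      small[OF w1(2)] lower[OF w1(1)] by (simp add: algebra_simps)
  moreover obtain w2 where w2: "w2 \<in> N" "norm (w2 - v2) \<le> e" using net v by blast
  have "s2 - b \<le> (s2 - s1) * e\<^sup>2"
    using quadratic_form_near_eigenvector[OF sym v(4) v(3) N[OF w2(1)]] s(1)[of "w2 - v2"]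
      small[OF w2(2)] upper[OF w2(1)] by (simp add: algebra_simps)
  ultimately have "(s2 - s1) * (1 - 2 * e\<^sup>2) \<le> b - a" and a: "a - s1 \<le> (s2 - s1) * e\<^sup>2"
    by (simp_all add: algebra_simps)
  then have "s2 - s1 \<le> (b - a) / (1 - 2 * e\<^sup>2)"
    using e by (simp add: pos_le_divide_eq)
  then have "(s2 - s1) * e\<^sup>2 \<le> (b - a) / (1 - 2 * e\<^sup>2) * e\<^sup>2"
    by (intro mult_right_mono) auto
  with a have "a - e\<^sup>2 * (b - a) / (1 - 2 * e\<^sup>2) \<le> s1" by (simp add: mult.commute)
  then show ?thesis
    using s(1)[of u] mult_right_mono[of _ s1 "(norm u)\<^sup>2"] by (meson order_trans zero_le_power2)
qed

text \<open>Semidefiniteness takes the place of lower control on the net: the form at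
  \<open>w - v\<close> is nonnegative, so passing from the top eigenvector to a net point loses at
  most \<open>s * e^2\<close>.\<close>

lemma quadratic_form_net_upper:
  fixes A :: "real^'n^'n"
  assumes sym: "transpose A = A" and N: "\<And>w. w \<in> N \<Longrightarrow> norm w = 1"
    and net: "\<And>v. norm v = 1 \<Longrightarrow> \<exists>w\<in>N. norm (w - v) \<le> e" and e: "0 \<le> e" "e < 1"
    and psd: "\<And>u. 0 \<le> u \<bullet> (A *v u)" and upper: "\<And>w. w \<in> N \<Longrightarrow> w \<bullet> (A *v w) \<le> b"
  shows "u \<bullet> (A *v u) \<le> b / (1 - e\<^sup>2) * (norm u)\<^sup>2"
proof -
  obtain v s where v: "norm v = 1" "A *v v = s *\<^sub>R v" and s: "\<And>u. u \<bullet> (A *v u) \<le> s * (norm u)\<^sup>2"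
    using symmetric_matrix_extremal_eigenvectors[OF sym] by metis
  have "s \<ge> 0" using psd[of v] s[of v] v(1) by simp
  obtain w where w: "w \<in> N" "norm (w - v) \<le> e" using net v by blast
  have "s * (norm (w - v))\<^sup>2 \<le> s * e\<^sup>2"
    using w \<open>s \<ge> 0\<close> by (intro mult_left_mono power_mono) auto
  then have "s - b \<le> s * e\<^sup>2"
    using quadratic_form_near_eigenvector[OF sym v(2) v(1) N[OF w(1)]] psd[of "w - v"]
      upper[OF w(1)] by (simp add: algebra_simps)
  moreover have "e\<^sup>2 < 1" using e by (simp add: power2_less_1_iff abs_square_less_1)
  ultimately have "s \<le> b / (1 - e\<^sup>2)"
    by (simp add: pos_le_divide_eq algebra_simps)
  then show ?thesis
    using s[of u] mult_right_mono[of s _ "(norm u)\<^sup>2"] by (meson order_trans zero_le_power2)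
qed

text \<open>A unit vector within \<open>e\<close> of the direction of \<open>x\<close> has inner
  product at least \<open>1 - e^2 / 2\<close> with that direction, so here too the mesh costs only
  second order.\<close>

lemma norm_net_upper:
  fixes x :: "'a::euclidean_space"
  assumes N: "\<And>w. w \<in> N \<Longrightarrow> norm w = 1" and net: "\<And>v. norm v = 1 \<Longrightarrow> \<exists>w\<in>N. norm (w - v) \<le> e"
    and e: "0 \<le> e" "e\<^sup>2 < 2" and upper: "\<And>w. w \<in> N \<Longrightarrow> w \<bullet> x \<le> b"
  shows "norm x * (1 - e\<^sup>2 / 2) \<le> b \<or> x = 0"
proof (cases "x = 0")
  case False
  define v where "v = x /\<^sub>R norm x"
  have v: "norm v = 1" "x = norm x *\<^sub>R v" using False by (simp_all add: v_def)
  obtain w where w: "w \<in> N" "norm (w - v) \<le> e" using net v by blast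
  have "(norm (w - v))\<^sup>2 = 2 - 2 * (w \<bullet> v)"
    using v(1) N[OF w(1)] by (simp add: power2_norm_eq_inner inner_diff_left inner_diff_right
        inner_commute norm_eq_1)
  moreover have "(norm (w - v))\<^sup>2 \<le> e\<^sup>2" using w(2) by (intro power_mono) auto
  ultimately have "1 - e\<^sup>2 / 2 \<le> w \<bullet> v" by simp
  then have "norm x * (1 - e\<^sup>2 / 2) \<le> norm x * (w \<bullet> v)" by (intro mult_left_mono) auto
  also have "\<dots> = w \<bullet> x" by (metis v(2) inner_scaleR_right)
  finally show ?thesis using upper[OF w(1)] by simp
qed simp

section \<open>Isotropic Gaussian vectors\<close>

lemma powr_minus_half_nat:
  fixes x :: real assumes "x > 0"
  shows "x powr (- real k / 2) = (1 / sqrt x) ^ k"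
proof -
  have "(1 / sqrt x) ^ k = (x powr (- (1/2))) powr real k"
    using assms by (simp add: powr_realpow powr_minus powr_half_sqrt inverse_eq_divide)
  also have "\<dots> = x powr (- (1/2) * real k)" by (rule powr_powr)
  finally show ?thesis by simp
qed

lemma gauss_iso_density_eq_prod:
  fixes mu :: "real^'n"
  assumes "s > 0"
  shows "gauss_iso_density mu s v = ennreal (\<Prod>b\<in>Basis. normal_density (mu \<bullet> b) s (v \<bullet> b))"
proof -
  have "(\<Prod>b\<in>Basis. normal_density (mu \<bullet> b) s (v \<bullet> b))
      = (1 / sqrt (2 * pi * s\<^sup>2)) ^ CARD('n) * exp (\<Sum>b\<in>Basis. - (v \<bullet> b - mu \<bullet> b)\<^sup>2 / (2 * s\<^sup>2))"
    by (simp add: normal_density_def prod_dividef exp_sum power_one_over)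
  also have "(\<Sum>b\<in>Basis. - (v \<bullet> b - mu \<bullet> b)\<^sup>2 / (2 * s\<^sup>2)) = - (norm (v - mu))\<^sup>2 / (2 * s\<^sup>2)"
  proof -
    have "(norm (v - mu))\<^sup>2 = (\<Sum>b\<in>Basis. (v \<bullet> b - mu \<bullet> b)\<^sup>2)"
      unfolding power2_norm_eq_inner euclidean_inner[of "v - mu" "v - mu"]
      by (simp add: inner_diff_left power2_eq_square)
    then show ?thesis by (simp add: sum_negf flip: sum_divide_distrib)
  qed
  also have "(1 / sqrt (2 * pi * s\<^sup>2)) ^ CARD('n) = (2 * pi * s\<^sup>2) powr (- real CARD('n) / 2)"
    using assms by (intro powr_minus_half_nat[symmetric]) simp
  finally show ?thesis by (simp add: gauss_iso_density_def)
qed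

context prob_space
begin

text \<open>Tonelli on a box, used twice: with all factors but one equal to \<open>UNIV\<close> it
  gives the law of a coordinate, and in full it then expresses independence of the
  coordinates.\<close>

lemma gauss_iso_emeasure_box:
  fixes X :: "'a \<Rightarrow> real^'n"
  assumes X: "distributed M lborel X (gauss_iso_density mu s)" and s: "s > 0"
    and A: "\<And>b. b \<in> Basis \<Longrightarrow> A b \<in> sets borel"
  shows "emeasure M {\<omega> \<in> space M. \<forall>b\<in>Basis. X \<omega> \<bullet> b \<in> A b}
    = (\<Prod>b\<in>Basis. emeasure (density lborel (normal_density (mu \<bullet> b) s)) (A b))"
proof -
  define B where "B = {v :: real^'n. \<forall>b\<in>Basis. v \<bullet> b \<in> A b}"
  have "B = (\<Inter>b\<in>Basis. (\<lambda>v. v \<bullet> b) -` A b)" by (auto simp: B_def)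
  also have "\<dots> \<in> sets borel"
    using A by (intro sets.finite_INT) (auto intro!: measurable_sets_borel[of _ borel])
  finally have B: "B \<in> sets lborel" by simp
  have "{\<omega> \<in> space M. \<forall>b\<in>Basis. X \<omega> \<bullet> b \<in> A b} = X -` B \<inter> space M"
    by (auto simp: B_def)
  then have "emeasure M {\<omega> \<in> space M. \<forall>b\<in>Basis. X \<omega> \<bullet> b \<in> A b}
      = (\<integral>\<^sup>+v. gauss_iso_density mu s v * indicator B v \<partial>lborel)"
    using distributed_emeasure[OF X B] by simp
  also have "\<dots> = (\<integral>\<^sup>+v. (\<Prod>b\<in>Basis. ennreal (normal_density (mu \<bullet> b) s (v \<bullet> b)) * indicator (A b) (v \<bullet> b)) \<partial>lborel)"
  proof (intro nn_integral_cong)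
    fix v :: "real^'n"
    have "(indicator B v :: ennreal) = (\<Prod>b\<in>Basis. indicator (A b) (v \<bullet> b))"
      by (auto simp: B_def indicator_def prod_zero_iff)
    then show "gauss_iso_density mu s v * indicator B v
        = (\<Prod>b\<in>Basis. ennreal (normal_density (mu \<bullet> b) s (v \<bullet> b)) * indicator (A b) (v \<bullet> b))"
      by (simp add: gauss_iso_density_eq_prod[OF s] prod.distrib prod_ennreal)
  qed
  also have "\<dots> = (\<Prod>b\<in>Basis. \<integral>\<^sup>+y. ennreal (normal_density (mu \<bullet> b) s y) * indicator (A b) y \<partial>lborel)"
    using A by (intro nn_integral_lborel_prod) auto
  also have "\<dots> = (\<Prod>b\<in>Basis. emeasure (density lborel (normal_density (mu \<bullet> b) s)) (A b))"
    using A by (intro prod.cong refl) (auto simp: emeasure_density)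
  finally show ?thesis .
qed

lemma gauss_iso_coordinate:
  fixes X :: "'a \<Rightarrow> real^'n"
  assumes X: "distributed M lborel X (gauss_iso_density mu s)" and s: "s > 0" and b: "b \<in> Basis"
  shows "distributed M lborel (\<lambda>\<omega>. X \<omega> \<bullet> b) (normal_density (mu \<bullet> b) s)"
proof -
  have [measurable]: "X \<in> borel_measurable M" using distributed_measurable[OF X] by simp
  have "distr M lborel (\<lambda>\<omega>. X \<omega> \<bullet> b) = density lborel (normal_density (mu \<bullet> b) s)"
  proof (rule measure_eqI)
    fix A assume "A \<in> sets (distr M lborel (\<lambda>\<omega>. X \<omega> \<bullet> b))"
    then have A: "A \<in> sets borel" by simp
    let ?A = "\<lambda>b'. if b' = b then A else UNIV"
    have one: "emeasure (density lborel (normal_density m s)) UNIV = 1" for m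
      using prob_space.emeasure_space_1[OF prob_space_normal_density[OF s, of m]] by simp
    have "emeasure (distr M lborel (\<lambda>\<omega>. X \<omega> \<bullet> b)) A = emeasure M {\<omega> \<in> space M. \<forall>b'\<in>Basis. X \<omega> \<bullet> b' \<in> ?A b'}"
      using A b by (subst emeasure_distr) (auto intro!: arg_cong[where f="emeasure M"])
    also have "\<dots> = (\<Prod>b'\<in>Basis. emeasure (density lborel (normal_density (mu \<bullet> b') s)) (?A b'))"
      using A by (intro gauss_iso_emeasure_box[OF X s]) auto
    also have "\<dots> = (\<Prod>b'\<in>Basis. if b' = b then emeasure (density lborel (normal_density (mu \<bullet> b) s)) A else 1)"
      by (intro prod.cong) (auto simp: one)
    also have "\<dots> = emeasure (density lborel (normal_density (mu \<bullet> b) s)) A"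
      using b by simp
    finally show "emeasure (distr M lborel (\<lambda>\<omega>. X \<omega> \<bullet> b)) A = \<dots>" .
  qed simp
  then show ?thesis by (simp add: distributed_def)
qed

lemma gauss_iso_indep_coordinates:
  fixes X :: "'a \<Rightarrow> real^'n"
  assumes X: "distributed M lborel X (gauss_iso_density mu s)" and s: "s > 0"
  shows "indep_vars (\<lambda>_. borel) (\<lambda>b \<omega>. X \<omega> \<bullet> b) Basis"
proof -
  have [measurable]: "X \<in> borel_measurable M" using distributed_measurable[OF X] by simp
  show ?thesis
  proof (subst indep_vars_finite[where E="\<lambda>_. sets borel"])
    show "\<forall>A\<in>Basis \<rightarrow> sets borel. prob (\<Inter>b\<in>Basis. (\<lambda>\<omega>. X \<omega> \<bullet> b) -` A b \<inter> space M)
        = (\<Prod>b\<in>Basis. prob ((\<lambda>\<omega>. X \<omega> \<bullet> b) -` A b \<inter> space M))"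
    proof
      fix A :: "real^'n \<Rightarrow> real set" assume A: "A \<in> Basis \<rightarrow> sets borel"
      have "(\<Inter>b\<in>Basis. (\<lambda>\<omega>. X \<omega> \<bullet> b) -` A b \<inter> space M) = {\<omega> \<in> space M. \<forall>b\<in>Basis. X \<omega> \<bullet> b \<in> A b}"
        by auto
      moreover have "emeasure (density lborel (normal_density (mu \<bullet> b) s)) (A b)
          = prob ((\<lambda>\<omega>. X \<omega> \<bullet> b) -` A b \<inter> space M)" if "b \<in> Basis" for b
        using distributed_distr_eq_density[OF gauss_iso_coordinate[OF X s that]] A that
        by (subst emeasure_eq_measure[symmetric], subst emeasure_distr[of _ M lborel, symmetric]) auto
      ultimately have "ennreal (prob (\<Inter>b\<in>Basis. (\<lambda>\<omega>. X \<omega> \<bullet> b) -` A b \<inter> space M))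
          = (\<Prod>b\<in>Basis. ennreal (prob ((\<lambda>\<omega>. X \<omega> \<bullet> b) -` A b \<inter> space M)))"
        using gauss_iso_emeasure_box[OF X s, of A] A
        by (simp add: emeasure_eq_measure Pi_def cong: prod.cong)
      then show "prob (\<Inter>b\<in>Basis. (\<lambda>\<omega>. X \<omega> \<bullet> b) -` A b \<inter> space M)
          = (\<Prod>b\<in>Basis. prob ((\<lambda>\<omega>. X \<omega> \<bullet> b) -` A b \<inter> space M))"
        by (simp add: prod_ennreal prod_nonneg)
    qed
  qed (auto simp: Int_stable_def sets.sigma_sets_eq[of borel, simplified])
qed

lemma gauss_iso_inner:
  fixes X :: "'a \<Rightarrow> real^'n"
  assumes X: "distributed M lborel X (gauss_iso_density mu s)" and s: "s > 0" and v: "v \<noteq> 0"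
  shows "distributed M lborel (\<lambda>\<omega>. v \<bullet> X \<omega>) (normal_density (v \<bullet> mu) (s * norm v))"
proof -
  \<comment> \<open>Coordinates with coefficient zero would contribute degenerate laws without a
    density, so they are dropped before independent normals are added.\<close>
  let ?I = "{b \<in> Basis. v \<bullet> b \<noteq> 0}"
  have sum_I: "(\<Sum>b\<in>?I. f b) = (\<Sum>b\<in>Basis. f b)" if "\<And>b. v \<bullet> b = 0 \<Longrightarrow> f b = 0" for f :: "real^'n \<Rightarrow> real"
    using that by (intro sum.mono_neutral_left) auto
  have "?I \<noteq> {}" using v euclidean_all_zero_iff by blast
  moreover have "indep_vars (\<lambda>_. borel) (\<lambda>b \<omega>. (v \<bullet> b) * (X \<omega> \<bullet> b)) ?I"
    by (rule indep_vars_compose2[where Y="\<lambda>b x. (v \<bullet> b) * x",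
        OF indep_vars_subset[OF gauss_iso_indep_coordinates[OF X s], of ?I]]) auto
  moreover have "distributed M lborel (\<lambda>\<omega>. (v \<bullet> b) * (X \<omega> \<bullet> b))
      (normal_density ((v \<bullet> b) * (mu \<bullet> b)) (\<bar>v \<bullet> b\<bar> * s))" if "b \<in> ?I" for b
    using normal_density_affine[OF gauss_iso_coordinate[OF X s], of b "v \<bullet> b" 0] that s by simp
  ultimately have "distributed M lborel (\<lambda>\<omega>. \<Sum>b\<in>?I. (v \<bullet> b) * (X \<omega> \<bullet> b))
      (normal_density (\<Sum>b\<in>?I. (v \<bullet> b) * (mu \<bullet> b)) (sqrt (\<Sum>b\<in>?I. (\<bar>v \<bullet> b\<bar> * s)\<^sup>2)))"
    using s by (intro sum_indep_normal) auto
  also have "(\<lambda>\<omega>. \<Sum>b\<in>?I. (v \<bullet> b) * (X \<omega> \<bullet> b)) = (\<lambda>\<omega>. v \<bullet> X \<omega>)"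
    by (subst sum_I) (auto simp flip: euclidean_inner)
  also have "(\<Sum>b\<in>?I. (v \<bullet> b) * (mu \<bullet> b)) = v \<bullet> mu"
    by (subst sum_I) (auto simp flip: euclidean_inner)
  also have "sqrt (\<Sum>b\<in>?I. (\<bar>v \<bullet> b\<bar> * s)\<^sup>2) = s * norm v"
  proof -
    have "(\<Sum>b\<in>?I. (\<bar>v \<bullet> b\<bar> * s)\<^sup>2) = s\<^sup>2 * (v \<bullet> v)"
      by (subst sum_I, simp) (simp add: euclidean_inner[of v v] power_mult_distrib sum_distrib_left
        power2_eq_square ac_simps)
    then show ?thesis using s by (simp add: norm_eq_sqrt_inner real_sqrt_mult)
  qed
  finally show ?thesis .
qed

end

lemma nn_integral_normal_density_exp:
  assumes "s > 0"
  shows "(\<integral>\<^sup>+y. ennreal (normal_density m s y) * ennreal (exp (c * y)) \<partial>lborel) = ennreal (exp (c * m + c\<^sup>2 * s\<^sup>2 / 2))"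
proof -
  have "normal_density m s y * exp (c * y) = exp (c * m + c\<^sup>2 * s\<^sup>2 / 2) * normal_density (m + c * s\<^sup>2) s y" for y
  proof -
    have "- (y - m)\<^sup>2 / (2 * s\<^sup>2) + c * y = (c * m + c\<^sup>2 * s\<^sup>2 / 2) + - (y - (m + c * s\<^sup>2))\<^sup>2 / (2 * s\<^sup>2)"
      using assms by (simp add: field_simps power2_eq_square)
    then show ?thesis
      unfolding normal_density_def by (simp add: mult.left_commute flip: exp_add)
  qed
  then have "(\<integral>\<^sup>+y. ennreal (normal_density m s y) * ennreal (exp (c * y)) \<partial>lborel)
      = (\<integral>\<^sup>+y. ennreal (exp (c * m + c\<^sup>2 * s\<^sup>2 / 2)) * ennreal (normal_density (m + c * s\<^sup>2) s y) \<partial>lborel)"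
    by (simp flip: ennreal_mult)
  also have "\<dots> = ennreal (exp (c * m + c\<^sup>2 * s\<^sup>2 / 2)) * (\<integral>\<^sup>+y. ennreal (normal_density (m + c * s\<^sup>2) s y) \<partial>lborel)"
    by (intro nn_integral_cmult) auto
  also have "(\<integral>\<^sup>+y. ennreal (normal_density (m + c * s\<^sup>2) s y) \<partial>lborel) = 1"
    using assms by (subst nn_integral_eq_integral) auto
  finally show ?thesis by simp
qed

lemma nn_integral_normal_density_exp_square:
  assumes s: "s > 0" and c: "2 * c * s\<^sup>2 < 1"
  shows "(\<integral>\<^sup>+y. ennreal (normal_density 0 s y) * ennreal (exp (c * y\<^sup>2)) \<partial>lborel)
    = ennreal (1 / sqrt (1 - 2 * c * s\<^sup>2))"
proof -
  define q where "q = 1 - 2 * c * s\<^sup>2"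
  \<comment> \<open>The weight \<open>exp (c * y^2)\<close> turns the density into a multiple of a
    centred normal density with variance \<open>s^2 / q\<close>; \<open>c\<close> may be
    negative.\<close>
  define r where "r = s / sqrt q"
  have q: "q > 0" using c by (simp add: q_def)
  have r: "r > 0" using s q by (simp add: r_def)
  have r2: "r\<^sup>2 = s\<^sup>2 / q" using q by (simp add: r_def power_divide)
  have "normal_density 0 s y * exp (c * y\<^sup>2) = (1 / sqrt q) * normal_density 0 r y" for y
  proof -
    have "- y\<^sup>2 / (2 * s\<^sup>2) + c * y\<^sup>2 = - y\<^sup>2 / (2 * r\<^sup>2)"
      using s q unfolding r2 by (simp add: q_def field_simps)
    then have "exp (- y\<^sup>2 / (2 * s\<^sup>2)) * exp (c * y\<^sup>2) = exp (- y\<^sup>2 / (2 * r\<^sup>2))"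
      by (simp flip: exp_add)
    moreover have "sqrt (2 * pi * s\<^sup>2) = sqrt q * sqrt (2 * pi * r\<^sup>2)"
      using q unfolding r2 by (simp flip: real_sqrt_mult)
    ultimately show ?thesis
      unfolding normal_density_def by simp
  qed
  then have "(\<integral>\<^sup>+y. ennreal (normal_density 0 s y) * ennreal (exp (c * y\<^sup>2)) \<partial>lborel)
      = (\<integral>\<^sup>+y. ennreal (1 / sqrt q) * ennreal (normal_density 0 r y) \<partial>lborel)"
    using q by (simp flip: ennreal_mult)
  also have "\<dots> = ennreal (1 / sqrt q) * (\<integral>\<^sup>+y. ennreal (normal_density 0 r y) \<partial>lborel)"
    by (intro nn_integral_cmult) auto
  also have "(\<integral>\<^sup>+y. ennreal (normal_density 0 r y) \<partial>lborel) = 1"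
    using r by (subst nn_integral_eq_integral) auto
  finally show ?thesis by (simp add: q_def)
qed

context prob_space
begin

lemma gauss_iso_exp_inner:
  fixes X :: "'a \<Rightarrow> real^'n"
  assumes X: "distributed M lborel X (gauss_iso_density mu s)" and s: "s > 0"
  shows "(\<integral>\<^sup>+\<omega>. ennreal (exp (v \<bullet> X \<omega>)) \<partial>M) = ennreal (exp (v \<bullet> mu + s\<^sup>2 * (norm v)\<^sup>2 / 2))"
proof (cases "v = 0")
  case True
  then show ?thesis by (simp add: emeasure_space_1)
next
  case False
  have "(\<integral>\<^sup>+\<omega>. ennreal (exp (1 * (v \<bullet> X \<omega>))) \<partial>M)
      = (\<integral>\<^sup>+y. ennreal (normal_density (v \<bullet> mu) (s * norm v) y) * ennreal (exp (1 * y)) \<partial>lborel)"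
    using distributed_nn_integral[OF gauss_iso_inner[OF X s False], of "\<lambda>y. ennreal (exp (1 * y))"] by simp
  also have "\<dots> = ennreal (exp (1 * (v \<bullet> mu) + 1\<^sup>2 * (s * norm v)\<^sup>2 / 2))"
    using s False by (intro nn_integral_normal_density_exp) auto
  finally show ?thesis by (simp add: power_mult_distrib)
qed

lemma gauss_iso_exp_square:
  fixes X :: "'a \<Rightarrow> real^'n"
  assumes X: "distributed M lborel X (gauss_iso_density mu s)" and s: "s > 0"
    and v: "norm v = 1" and c: "2 * c * s\<^sup>2 < 1"
  shows "(\<integral>\<^sup>+\<omega>. ennreal (exp (c * (v \<bullet> (X \<omega> - mu))\<^sup>2)) \<partial>M) = ennreal (1 / sqrt (1 - 2 * c * s\<^sup>2))"
proof -
  have "v \<noteq> 0" using v by auto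
  have "distributed M lborel (\<lambda>\<omega>. - (v \<bullet> mu) + 1 * (v \<bullet> X \<omega>)) (normal_density (- (v \<bullet> mu) + 1 * (v \<bullet> mu)) (\<bar>1\<bar> * s))"
    using gauss_iso_inner[OF X s \<open>v \<noteq> 0\<close>] v s by (intro normal_density_affine) auto
  then have "distributed M lborel (\<lambda>\<omega>. v \<bullet> (X \<omega> - mu)) (normal_density 0 s)"
    by (simp add: inner_diff_right)
  from distributed_nn_integral[OF this, of "\<lambda>y. ennreal (exp (c * y\<^sup>2))"] show ?thesis
    using nn_integral_normal_density_exp_square[OF s c] by simp
qed

text \<open>The Chernoff parameter is absorbed into \<open>Z\<close>, which allows either sign and
  index-dependent weights. Nonnegative integrals spare all integrability conditions.\<close>

lemma chernoff_bound_indep: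
  fixes Z :: "'i \<Rightarrow> 'a \<Rightarrow> real"
  assumes fin: "finite I" and indep: "indep_vars (\<lambda>_. borel) Z I"
    and le: "\<And>i. i \<in> I \<Longrightarrow> (\<integral>\<^sup>+\<omega>. ennreal (exp (Z i \<omega>)) \<partial>M) \<le> ennreal (f i)"
    and f: "\<And>i. i \<in> I \<Longrightarrow> 0 \<le> f i"
  shows "prob {\<omega> \<in> space M. s \<le> (\<Sum>i\<in>I. Z i \<omega>)} \<le> exp (- s) * (\<Prod>i\<in>I. f i)"
proof -
  have [measurable]: "Z i \<in> borel_measurable M" if "i \<in> I" for i
    using indep that by (auto simp: indep_vars_def)
  have indep': "indep_vars (\<lambda>_. borel) (\<lambda>i \<omega>. ennreal (exp (Z i \<omega>))) I"
    by (rule indep_vars_compose2[where Y="\<lambda>_ x. ennreal (exp x)", OF indep]) auto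
  have [measurable]: "(\<lambda>\<omega>. \<Sum>i\<in>I. Z i \<omega>) \<in> borel_measurable M" by auto
  have "ennreal (prob {\<omega> \<in> space M. s \<le> (\<Sum>i\<in>I. Z i \<omega>)})
      = emeasure M {\<omega> \<in> space M. 1 \<le> ennreal (exp (- s)) * ennreal (exp (\<Sum>i\<in>I. Z i \<omega>))}"
    unfolding emeasure_eq_measure[symmetric]
    by (intro arg_cong[where f="emeasure M"]) (auto simp flip: ennreal_mult exp_add)
  also have "\<dots> \<le> ennreal (exp (- s)) * (\<integral>\<^sup>+\<omega>. ennreal (exp (\<Sum>i\<in>I. Z i \<omega>)) * indicator (space M) \<omega> \<partial>M)"
    using nn_integral_Markov_inequality[of "\<lambda>\<omega>. ennreal (exp (\<Sum>i\<in>I. Z i \<omega>))" "space M" M "ennreal (exp (- s))"]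
    by simp
  also have "(\<integral>\<^sup>+\<omega>. ennreal (exp (\<Sum>i\<in>I. Z i \<omega>)) * indicator (space M) \<omega> \<partial>M)
      = (\<integral>\<^sup>+\<omega>. (\<Prod>i\<in>I. ennreal (exp (Z i \<omega>))) \<partial>M)"
    by (intro nn_integral_cong) (simp add: exp_sum[OF fin] prod_ennreal)
  also have "\<dots> = (\<Prod>i\<in>I. \<integral>\<^sup>+\<omega>. ennreal (exp (Z i \<omega>)) \<partial>M)"
    using fin indep' by (intro indep_vars_nn_integral) auto
  also have "\<dots> \<le> (\<Prod>i\<in>I. ennreal (f i))"
    using le by (intro prod_mono_ennreal) auto
  also have "\<dots> = ennreal (\<Prod>i\<in>I. f i)"
    using f by (intro prod_ennreal) auto
  finally have "ennreal (prob {\<omega> \<in> space M. s \<le> (\<Sum>i\<in>I. Z i \<omega>)}) \<le> ennreal (exp (- s) * (\<Prod>i\<in>I. f i))"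
    using f by (simp add: ennreal_mult prod_nonneg mult_left_mono)
  then show ?thesis
    using f by (simp add: prod_nonneg)
qed

end

section \<open>Gram matrices of noncentral Gaussian vectors\<close>

text \<open>These rational bounds decide the comparison of the net entropy
  \<open>2 * ln 5 * n\<close> with the exponents that \<open>8 * n + 16 * l \<le> t\<close>
  provides. They come from \<open>e < 2.72\<close> and from the quadratic Taylor bound at
  \<open>163 / 800\<close>, raised to integer powers.\<close>

lemma ln_5_bounds: "16/10 \<le> ln (5::real)" "ln (5::real) \<le> 163/100"
proof -
  have "exp (8/5 :: real) ^ 5 = exp 1 ^ 8"
    by (simp flip: exp_of_nat_mult)
  also have "\<dots> \<le> (272/100) ^ 8"
    using e_less_272 by (intro power_mono) auto
  also have "\<dots> \<le> (5::real) ^ 5" by (simp add: power_divide)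
  finally have "exp (8/5 :: real) \<le> 5" by (rule power_le_imp_le_base[where n=4, simplified]) simp_all
  then show "16/10 \<le> ln (5::real)" by (subst ln_ge_iff) simp_all
  have "5 \<le> (1 + 163/800 + (163/800)\<^sup>2 / 2 :: real) ^ 8" by (simp add: power2_eq_square field_simps)
  also have "\<dots> \<le> exp (163/800) ^ 8"
    using exp_lower_Taylor_quadratic[of "163/800"] by (intro power_mono) auto
  also have "\<dots> = exp (163/100 :: real)" by (simp flip: exp_of_nat_mult)
  finally show "ln (5::real) \<le> 163/100" by (metis ln_exp ln_mono zero_less_numeral)
qed

lemma ln_3_le: "ln (3::real) \<le> 115/100"
proof -
  have "3 \<le> (1 + 115/800 + (115/800)\<^sup>2 / 2 :: real) ^ 8" by (simp add: power2_eq_square field_simps)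
  also have "\<dots> \<le> exp (115/800) ^ 8"
    using exp_lower_Taylor_quadratic[of "115/800"] by (intro power_mono) auto
  also have "\<dots> = exp (115/100 :: real)" by (simp flip: exp_of_nat_mult)
  finally show ?thesis by (metis ln_exp ln_mono zero_less_numeral)
qed

context prob_space
begin

context
  fixes X :: "'i \<Rightarrow> 'a \<Rightarrow> real^'n" and mu :: "'i \<Rightarrow> real^'n" and J :: "'i set" and s :: real
  assumes fin: "finite J" and indep: "indep_vars (\<lambda>_. borel) X J" and s: "s > 0"
    and X: "\<And>j. j \<in> J \<Longrightarrow> distributed M lborel (X j) (gauss_iso_density (mu j) s)"
begin

text \<open>A negative \<open>c\<close> turns this into a lower-tail bound for the sum of squares, a
  positive one into an upper-tail bound.\<close>

lemma gauss_iso_square_sum_tail: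
  assumes v: "norm v = 1" and c: "2 * c * s\<^sup>2 < 1"
  shows "prob {\<omega> \<in> space M. r \<le> (\<Sum>j\<in>J. c * (v \<bullet> (X j \<omega> - mu j))\<^sup>2)}
    \<le> exp (- r) * (1 / sqrt (1 - 2 * c * s\<^sup>2)) ^ card J"
proof -
  have "prob {\<omega> \<in> space M. r \<le> (\<Sum>j\<in>J. c * (v \<bullet> (X j \<omega> - mu j))\<^sup>2)}
      \<le> exp (- r) * (\<Prod>j\<in>J. 1 / sqrt (1 - 2 * c * s\<^sup>2))"
  proof (rule chernoff_bound_indep[OF fin])
    show "indep_vars (\<lambda>_. borel) (\<lambda>j \<omega>. c * (v \<bullet> (X j \<omega> - mu j))\<^sup>2) J"
      by (rule indep_vars_compose2[where Y="\<lambda>j x. c * (v \<bullet> (x - mu j))\<^sup>2", OF indep]) auto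
    show "(\<integral>\<^sup>+\<omega>. ennreal (exp (c * (v \<bullet> (X j \<omega> - mu j))\<^sup>2)) \<partial>M) \<le> ennreal (1 / sqrt (1 - 2 * c * s\<^sup>2))"
      if "j \<in> J" for j
      using gauss_iso_exp_square[OF X[OF that] s v c] by simp
  qed (use c in auto)
  then show ?thesis by simp
qed

lemma gauss_iso_linear_sum_tail:
  "prob {\<omega> \<in> space M. r \<le> (\<Sum>j\<in>J. w j \<bullet> (X j \<omega> - mu j))}
    \<le> exp (- r + s\<^sup>2 * (\<Sum>j\<in>J. (norm (w j))\<^sup>2) / 2)"
proof -
  have "prob {\<omega> \<in> space M. r \<le> (\<Sum>j\<in>J. w j \<bullet> (X j \<omega> - mu j))}
      \<le> exp (- r) * (\<Prod>j\<in>J. exp (s\<^sup>2 * (norm (w j))\<^sup>2 / 2))"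
  proof (rule chernoff_bound_indep[OF fin])
    show "indep_vars (\<lambda>_. borel) (\<lambda>j \<omega>. w j \<bullet> (X j \<omega> - mu j)) J"
      by (rule indep_vars_compose2[where Y="\<lambda>j x. w j \<bullet> (x - mu j)", OF indep]) auto
    show "(\<integral>\<^sup>+\<omega>. ennreal (exp (w j \<bullet> (X j \<omega> - mu j))) \<partial>M) \<le> ennreal (exp (s\<^sup>2 * (norm (w j))\<^sup>2 / 2))"
      if "j \<in> J" for j
    proof -
      have [measurable]: "X j \<in> borel_measurable M" using distributed_measurable[OF X[OF that]] by simp
      have "(\<integral>\<^sup>+\<omega>. ennreal (exp (w j \<bullet> (X j \<omega> - mu j))) \<partial>M)
          = (\<integral>\<^sup>+\<omega>. ennreal (exp (- (w j \<bullet> mu j))) * ennreal (exp (w j \<bullet> X j \<omega>)) \<partial>M)"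
        by (intro nn_integral_cong) (simp add: inner_diff_right flip: ennreal_mult exp_add)
      also have "\<dots> = ennreal (exp (- (w j \<bullet> mu j))) * (\<integral>\<^sup>+\<omega>. ennreal (exp (w j \<bullet> X j \<omega>)) \<partial>M)"
        by (intro nn_integral_cmult) auto
      also have "\<dots> = ennreal (exp (s\<^sup>2 * (norm (w j))\<^sup>2 / 2))"
        by (simp add: gauss_iso_exp_inner[OF X[OF that] s] flip: ennreal_mult exp_add)
      finally show ?thesis by simp
    qed
  qed auto
  also have "(\<Prod>j\<in>J. exp (s\<^sup>2 * (norm (w j))\<^sup>2 / 2)) = exp (s\<^sup>2 * (\<Sum>j\<in>J. (norm (w j))\<^sup>2) / 2)"
    by (simp add: exp_sum[OF fin, symmetric] sum_distrib_left sum_divide_distrib)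
  finally show ?thesis by (simp only: exp_add)
qed

text \<open>Each event must be rarer than the net is large: \<open>2 * ln 5 * n\<close> pays for
  \<open>25 ^ CARD('n)\<close> net points, and \<open>l\<close> leaves a factor
  \<open>d / 2\<close>. For the two events on squares the optimal Chernoff parameters are taken,
  \<open>- 2 / s^2\<close> for the level \<open>1/5\<close> and \<open>1 / (3 * s^2)\<close> for the
  level \<open>3\<close>.\<close>

lemma gauss_iso_gram_net_events:
  fixes d :: real
  defines "t \<equiv> real (card J)" and "n \<equiv> real CARD('n)" and "l \<equiv> ln (2 / d)"
  assumes v: "norm v = 1" and d: "0 < d" "d < 1" and B: "\<And>j. j \<in> J \<Longrightarrow> norm (mu j) \<le> B"
    and t1: "8 * n + 16 * l \<le> t" and t2: "256 * B\<^sup>2 * (4 * n + 2 * l) \<le> t * s\<^sup>2"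
  shows "prob {\<omega> \<in> space M. (\<Sum>j\<in>J. (v \<bullet> (X j \<omega> - mu j))\<^sup>2) \<le> t * s\<^sup>2 / 5} \<le> exp (- (2 * ln 5 * n + l))"
    and "prob {\<omega> \<in> space M. 3 * t * s\<^sup>2 \<le> (\<Sum>j\<in>J. (v \<bullet> (X j \<omega> - mu j))\<^sup>2)} \<le> exp (- (2 * ln 5 * n + l))"
    and "\<bar>a\<bar> = 1 \<Longrightarrow> prob {\<omega> \<in> space M. 4 / 25 * t * s\<^sup>2 \<le> (\<Sum>j\<in>J. a * (2 * (v \<bullet> mu j) * (v \<bullet> (X j \<omega> - mu j))))}
      \<le> exp (- (2 * ln 5 * n + l))"
proof -
  have l: "l > 0" using d by (simp add: l_def)
  have n: "n > 0" by (simp add: n_def)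
  have t: "t > 0" using t1 n l by linarith
  have ln5: "16/10 \<le> ln (5::real)" "ln (5::real) \<le> 163/100" by (rule ln_5_bounds)+
  have pow: "y ^ card J = exp (t * ln y)" if "y > 0" for y
    using that by (simp add: t_def exp_of_nat_mult)
  have "{\<omega> \<in> space M. (\<Sum>j\<in>J. (v \<bullet> (X j \<omega> - mu j))\<^sup>2) \<le> t * s\<^sup>2 / 5}
      = {\<omega> \<in> space M. - (2 * t / 5) \<le> (\<Sum>j\<in>J. (- 2 / s\<^sup>2) * (v \<bullet> (X j \<omega> - mu j))\<^sup>2)}"
    unfolding sum_distrib_left[symmetric] using s by (intro Collect_cong conj_cong refl) (simp add: field_simps)
  then have "prob {\<omega> \<in> space M. (\<Sum>j\<in>J. (v \<bullet> (X j \<omega> - mu j))\<^sup>2) \<le> t * s\<^sup>2 / 5}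
      \<le> exp (2 * t / 5) * (1 / sqrt 5) ^ card J"
    using gauss_iso_square_sum_tail[of v "- 2 / s\<^sup>2" "- (2 * t / 5)"] v s by simp
  also have "\<dots> = exp (- (t * (ln 5 / 2 - 2 / 5)))"
  proof -
    have "ln (1 / sqrt 5) = - (ln 5 / 2 :: real)" by (simp add: ln_div ln_sqrt)
    then have "(1 / sqrt 5) ^ card J = exp (t * - (ln 5 / 2))" using pow[of "1 / sqrt 5"] by simp
    then show ?thesis unfolding exp_add[symmetric] by (simp add: algebra_simps flip: exp_add)
  qed
  also have "\<dots> \<le> exp (- (2 * ln 5 * n + l))"
  proof -
    have "(8 * n + 16 * l) * (ln 5 / 2 - 2 / 5) \<le> t * (ln 5 / 2 - 2 / 5)"
      using t1 ln5 by (intro mult_right_mono) auto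
    moreover have "0 \<le> (2 * ln 5 - 32 / 10) * n" "0 \<le> (8 * ln 5 - 74 / 10) * l"
      using ln5 n l by simp_all
    ultimately show ?thesis by (simp add: algebra_simps)
  qed
  finally show "prob {\<omega> \<in> space M. (\<Sum>j\<in>J. (v \<bullet> (X j \<omega> - mu j))\<^sup>2) \<le> t * s\<^sup>2 / 5}
      \<le> exp (- (2 * ln 5 * n + l))" .
  have "{\<omega> \<in> space M. 3 * t * s\<^sup>2 \<le> (\<Sum>j\<in>J. (v \<bullet> (X j \<omega> - mu j))\<^sup>2)}
      = {\<omega> \<in> space M. t \<le> (\<Sum>j\<in>J. (1 / (3 * s\<^sup>2)) * (v \<bullet> (X j \<omega> - mu j))\<^sup>2)}"
    unfolding sum_distrib_left[symmetric] using s by (intro Collect_cong conj_cong refl) (simp add: field_simps)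
  then have "prob {\<omega> \<in> space M. 3 * t * s\<^sup>2 \<le> (\<Sum>j\<in>J. (v \<bullet> (X j \<omega> - mu j))\<^sup>2)}
      \<le> exp (- t) * (1 / sqrt (1 / 3)) ^ card J"
    using gauss_iso_square_sum_tail[of v "1 / (3 * s\<^sup>2)" t] v s by simp
  also have "\<dots> = exp (- (t * (1 - ln 3 / 2)))"
  proof -
    have "ln (1 / sqrt (1 / 3)) = (ln 3 / 2 :: real)" by (simp add: real_sqrt_divide ln_sqrt)
    then have "(1 / sqrt (1 / 3)) ^ card J = exp (t * (ln 3 / 2))" using pow[of "1 / sqrt (1 / 3)"] by simp
    then show ?thesis by (simp add: algebra_simps flip: exp_add)
  qed
  also have "\<dots> \<le> exp (- (2 * ln 5 * n + l))"
  proof -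
    have "(8 * n + 16 * l) * (1 - ln 3 / 2) \<le> t * (1 - ln 3 / 2)"
      using t1 ln_3_le by (intro mult_right_mono) auto
    moreover have "0 \<le> (8 - 4 * ln 3 - 2 * ln 5) * n" "0 \<le> (15 - 8 * ln 3) * l"
      using ln5 n l ln_3_le by simp_all
    ultimately show ?thesis by (simp add: algebra_simps)
  qed
  finally show "prob {\<omega> \<in> space M. 3 * t * s\<^sup>2 \<le> (\<Sum>j\<in>J. (v \<bullet> (X j \<omega> - mu j))\<^sup>2)}
      \<le> exp (- (2 * ln 5 * n + l))" .
  assume a: "\<bar>a\<bar> = 1"
  define D where "D = 4 * n + 2 * l"
  have D: "D > 0" using n l by (simp add: D_def)
  \<comment> \<open>Once the means are bounded through \<open>t2\<close>, the exponent is
    \<open>- (4/25) * c * y + (c * y)^2 / (128 * D)\<close> with \<open>y = t * s^2\<close>. This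
    \<open>c\<close> is its minimiser, and the minimum \<open>- (8192 / 10000) * D\<close> just
    suffices, since \<open>2 * ln 5 < 3.2768\<close>.\<close>
  define c where "c = (1024 / 100) * D / (t * s\<^sup>2)"
  have c: "c > 0" using D t s by (simp add: c_def)
  define w where "w j = (c * a * (2 * (v \<bullet> mu j))) *\<^sub>R v" for j
  have w_inner: "w j \<bullet> x = c * (a * (2 * (v \<bullet> mu j) * (v \<bullet> x)))" for j x
    by (simp add: w_def)
  have "{\<omega> \<in> space M. 4 / 25 * t * s\<^sup>2 \<le> (\<Sum>j\<in>J. a * (2 * (v \<bullet> mu j) * (v \<bullet> (X j \<omega> - mu j))))}
      = {\<omega> \<in> space M. c * (4 / 25 * t * s\<^sup>2) \<le> (\<Sum>j\<in>J. w j \<bullet> (X j \<omega> - mu j))}"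
    unfolding w_inner sum_distrib_left[symmetric]
    by (intro Collect_cong conj_cong refl) (simp only: mult_le_cancel_left_pos[OF c])
  then have "prob {\<omega> \<in> space M. 4 / 25 * t * s\<^sup>2 \<le> (\<Sum>j\<in>J. a * (2 * (v \<bullet> mu j) * (v \<bullet> (X j \<omega> - mu j))))}
      \<le> exp (- (c * (4 / 25 * t * s\<^sup>2)) + s\<^sup>2 * (\<Sum>j\<in>J. (norm (w j))\<^sup>2) / 2)"
    using gauss_iso_linear_sum_tail[of "c * (4 / 25 * t * s\<^sup>2)" w] by (simp only:)
  also have "\<dots> \<le> exp (- (2 * ln 5 * n + l))"
  proof -
    have "(norm (w j))\<^sup>2 \<le> 4 * c\<^sup>2 * B\<^sup>2" if "j \<in> J" for j
    proof -
      have "\<bar>v \<bullet> mu j\<bar> \<le> B"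
        using Cauchy_Schwarz_ineq2[of v "mu j"] v B[OF that] by simp
      then have "(v \<bullet> mu j)\<^sup>2 \<le> B\<^sup>2" by (metis abs_ge_zero power2_abs power_mono)
      moreover have "(norm (w j))\<^sup>2 = 4 * c\<^sup>2 * (v \<bullet> mu j)\<^sup>2"
        using v a by (simp add: w_def power_mult_distrib abs_mult)
      ultimately show ?thesis by (simp add: mult_left_mono)
    qed
    then have "(\<Sum>j\<in>J. (norm (w j))\<^sup>2) \<le> t * (4 * c\<^sup>2 * B\<^sup>2)"
      using sum_bounded_above[of J "\<lambda>j. (norm (w j))\<^sup>2" "4 * c\<^sup>2 * B\<^sup>2"] by (simp add: t_def)
    then have "s\<^sup>2 * (\<Sum>j\<in>J. (norm (w j))\<^sup>2) / 2 \<le> s\<^sup>2 * (t * (4 * c\<^sup>2 * B\<^sup>2)) / 2"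
      by (intro divide_right_mono mult_left_mono) auto
    also have "\<dots> = (t * s\<^sup>2 * c\<^sup>2 / (128 * D)) * (256 * B\<^sup>2 * D)"
      using D by (simp add: field_simps)
    also have "\<dots> \<le> (t * s\<^sup>2 * c\<^sup>2 / (128 * D)) * (t * s\<^sup>2)"
      using t2 t D by (intro mult_left_mono) (auto simp: D_def)
    also have "\<dots> = 8192 / 10000 * D"
      using t s D by (simp add: c_def field_simps power2_eq_square)
    finally have "s\<^sup>2 * (\<Sum>j\<in>J. (norm (w j))\<^sup>2) / 2 \<le> 8192 / 10000 * D" .
    moreover have "c * (4 / 25 * t * s\<^sup>2) = 16384 / 10000 * D"
      using t s by (simp add: c_def field_simps)
    moreover have "0 \<le> (32768 / 10000 - 2 * ln 5) * n" using ln5 n by simp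
    ultimately show ?thesis using l by (simp add: D_def algebra_simps)
  qed
  finally show "prob {\<omega> \<in> space M. 4 / 25 * t * s\<^sup>2 \<le> (\<Sum>j\<in>J. a * (2 * (v \<bullet> mu j) * (v \<bullet> (X j \<omega> - mu j))))}
      \<le> exp (- (2 * ln 5 * n + l))" .
qed

text \<open>The cross terms between means and fluctuations are controlled only at the points of the net,
  where they are scalar Gaussians; the mesh \<open>1/12\<close> and the constants \<open>1/5\<close>, \<open>3\<close>, \<open>4/25\<close> balance the
  entropy \<open>n ln 25\<close> of the net against the three tail bounds.\<close>

lemma gauss_iso_gram_lower_bound:
  fixes d :: real
  defines "t \<equiv> real (card J)" and "n \<equiv> real CARD('n)" and "l \<equiv> ln (2 / d)"
  assumes d: "0 < d" "d < 1" and B: "\<And>j. j \<in> J \<Longrightarrow> norm (mu j) \<le> B"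
    and t1: "8 * n + 16 * l \<le> t" and t2: "256 * B\<^sup>2 * (4 * n + 2 * l) \<le> t * s\<^sup>2"
  obtains Q where "Q \<in> events" "prob Q \<le> 2 * d"
    "\<And>\<omega> v. \<omega> \<in> space M - Q \<Longrightarrow>
      t * s\<^sup>2 / 64 * (norm v)\<^sup>2 + (\<Sum>j\<in>J. (v \<bullet> mu j)\<^sup>2) \<le> (\<Sum>j\<in>J. (v \<bullet> X j \<omega>)\<^sup>2)"
proof -
  have [measurable]: "X j \<in> borel_measurable M" if "j \<in> J" for j
    using distributed_measurable[OF X[OF that]] by simp
  obtain N :: "(real^'n) set" where N: "finite N" "N \<subseteq> sphere 0 1" "real (card N) \<le> (1 + 2 / (1/12)) ^ DIM(real^'n)"
    and net: "\<And>v. norm v = 1 \<Longrightarrow> \<exists>w\<in>N. norm (w - v) \<le> 1/12"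
    using sphere_net[of "1/12", where 'a="real^'n"] by (metis zero_less_divide_1_iff zero_less_numeral)
  define Z where "Z v j \<omega> = v \<bullet> (X j \<omega> - mu j)" for v j \<omega>
  define F where "F v = {\<omega> \<in> space M. (\<Sum>j\<in>J. (Z v j \<omega>)\<^sup>2) \<le> t * s\<^sup>2 / 5}
    \<union> {\<omega> \<in> space M. 3 * t * s\<^sup>2 \<le> (\<Sum>j\<in>J. (Z v j \<omega>)\<^sup>2)}
    \<union> {\<omega> \<in> space M. 4 / 25 * t * s\<^sup>2 \<le> (\<Sum>j\<in>J. 1 * (2 * (v \<bullet> mu j) * Z v j \<omega>))}
    \<union> {\<omega> \<in> space M. 4 / 25 * t * s\<^sup>2 \<le> (\<Sum>j\<in>J. (- 1) * (2 * (v \<bullet> mu j) * Z v j \<omega>))}" for v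
  have F [measurable]: "F v \<in> events" for v unfolding F_def Z_def by measurable
  let ?q = "exp (- (2 * ln 5 * n + l))"
  have F_le: "prob (F v) \<le> 4 * ?q" if "v \<in> N" for v
  proof -
    have v: "norm v = 1" using that N by auto
    note ev = gauss_iso_gram_net_events[OF v d B t1[unfolded t_def n_def l_def] t2[unfolded t_def n_def l_def],
        folded t_def n_def l_def Z_def]
    have le: "prob (A \<union> B) \<le> a + b" if "prob A \<le> a" "prob B \<le> b" "A \<in> events" "B \<in> events" for A B a b
      using measure_Un_le[of A M B] that by linarith
    have "prob (F v) \<le> ?q + ?q + ?q + ?q"
      unfolding F_def by (intro le ev) (auto simp: Z_def)
    then show ?thesis by simp
  qed
  define Q where "Q = (\<Union>v\<in>N. F v)"
  show ?thesis
  proof (rule that[of Q])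
    show "Q \<in> events" unfolding Q_def using N by auto
    have "prob Q \<le> (\<Sum>v\<in>N. prob (F v))"
      unfolding Q_def using N by (intro measure_UNION_le) auto
    also have "\<dots> \<le> real (card N) * (4 * ?q)"
      using sum_bounded_above[of N "\<lambda>v. prob (F v)" "4 * ?q"] F_le by simp
    also have "\<dots> \<le> 25 ^ CARD('n) * (4 * ?q)"
      using N(3) by (intro mult_right_mono) simp_all
    \<comment> \<open>Since \<open>1 + 2 / (1/12) = 25\<close>, the entropy of the net cancels and
      the four events leave \<open>4 * (d / 2)\<close>.\<close>
    also have "?q = d / 2 / 25 ^ CARD('n)"
    proof -
      have "exp (2 * ln 5 * n) = exp (ln 25) ^ CARD('n)"
        by (simp add: n_def ln_realpow[of 5 2, simplified] flip: exp_of_nat_mult)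
      moreover have "exp l = 2 / d" using d by (simp add: l_def)
      moreover have "?q = inverse (exp (2 * ln 5 * n) * exp l)" by (simp only: exp_minus exp_add)
      ultimately show ?thesis using d by (simp only:) (simp add: field_simps)
    qed
    finally show "prob Q \<le> 2 * d" by simp
    fix \<omega> v assume \<omega>: "\<omega> \<in> space M - Q"
    \<comment> \<open>Only the difference of the two Gram matrices is compared on the net, so the
      Gram form of the means survives in the conclusion with coefficient 1.\<close>
    define S where "S = (\<Sum>j\<in>J. outer (X j \<omega>) (X j \<omega>)) - (\<Sum>j\<in>J. outer (mu j) (mu j))"
    have S_quad: "w \<bullet> (S *v w) = (\<Sum>j\<in>J. (w \<bullet> X j \<omega>)\<^sup>2) - (\<Sum>j\<in>J. (w \<bullet> mu j)\<^sup>2)" for w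
      by (simp add: S_def matrix_vector_mult_diff_rdistrib sum_matrix_vector_mult inner_diff_right
          inner_sum_right inner_outer_mult_vec power2_eq_square inner_commute)
    have sym: "transpose S = S"
      by (simp add: S_def transpose_def vec_eq_iff outer_def mult.commute)
    have bounds: "1 / 25 * (t * s\<^sup>2) \<le> w \<bullet> (S *v w)" "w \<bullet> (S *v w) \<le> 79 / 25 * (t * s\<^sup>2)" if "w \<in> N" for w
    proof -
      have "(w \<bullet> X j \<omega>)\<^sup>2 - (w \<bullet> mu j)\<^sup>2 = (Z w j \<omega>)\<^sup>2 + 2 * (w \<bullet> mu j) * Z w j \<omega>" for j
        by (simp add: Z_def inner_diff_right power2_eq_square algebra_simps)
      then have "w \<bullet> (S *v w) = (\<Sum>j\<in>J. (Z w j \<omega>)\<^sup>2) + (\<Sum>j\<in>J. 2 * (w \<bullet> mu j) * Z w j \<omega>)"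
        unfolding S_quad by (simp flip: sum_subtractf sum.distrib)
      moreover have "\<omega> \<notin> F w" "\<omega> \<in> space M" using \<omega> that by (auto simp: Q_def)
      then have "t * s\<^sup>2 / 5 < (\<Sum>j\<in>J. (Z w j \<omega>)\<^sup>2)" "(\<Sum>j\<in>J. (Z w j \<omega>)\<^sup>2) < 3 * t * s\<^sup>2"
        "(\<Sum>j\<in>J. 2 * (w \<bullet> mu j) * Z w j \<omega>) < 4 / 25 * t * s\<^sup>2"
        "- (\<Sum>j\<in>J. 2 * (w \<bullet> mu j) * Z w j \<omega>) < 4 / 25 * t * s\<^sup>2"
        by (auto simp: F_def not_le sum_negf)
      ultimately show "1 / 25 * (t * s\<^sup>2) \<le> w \<bullet> (S *v w)" "w \<bullet> (S *v w) \<le> 79 / 25 * (t * s\<^sup>2)"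
        by (simp_all add: algebra_simps)
    qed
    have "(1 / 25 * (t * s\<^sup>2) - (1/12)\<^sup>2 * (79 / 25 * (t * s\<^sup>2) - 1 / 25 * (t * s\<^sup>2)) / (1 - 2 * (1/12)\<^sup>2)) * (norm v)\<^sup>2
        \<le> v \<bullet> (S *v v)"
      by (rule quadratic_form_net_lower[OF sym _ net _ _ bounds]) (use N in \<open>auto simp: power2_eq_square\<close>)
    \<comment> \<open>The fraction of \<open>t * s^2\<close> left by the net is
      \<open>(1/25) * (1 - 78/142) = 64/3550\<close>, slightly more than
      \<open>1/64\<close>.\<close>
    moreover have "t * s\<^sup>2 / 64 \<le> 1 / 25 * (t * s\<^sup>2) - (1/12)\<^sup>2 * (79 / 25 * (t * s\<^sup>2) - 1 / 25 * (t * s\<^sup>2)) / (1 - 2 * (1/12)\<^sup>2)"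
    proof -
      have "y / 64 \<le> 1 / 25 * y - (1/12)\<^sup>2 * (79 / 25 * y - 1 / 25 * y) / (1 - 2 * (1/12)\<^sup>2)"
        if "0 \<le> y" for y :: real
        using that by (simp add: power2_eq_square)
      then show ?thesis by (simp add: t_def)
    qed
    ultimately have "t * s\<^sup>2 / 64 * (norm v)\<^sup>2 \<le> v \<bullet> (S *v v)"
      by (meson mult_right_mono order_trans zero_le_power2)
    then show "t * s\<^sup>2 / 64 * (norm v)\<^sup>2 + (\<Sum>j\<in>J. (v \<bullet> mu j)\<^sup>2) \<le> (\<Sum>j\<in>J. (v \<bullet> X j \<omega>)\<^sup>2)"
      unfolding S_quad by simp
  qed
qed

end

end

section \<open>Self-normalised Gaussian noise\<close>

text \<open>Passes from countably many directions, over which events stay measurable, to all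
  directions.\<close>

lemma continuous_nonneg_dense:
  fixes h :: "'b::topological_space \<Rightarrow> real"
  assumes "continuous_on UNIV h" "closure D = UNIV" "\<And>w. w \<in> D \<Longrightarrow> 0 \<le> h w"
  shows "0 \<le> h w"
proof -
  have "closed {w. 0 \<le> h w}" using assms(1) by (intro closed_Collect_le) auto
  then have "closure D \<subseteq> {w. 0 \<le> h w}" using assms(3) by (intro closure_minimal) auto
  then show ?thesis using assms(2) by auto
qed

text \<open>\<open>B\<close> is an inverse square root of the Gram matrix, up to a rotation. It
  makes every nondegenerate design isometric: for unit \<open>v\<close> the weights
  \<open>B v \<bullet> x i\<close> have square sum 1, so the weighted noise has a variance that does
  not depend on the design.\<close>

lemma gram_orthonormalisation:
  fixes x :: "'i \<Rightarrow> real^'n"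
  assumes pos: "\<And>w. w \<noteq> 0 \<Longrightarrow> 0 < (\<Sum>i\<in>I. (w \<bullet> x i)\<^sup>2)"
  obtains B where "linear B" "surj B" "\<And>v. (\<Sum>i\<in>I. (B v \<bullet> x i)\<^sup>2) = (norm (v :: real^'n))\<^sup>2"
proof -
  define A where "A = (\<Sum>i\<in>I. outer (x i) (x i))"
  have A: "w \<bullet> (A *v w) = (\<Sum>i\<in>I. (w \<bullet> x i)\<^sup>2)" for w
    by (simp add: A_def sum_matrix_vector_mult inner_sum_right inner_outer_mult_vec power2_eq_square inner_commute)
  have "transpose A = A" by (simp add: A_def transpose_sum)
  then obtain p d where p: "orthonormal_family p" and Ap: "A = spectral_matrix p d"
    using symmetric_matrix_spectral by blast
  have d: "d a > 0" for a
  proof -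
    have "p a \<noteq> 0" using norm_orthonormal[OF p, of a] by force
    from pos[OF this] A[of "p a"] show ?thesis
      by (simp add: Ap spectral_matrix_eigen[OF p] norm_orthonormal[OF p] inner_orthonormal[OF p])
  qed
  define B where "B v = (\<Sum>a\<in>UNIV. (v $ a / sqrt (d a)) *\<^sub>R p a)" for v
  have pB: "p a \<bullet> B v = v $ a / sqrt (d a)" for a v
  proof -
    have "p a \<bullet> B v = (\<Sum>b\<in>UNIV. if b = a then v $ a / sqrt (d a) else 0)"
      unfolding B_def inner_sum_right by (intro sum.cong) (auto simp: inner_orthonormal[OF p])
    then show ?thesis by simp
  qed
  show ?thesis
  proof (rule that[of B])
    show "linear B"
    proof (rule linearI)
      fix v w and c :: real
      show "B (v + w) = B v + B w"
        unfolding B_def sum.distrib[symmetric] by (intro sum.cong refl) (simp add: add_divide_distrib scaleR_add_left)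
      show "B (c *\<^sub>R v) = c *\<^sub>R B v"
        unfolding B_def scaleR_sum_right by (intro sum.cong refl) simp
    qed
    show "surj B"
    proof (rule surjI)
      fix w show "B (\<chi> a. sqrt (d a) * (p a \<bullet> w)) = w"
        using orthonormal_family_expand[OF p, of w] d by (simp add: B_def less_imp_neq[symmetric])
    qed
    show "(\<Sum>i\<in>I. (B v \<bullet> x i)\<^sup>2) = (norm v)\<^sup>2" for v
    proof -
      have "(\<Sum>i\<in>I. (B v \<bullet> x i)\<^sup>2) = (\<Sum>a\<in>UNIV. d a * (v $ a / sqrt (d a))\<^sup>2)"
        by (simp only: A[symmetric] Ap spectral_matrix_quadratic[OF p] pB)
      also have "\<dots> = (\<Sum>a\<in>UNIV. (v $ a)\<^sup>2)"
        using d by (intro sum.cong refl) (simp add: power_divide less_imp_le less_imp_neq[symmetric])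
      also have "\<dots> = (norm v)\<^sup>2" by (subst power2_norm_eq_inner) (simp add: inner_vec_def power2_eq_square)
      finally show ?thesis .
    qed
  qed
qed

context prob_space
begin

lemma gauss_iso_weighted_sum_tail:
  fixes E :: "'i \<Rightarrow> 'a \<Rightarrow> real^'l"
  assumes fin: "finite I" and indep: "indep_vars (\<lambda>_. borel) E I" and s: "s > 0"
    and E: "\<And>i. i \<in> I \<Longrightarrow> distributed M lborel (E i) (gauss_iso_density 0 s)"
    and u: "norm u = 1" and y: "(\<Sum>i\<in>I. (y i)\<^sup>2) = 1" and r: "r \<ge> 0"
  shows "prob {\<omega> \<in> space M. s * r \<le> u \<bullet> (\<Sum>i\<in>I. y i *\<^sub>R E i \<omega>)} \<le> exp (- r\<^sup>2 / 2)"
proof (cases "r = 0")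
  case False
  \<comment> \<open>\<open>r / s\<close> is the optimal Chernoff parameter for a centred normal with
    variance \<open>s^2\<close> at the level \<open>s * r\<close>.\<close>
  then have c: "r / s > 0" using r s by simp
  have "{\<omega> \<in> space M. s * r \<le> u \<bullet> (\<Sum>i\<in>I. y i *\<^sub>R E i \<omega>)}
      = {\<omega> \<in> space M. (r / s) * (s * r) \<le> (r / s) * (\<Sum>i\<in>I. y i * (u \<bullet> E i \<omega>))}"
    unfolding mult_le_cancel_left_pos[OF c] by (simp add: inner_sum_right)
  also have "\<dots> = {\<omega> \<in> space M. r\<^sup>2 \<le> (\<Sum>i\<in>I. ((r / s * y i) *\<^sub>R u) \<bullet> E i \<omega>)}"
    using s by (simp add: sum_distrib_left power2_eq_square mult.assoc)
  finally have "prob {\<omega> \<in> space M. s * r \<le> u \<bullet> (\<Sum>i\<in>I. y i *\<^sub>R E i \<omega>)}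
      = prob {\<omega> \<in> space M. r\<^sup>2 \<le> (\<Sum>i\<in>I. ((r / s * y i) *\<^sub>R u) \<bullet> E i \<omega>)}" by simp
  also have "\<dots> \<le> exp (- r\<^sup>2) * (\<Prod>i\<in>I. exp (r\<^sup>2 / 2 * (y i)\<^sup>2))"
  proof (rule chernoff_bound_indep[OF fin])
    show "indep_vars (\<lambda>_. borel) (\<lambda>i \<omega>. ((r / s * y i) *\<^sub>R u) \<bullet> E i \<omega>) I"
      by (rule indep_vars_compose2[where Y="\<lambda>i e. ((r / s * y i) *\<^sub>R u) \<bullet> e", OF indep]) auto
    fix i assume i: "i \<in> I"
    have "(norm ((r / s * y i) *\<^sub>R u))\<^sup>2 = r\<^sup>2 / s\<^sup>2 * (y i)\<^sup>2"
      using u by (simp add: power_mult_distrib power_divide)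
    then have "s\<^sup>2 * (norm ((r / s * y i) *\<^sub>R u))\<^sup>2 / 2 = r\<^sup>2 / 2 * (y i)\<^sup>2"
      using s by simp
    then show "(\<integral>\<^sup>+\<omega>. ennreal (exp (((r / s * y i) *\<^sub>R u) \<bullet> E i \<omega>)) \<partial>M) \<le> ennreal (exp (r\<^sup>2 / 2 * (y i)\<^sup>2))"
      using gauss_iso_exp_inner[OF E[OF i] s, of "(r / s * y i) *\<^sub>R u"] by (simp only: inner_zero_right add_0)
  qed auto
  also have "(\<Prod>i\<in>I. exp (r\<^sup>2 / 2 * (y i)\<^sup>2)) = exp (r\<^sup>2 / 2)"
    by (simp only: exp_sum[OF fin, symmetric] sum_distrib_left[symmetric] y) simp
  also have "exp (- r\<^sup>2) * exp (r\<^sup>2 / 2) = exp (- r\<^sup>2 / 2)" by (simp flip: exp_add)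
  finally show ?thesis .
qed simp

text \<open>Mesh \<open>1/2\<close> gives nets of at most \<open>5 ^ CARD('n)\<close> and
  \<open>5 ^ CARD('l)\<close> points, and \<open>K\<close> is chosen so that the number of pairs
  times \<open>exp (- K)\<close> is \<open>d\<close>. In
  \<open>512/147 = 2 * (64/49) * (4/3)\<close> the factor \<open>2\<close> comes from
  \<open>r^2 = 2 * K\<close>, \<open>64/49\<close> from the net for the noise vector, and
  \<open>4/3\<close> from the net for the normalised direction.\<close>

lemma self_normalized_fixed_design:
  fixes E :: "'i \<Rightarrow> 'a \<Rightarrow> real^'l" and x :: "'i \<Rightarrow> real^'n" and d :: real
  defines "K \<equiv> (real CARD('n) + real CARD('l)) * ln 5 + ln (1 / d)"
  assumes fin: "finite I" and indep: "indep_vars (\<lambda>_. borel) E I" and s: "s > 0"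
    and E: "\<And>i. i \<in> I \<Longrightarrow> distributed M lborel (E i) (gauss_iso_density 0 s)"
    and pos: "\<And>w. w \<noteq> 0 \<Longrightarrow> 0 < (\<Sum>i\<in>I. (w \<bullet> x i)\<^sup>2)" and d: "0 < d" "d \<le> 1"
  obtains Q where "Q \<in> events" "prob Q \<le> d"
    "\<And>\<omega> w. \<omega> \<in> space M - Q \<Longrightarrow>
      (norm (\<Sum>i\<in>I. (w \<bullet> x i) *\<^sub>R E i \<omega>))\<^sup>2 \<le> s\<^sup>2 * (512 / 147 * K) * (\<Sum>i\<in>I. (w \<bullet> x i)\<^sup>2)"
proof -
  have [measurable]: "E i \<in> borel_measurable M" if "i \<in> I" for i
    using distributed_measurable[OF E[OF that]] by simp
  obtain B where B: "linear B" "surj B" "\<And>v. (\<Sum>i\<in>I. (B v \<bullet> x i)\<^sup>2) = (norm (v :: real^'n))\<^sup>2"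
    using gram_orthonormalisation[of x I] pos by blast
  have half: "(0::real) < 1 / 2" by simp
  obtain N :: "(real^'n) set" where N: "finite N" "N \<subseteq> sphere 0 1" "real (card N) \<le> (1 + 2 / (1/2)) ^ DIM(real^'n)"
    and N_net: "\<And>v. norm v = 1 \<Longrightarrow> \<exists>w\<in>N. norm (w - v) \<le> 1/2"
    using sphere_net[OF half, where 'a="real^'n"] by metis
  obtain N' :: "(real^'l) set" where N': "finite N'" "N' \<subseteq> sphere 0 1" "real (card N') \<le> (1 + 2 / (1/2)) ^ DIM(real^'l)"
    and N'_net: "\<And>v. norm v = 1 \<Longrightarrow> \<exists>w\<in>N'. norm (w - v) \<le> 1/2"
    using sphere_net[OF half, where 'a="real^'l"] by metis
  have K: "K \<ge> 0" using d by (simp add: K_def)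
  define r where "r = sqrt (2 * K)"
  have r: "r \<ge> 0" "r\<^sup>2 = 2 * K" using K by (simp_all add: r_def)
  define G where "G \<omega> v = (\<Sum>i\<in>I. (B v \<bullet> x i) *\<^sub>R E i \<omega>)" for \<omega> v
  define F where "F q = {\<omega> \<in> space M. s * r \<le> snd q \<bullet> G \<omega> (fst q)}" for q
  have F: "F q \<in> events" for q unfolding F_def G_def by measurable
  have F_le: "prob (F q) \<le> exp (- K)" if "q \<in> N \<times> N'" for q
  proof -
    have "norm (fst q) = 1" "norm (snd q) = 1" using that N N' by auto
    then show ?thesis
      using gauss_iso_weighted_sum_tail[OF fin indep s E, of "snd q" "\<lambda>i. B (fst q) \<bullet> x i" r] B(3)[of "fst q"] r
      by (simp add: F_def G_def)
  qed
  define Q where "Q = (\<Union>q\<in>N \<times> N'. F q)"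
  show ?thesis
  proof (rule that[of Q])
    show "Q \<in> events" unfolding Q_def using N N' F by auto
    have "prob Q \<le> (\<Sum>q\<in>N \<times> N'. prob (F q))"
      unfolding Q_def using N N' F by (intro measure_UNION_le) auto
    also have "\<dots> \<le> (real (card N) * real (card N')) * exp (- K)"
      using sum_bounded_above[of "N \<times> N'" "\<lambda>q. prob (F q)" "exp (- K)"] F_le by (simp add: card_cartesian_product)
    also have "\<dots> \<le> (5 ^ CARD('n) * 5 ^ CARD('l)) * exp (- K)"
      using N(3) N'(3) by (intro mult_right_mono mult_mono) simp_all
    also have "\<dots> = d"
    proof -
      have "exp K = exp (ln 5) ^ CARD('n) * exp (ln 5) ^ CARD('l) * exp (ln (1 / d))"
        unfolding K_def exp_add distrib_right by (simp only: exp_of_nat_mult)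
      then have "exp K = 5 ^ CARD('n) * 5 ^ CARD('l) / d" using d by simp
      then show ?thesis by (simp add: exp_minus)
    qed
    finally show "prob Q \<le> d" .
    fix \<omega> w assume \<omega>: "\<omega> \<in> space M - Q"
    have lin: "linear (G \<omega>)"
      by (rule linearI) (simp_all add: G_def linear_add[OF B(1)] linear_scale[OF B(1)] inner_add_left
        scaleR_add_left sum.distrib scaleR_sum_right)
    define H where "H = transpose (matrix (G \<omega>)) ** matrix (G \<omega>)"
    have H: "v \<bullet> (H *v v) = (norm (G \<omega> v))\<^sup>2" for v
    proof -
      have mult: "matrix (G \<omega>) *v u = G \<omega> u" for u using lin by simp
      have "H *v v = G \<omega> v v* matrix (G \<omega>)"
        by (simp add: H_def mult flip: matrix_vector_mul_assoc)
      then have "(H *v v) \<bullet> v = G \<omega> v \<bullet> G \<omega> v"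
        by (simp only: dot_lmul_matrix mult)
      then show ?thesis by (simp add: power2_norm_eq_inner inner_commute)
    qed
    have sym: "transpose H = H"
      by (simp add: H_def matrix_transpose_mul)
    have at_net: "v \<bullet> (H *v v) \<le> s\<^sup>2 * (64 / 49 * (2 * K))" if v: "v \<in> N" for v
    proof -
      have "u \<bullet> G \<omega> v \<le> s * r" if "u \<in> N'" for u
        using \<omega> v that by (auto simp: Q_def F_def not_le) (metis fst_conv less_imp_le not_le snd_conv)
      then have "norm (G \<omega> v) * (1 - (1/2)\<^sup>2 / 2) \<le> s * r \<or> G \<omega> v = 0"
        using N' by (intro norm_net_upper[OF _ N'_net]) (auto simp: power2_eq_square)
      then have "norm (G \<omega> v) \<le> s * r * (8 / 7)"
        using r s by (auto simp: power2_eq_square)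
      then have "(norm (G \<omega> v))\<^sup>2 \<le> (s * r * (8 / 7))\<^sup>2" by (intro power_mono) auto
      then show ?thesis using r by (simp add: H power_mult_distrib power_divide algebra_simps)
    qed
    have quad: "(norm (G \<omega> v))\<^sup>2 \<le> s\<^sup>2 * (512 / 147 * K) * (norm v)\<^sup>2" for v
    proof -
      have "v \<bullet> (H *v v) \<le> s\<^sup>2 * (64 / 49 * (2 * K)) / (1 - (1/2)\<^sup>2) * (norm v)\<^sup>2"
        by (rule quadratic_form_net_upper[OF sym _ N_net _ _ _ at_net]) (use N in \<open>auto simp: H\<close>)
      then show ?thesis by (simp add: H power2_eq_square)
    qed
    obtain v where "w = B v" using B(2) by (metis surjD)
    then show "(norm (\<Sum>i\<in>I. (w \<bullet> x i) *\<^sub>R E i \<omega>))\<^sup>2 \<le> s\<^sup>2 * (512 / 147 * K) * (\<Sum>i\<in>I. (w \<bullet> x i)\<^sup>2)"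
      using quad[of v] by (simp add: B(3) G_def)
  qed
qed

text \<open>Independence allows the design to be frozen: the fixed-design bound, whose constant is
  the same for all designs, is integrated over the product law. \<open>\<kappa>\<close> expresses
  nondegeneracy only and does not enter the estimate.\<close>

lemma self_normalized_random_design:
  fixes E :: "'i \<Rightarrow> 'a \<Rightarrow> real^'l" and X :: "'i \<Rightarrow> 'a \<Rightarrow> real^'n" and d :: real
  defines "K \<equiv> (real CARD('n) + real CARD('l)) * ln 5 + ln (1 / d)"
  assumes fin: "finite I" and indep: "indep_vars (\<lambda>_. borel) E I" and s: "s > 0"
    and E: "\<And>i. i \<in> I \<Longrightarrow> distributed M lborel (E i) (gauss_iso_density 0 s)"
    and mX [measurable]: "(\<lambda>\<omega>. \<lambda>i\<in>I. X i \<omega>) \<in> measurable M (PiM I (\<lambda>_. borel))"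
    and mE [measurable]: "(\<lambda>\<omega>. \<lambda>i\<in>I. E i \<omega>) \<in> measurable M (PiM I (\<lambda>_. borel))"
    and joint: "distr M (PiM I (\<lambda>_. borel)) (\<lambda>\<omega>. \<lambda>i\<in>I. X i \<omega>) \<Otimes>\<^sub>M distr M (PiM I (\<lambda>_. borel)) (\<lambda>\<omega>. \<lambda>i\<in>I. E i \<omega>)
      = distr M (PiM I (\<lambda>_. borel) \<Otimes>\<^sub>M PiM I (\<lambda>_. borel)) (\<lambda>\<omega>. (\<lambda>i\<in>I. X i \<omega>, \<lambda>i\<in>I. E i \<omega>))"
    and d: "0 < d" "d \<le> 1" and kappa: "\<kappa> > 0"
  obtains Q where "Q \<in> events" "prob Q \<le> d"
    "\<And>\<omega> w. \<omega> \<in> space M - Q \<Longrightarrow> (\<And>v. \<kappa> * (norm v)\<^sup>2 \<le> (\<Sum>i\<in>I. (v \<bullet> X i \<omega>)\<^sup>2)) \<Longrightarrow>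
      (norm (\<Sum>i\<in>I. (w \<bullet> X i \<omega>) *\<^sub>R E i \<omega>))\<^sup>2 \<le> s\<^sup>2 * (512 / 147 * K) * (\<Sum>i\<in>I. (w \<bullet> X i \<omega>)\<^sup>2)"
proof -
  let ?C = "s\<^sup>2 * (512 / 147 * K)"
  let ?PX = "PiM I (\<lambda>_. borel) :: ('i \<Rightarrow> real^'n) measure"
  let ?PE = "PiM I (\<lambda>_. borel) :: ('i \<Rightarrow> real^'l) measure"
  let ?X = "\<lambda>\<omega>. \<lambda>i\<in>I. X i \<omega>" and ?E = "\<lambda>\<omega>. \<lambda>i\<in>I. E i \<omega>"
  obtain D :: "(real^'n) set" where D: "countable D" and dense: "\<And>U. open U \<Longrightarrow> U \<noteq> {} \<Longrightarrow> \<exists>w\<in>D. w \<in> U"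
    using countable_dense_exists[where 'a="real^'n"] by metis
  have cl: "closure D = UNIV"
    using dense[of "- closure D"] closure_subset[of D] by auto
  \<comment> \<open>Quantifying over a countable dense set keeps this measurable. Coercivity is part
    of the set, so its slice over a degenerate design is empty.\<close>
  define Bad where "Bad = {q \<in> space (?PX \<Otimes>\<^sub>M ?PE).
      (\<forall>v\<in>D. \<kappa> * (norm v)\<^sup>2 \<le> (\<Sum>i\<in>I. (v \<bullet> fst q i)\<^sup>2)) \<and>
      (\<exists>w\<in>D. ?C * (\<Sum>i\<in>I. (w \<bullet> fst q i)\<^sup>2) < (norm (\<Sum>i\<in>I. (w \<bullet> fst q i) *\<^sub>R snd q i))\<^sup>2)}"
  have [measurable]: "(\<lambda>q. fst q i) \<in> borel_measurable (?PX \<Otimes>\<^sub>M ?PE)"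
    "(\<lambda>q. snd q i) \<in> borel_measurable (?PX \<Otimes>\<^sub>M ?PE)" if "i \<in> I" for i
    using that by measurable
  have Bad: "Bad \<in> sets (?PX \<Otimes>\<^sub>M ?PE)"
    unfolding Bad_def using D by measurable
  define Q where "Q = {\<omega> \<in> space M. (?X \<omega>, ?E \<omega>) \<in> Bad}"
  have Q_eq: "Q = (\<lambda>\<omega>. (?X \<omega>, ?E \<omega>)) -` Bad \<inter> space M" by (auto simp: Q_def)
  have slice: "emeasure (distr M ?PE ?E) (Pair f -` Bad) \<le> ennreal d" for f
  proof (cases "f \<in> space ?PX \<and> (\<forall>v\<in>D. \<kappa> * (norm v)\<^sup>2 \<le> (\<Sum>i\<in>I. (v \<bullet> f i)\<^sup>2))")
    case True
    have lower: "0 \<le> (\<Sum>i\<in>I. (w \<bullet> f i)\<^sup>2) - \<kappa> * (norm w)\<^sup>2" for w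
      by (rule continuous_nonneg_dense[OF _ cl]) (use True in \<open>auto intro!: continuous_intros\<close>)
    have pos: "0 < (\<Sum>i\<in>I. (w \<bullet> f i)\<^sup>2)" if "w \<noteq> 0" for w
    proof -
      have "0 < \<kappa> * (norm w)\<^sup>2" using kappa that by simp
      with lower[of w] show ?thesis by linarith
    qed
    obtain Q' where Q': "Q' \<in> events" "prob Q' \<le> d"
      "\<And>\<omega> w. \<omega> \<in> space M - Q' \<Longrightarrow> (norm (\<Sum>i\<in>I. (w \<bullet> f i) *\<^sub>R E i \<omega>))\<^sup>2 \<le> ?C * (\<Sum>i\<in>I. (w \<bullet> f i)\<^sup>2)"
      by (rule self_normalized_fixed_design[OF fin indep s E pos d, folded K_def]) blast+
    have "emeasure (distr M ?PE ?E) (Pair f -` Bad) = emeasure M (?E -` (Pair f -` Bad) \<inter> space M)"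
      using Bad by (intro emeasure_distr mE) (auto intro: sets_Pair1)
    also have "\<dots> \<le> emeasure M Q'"
    proof (intro emeasure_mono subsetI)
      fix \<omega> assume \<omega>: "\<omega> \<in> ?E -` (Pair f -` Bad) \<inter> space M"
      then obtain w where "?C * (\<Sum>i\<in>I. (w \<bullet> f i)\<^sup>2) < (norm (\<Sum>i\<in>I. (w \<bullet> f i) *\<^sub>R ?E \<omega> i))\<^sup>2"
        by (auto simp: Bad_def)
      then have "?C * (\<Sum>i\<in>I. (w \<bullet> f i)\<^sup>2) < (norm (\<Sum>i\<in>I. (w \<bullet> f i) *\<^sub>R E i \<omega>))\<^sup>2"
        by (simp cong: sum.cong)
      then show "\<omega> \<in> Q'"
        using Q'(3)[of \<omega> w] \<omega> by force
    qed (rule Q')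
    also have "\<dots> \<le> ennreal d" using Q'(2) by (simp add: emeasure_eq_measure ennreal_leI)
    finally show ?thesis .
  next
    case False
    then have "Pair f -` Bad = {}" by (auto simp: Bad_def space_pair_measure)
    then show ?thesis by simp
  qed
  interpret PX: prob_space "distr M ?PX ?X" by (rule prob_space_distr[OF mX])
  interpret PE: prob_space "distr M ?PE ?E" by (rule prob_space_distr[OF mE])
  show ?thesis
  proof (rule that[of Q])
    show Q: "Q \<in> events" unfolding Q_eq using Bad by measurable
    have "emeasure M Q = emeasure (distr M ?PX ?X \<Otimes>\<^sub>M distr M ?PE ?E) Bad"
      unfolding joint Q_eq using Bad by (subst emeasure_distr) auto
    also have "\<dots> = (\<integral>\<^sup>+f. emeasure (distr M ?PE ?E) (Pair f -` Bad) \<partial>distr M ?PX ?X)"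
      using Bad by (intro PE.emeasure_pair_measure_alt) (simp cong: sets_pair_measure_cong)
    also have "\<dots> \<le> (\<integral>\<^sup>+f. ennreal d \<partial>distr M ?PX ?X)"
      using slice by (intro nn_integral_mono) auto
    also have "\<dots> = ennreal d" using PX.emeasure_space_1 by simp
    finally show "prob Q \<le> d" using d by (simp add: emeasure_eq_measure)
    fix \<omega> w assume \<omega>: "\<omega> \<in> space M - Q" and low: "\<And>v. \<kappa> * (norm v)\<^sup>2 \<le> (\<Sum>i\<in>I. (v \<bullet> X i \<omega>)\<^sup>2)"
    have "(?X \<omega>, ?E \<omega>) \<in> space (?PX \<Otimes>\<^sub>M ?PE)"
      using \<omega> measurable_space[OF mX] measurable_space[OF mE] by (auto simp: space_pair_measure)
    then have pts: "0 \<le> ?C * (\<Sum>i\<in>I. (w \<bullet> X i \<omega>)\<^sup>2) - (norm (\<Sum>i\<in>I. (w \<bullet> X i \<omega>) *\<^sub>R E i \<omega>))\<^sup>2" if "w \<in> D" for w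
      using that \<omega> low by (auto simp: Q_def Bad_def not_less)
    have "0 \<le> ?C * (\<Sum>i\<in>I. (w \<bullet> X i \<omega>)\<^sup>2) - (norm (\<Sum>i\<in>I. (w \<bullet> X i \<omega>) *\<^sub>R E i \<omega>))\<^sup>2"
      by (rule continuous_nonneg_dense[OF _ cl pts]) (intro continuous_intros)
    then show "(norm (\<Sum>i\<in>I. (w \<bullet> X i \<omega>) *\<^sub>R E i \<omega>))\<^sup>2 \<le> ?C * (\<Sum>i\<in>I. (w \<bullet> X i \<omega>)\<^sup>2)" by simp
  qed
qed

end

section \<open>The error of the consensus estimate\<close>

lemma weighted_sum_sqrt_le:
  assumes "\<And>k. k \<in> A \<Longrightarrow> 0 \<le> p k" "\<And>k. k \<in> A \<Longrightarrow> 0 \<le> q k"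
  shows "(\<Sum>k\<in>A. p k * sqrt (q k)) \<le> sqrt ((\<Sum>k\<in>A. p k) * (\<Sum>k\<in>A. p k * q k))"
proof (rule real_le_rsqrt)
  have "(\<Sum>k\<in>A. p k * sqrt (q k))\<^sup>2 = (\<Sum>k\<in>A. sqrt (p k) * (sqrt (p k) * sqrt (q k)))\<^sup>2"
    using assms by (intro arg_cong[where f="\<lambda>x. x\<^sup>2"] sum.cong) (auto simp flip: mult.assoc)
  also have "\<dots> \<le> (\<Sum>k\<in>A. (sqrt (p k))\<^sup>2) * (\<Sum>k\<in>A. (sqrt (p k) * sqrt (q k))\<^sup>2)"
    by (rule Cauchy_Schwarz_ineq_sum)
  also have "\<dots> = (\<Sum>k\<in>A. p k) * (\<Sum>k\<in>A. p k * q k)"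
    using assms by (intro arg_cong2[where f="(*)"] sum.cong) (auto simp: power_mult_distrib)
  finally show "(\<Sum>k\<in>A. p k * sqrt (q k))\<^sup>2 \<le> (\<Sum>k\<in>A. p k) * (\<Sum>k\<in>A. p k * q k)" .
qed

text \<open>If \<open>m r \<ge> 1/2\<close> the local bounds suffice; otherwise every weight exceeds \<open>1/(2m)\<close>, which
  compares the weighted Gram form with the uniformly averaged one.\<close>

lemma perturbed_average_bound:
  fixes p q :: "'m::finite \<Rightarrow> real" and v :: "'m \<Rightarrow> 'v::real_normed_vector"
  defines "m \<equiv> real CARD('m)"
  assumes p: "\<And>k. 0 \<le> p k" "(\<Sum>k\<in>UNIV. p k) = 1" "\<And>k. \<bar>p k - 1 / m\<bar> \<le> r"
    and q: "\<And>k. \<kappa>0 * y\<^sup>2 \<le> q k" "\<kappa>1 * y\<^sup>2 \<le> (\<Sum>k\<in>UNIV. q k)" "(\<Sum>k\<in>UNIV. p k * q k) \<le> y * z"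
    and v: "\<And>k. (norm (v k))\<^sup>2 \<le> h\<^sup>2 * q k" "(norm (\<Sum>k\<in>UNIV. v k))\<^sup>2 \<le> g\<^sup>2 * (\<Sum>k\<in>UNIV. q k)"
    and pos: "0 < \<kappa>0" "0 < \<kappa>1" "0 \<le> h" "0 \<le> g" "0 \<le> y" "0 \<le> z"
  shows "norm (\<Sum>k\<in>UNIV. p k *\<^sub>R v k) \<le> (g / sqrt \<kappa>1 + 3 * m * r * h / sqrt \<kappa>0) * z"
proof -
  have m: "m \<ge> 1" by (simp add: m_def Suc_leI)
  have r: "r \<ge> 0" using p(3)[of undefined] by linarith
  have q0: "0 \<le> q k" for k
    using q(1)[of k] pos by (meson mult_nonneg_nonneg less_imp_le order_trans zero_le_power2)
  define Q S where "Q = (\<Sum>k\<in>UNIV. p k * q k)" and "S = (\<Sum>k\<in>UNIV. q k)"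
  have Q0: "Q \<ge> 0" and S0: "S \<ge> 0" using p q0 by (auto simp: Q_def S_def intro!: sum_nonneg)
  have nv: "norm (v k) \<le> h * sqrt (q k)" for k
    by (rule power2_le_imp_le) (use v(1)[of k] q0 pos in \<open>auto simp: power_mult_distrib\<close>)
  have nV: "norm (\<Sum>k\<in>UNIV. v k) \<le> g * sqrt S"
    by (rule power2_le_imp_le) (use v(2) S0 pos in \<open>auto simp: power_mult_distrib S_def\<close>)
  \<comment> \<open>\<open>y\<close> will be the norm of the test vector. A lower bound by
    \<open>y^2\<close> and an upper bound linear in \<open>y\<close> eliminate it, leaving only the
    square root of the coercivity constant.\<close>
  have sq: "a \<le> z / (c * sqrt \<kappa>)" if "0 < \<kappa>" "0 < c" "0 \<le> a" "\<kappa> * y\<^sup>2 \<le> a\<^sup>2" "c * a\<^sup>2 \<le> y * z" for a c \<kappa>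
  proof (cases "a = 0")
    case False
    have "(c * a\<^sup>2)\<^sup>2 * \<kappa> \<le> (y * z)\<^sup>2 * \<kappa>"
      using that by (intro mult_right_mono power_mono) auto
    also have "\<dots> = z\<^sup>2 * (\<kappa> * y\<^sup>2)" by (simp add: power_mult_distrib)
    also have "\<dots> \<le> z\<^sup>2 * a\<^sup>2" using that by (intro mult_left_mono) auto
    finally have "a\<^sup>2 * (c\<^sup>2 * a\<^sup>2 * \<kappa>) \<le> a\<^sup>2 * z\<^sup>2" by (simp add: power2_eq_square ac_simps)
    then have "c\<^sup>2 * a\<^sup>2 * \<kappa> \<le> z\<^sup>2" using False by (simp add: mult_le_cancel_left_pos)
    then have "(a * (c * sqrt \<kappa>))\<^sup>2 \<le> z\<^sup>2" using that by (simp add: power_mult_distrib ac_simps)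
    then have "a * (c * sqrt \<kappa>) \<le> z" using pos by (metis power2_le_imp_le)
    then show ?thesis using that by (simp add: pos_le_divide_eq)
  qed (use pos that in auto)
  have low: "\<kappa>0 * y\<^sup>2 \<le> Q"
  proof -
    have "(\<Sum>k\<in>UNIV. p k * (\<kappa>0 * y\<^sup>2)) \<le> Q"
      unfolding Q_def using p q by (intro sum_mono mult_left_mono) auto
    then show ?thesis using p(2) by (simp flip: sum_distrib_right)
  qed
  have sqQ: "sqrt Q \<le> z / sqrt \<kappa>0"
    using sq[of \<kappa>0 1 "sqrt Q"] pos low Q0 q(3) by (simp add: Q_def)
  have loc: "h * sqrt Q \<le> h * z / sqrt \<kappa>0"
    using mult_left_mono[OF sqQ pos(3)] by simp
  have loc0: "0 \<le> h * z / sqrt \<kappa>0" using pos by simp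
  have bound0: "norm (\<Sum>k\<in>UNIV. p k *\<^sub>R v k) \<le> h * sqrt Q"
  proof -
    have "norm (\<Sum>k\<in>UNIV. p k *\<^sub>R v k) \<le> (\<Sum>k\<in>UNIV. p k * (h * sqrt (q k)))"
      using p nv by (intro sum_norm_le) (auto intro!: mult_left_mono)
    also have "\<dots> = h * (\<Sum>k\<in>UNIV. p k * sqrt (q k))" by (simp add: sum_distrib_left ac_simps)
    also have "\<dots> \<le> h * sqrt Q"
      using weighted_sum_sqrt_le[of UNIV p q] p q0 pos by (intro mult_left_mono) (auto simp: Q_def)
    finally show ?thesis .
  qed
  have gz: "0 \<le> g / sqrt \<kappa>1 * z" using pos by simp
  show ?thesis
  proof (cases "1 / 2 \<le> m * r")
    case True
    have "h * z / sqrt \<kappa>0 \<le> (3 * m * r) * (h * z / sqrt \<kappa>0)"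
      using mult_right_mono[OF _ loc0, of 1 "3 * m * r"] True by simp
    then show ?thesis using bound0 loc gz by (simp add: distrib_right mult.assoc)
  next
    case False
    then have mr: "m * r < 1 / 2" by simp
    have pk: "1 / m - r \<le> p k" for k using p(3)[of k] by linarith
    have half: "1 / (2 * m) \<le> 1 / m - r" using mr m by (simp add: field_simps)
    have QS: "(1 - m * r) / m * S \<le> Q"
    proof -
      have "(\<Sum>k\<in>UNIV. (1 / m - r) * q k) \<le> Q"
        unfolding Q_def using pk q0 by (intro sum_mono mult_right_mono) auto
      moreover have "(1 - m * r) / m = 1 / m - r" using m by (simp add: field_simps)
      ultimately show ?thesis by (simp add: S_def sum_distrib_left)
    qed
    have S2: "S \<le> 2 * m * Q"
    proof -
      have "1 / (2 * m) * S \<le> (1 - m * r) / m * S"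
        using half S0 m by (intro mult_right_mono) (auto simp: field_simps)
      then have "1 / (2 * m) * S \<le> Q" using QS by linarith
      then show ?thesis using m by (simp add: field_simps)
    qed
    have sumsqrt: "(\<Sum>k\<in>UNIV. sqrt (q k)) \<le> sqrt (m * S)"
      using weighted_sum_sqrt_le[of UNIV "\<lambda>_. 1" q] q0 by (simp add: S_def m_def)
    have sqrt2: "sqrt 2 \<le> 3 / 2" by (rule real_le_lsqrt) (simp_all add: power2_eq_square)
    have mS: "sqrt (m * S) \<le> (3 / 2) * m * sqrt Q"
    proof -
      have "sqrt (m * S) \<le> sqrt (2 * (m\<^sup>2 * Q))"
        using S2 m by (intro real_sqrt_le_mono) (simp add: power2_eq_square mult_left_mono)
      also have "\<dots> = sqrt 2 * (m * sqrt Q)" using m by (simp add: real_sqrt_mult)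
      also have "\<dots> \<le> 3 / 2 * (m * sqrt Q)" using sqrt2 m Q0 by (intro mult_right_mono) auto
      finally show ?thesis by simp
    qed
    \<comment> \<open>Below, \<open>f\<close> is split as
      \<open>f * (1 - m * r) + m * r * f\<close>: the first part receives the global bound, the
      second the cruder local one. That second part and the deviations of the weights from
      \<open>1 / m\<close> each cost \<open>(3/2) * m * r\<close>, whence the factor 3 in the
      conclusion.\<close>
    define f where "f = norm (\<Sum>k\<in>UNIV. v k) / m"
    have f0: "f \<ge> 0" using m by (simp add: f_def)
    have f_loc: "f \<le> 3 / 2 * (h * sqrt Q)"
    proof -
      have "norm (\<Sum>k\<in>UNIV. v k) \<le> (\<Sum>k\<in>UNIV. h * sqrt (q k))" using nv by (intro sum_norm_le) auto
      also have "\<dots> \<le> h * ((3 / 2) * m * sqrt Q)"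
        unfolding sum_distrib_left[symmetric] using sumsqrt mS pos by (intro mult_left_mono) auto
      finally show ?thesis using m by (simp add: f_def field_simps)
    qed
    \<comment> \<open>The weights are at least \<open>(1 - m * r) / m\<close>, so the same factor
      \<open>1 - m * r\<close> appears on both sides and cancels; the leading constant is exactly
      \<open>g / sqrt \<kappa>1\<close>.\<close>
    have f_glob: "f * (1 - m * r) \<le> g / sqrt \<kappa>1 * z"
    proof -
      define c where "c = (1 - m * r) / m"
      have c: "0 < c" using mr m by (simp add: c_def)
      have "sqrt S \<le> z / (c * sqrt \<kappa>1)"
        using sq[of \<kappa>1 c "sqrt S"] pos q(2) QS q(3) S0 c by (simp add: S_def Q_def c_def)
      then have le: "sqrt S * c \<le> z / sqrt \<kappa>1"
        using c pos by (simp add: pos_le_divide_eq mult.assoc)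
      have "f * (1 - m * r) = norm (\<Sum>k\<in>UNIV. v k) * c" by (simp add: f_def c_def)
      also have "\<dots> \<le> g * sqrt S * c" using nV c by (intro mult_right_mono) auto
      also have "\<dots> \<le> g * (z / sqrt \<kappa>1)"
        using mult_left_mono[OF le pos(4)] by (simp only: mult.assoc)
      finally show ?thesis by simp
    qed
    have "(\<Sum>k\<in>UNIV. p k *\<^sub>R v k) = (1 / m) *\<^sub>R (\<Sum>k\<in>UNIV. v k) + (\<Sum>k\<in>UNIV. (p k - 1 / m) *\<^sub>R v k)"
      by (simp add: scaleR_sum_right scaleR_left_diff_distrib sum_subtractf)
    then have "norm (\<Sum>k\<in>UNIV. p k *\<^sub>R v k) \<le> f + norm (\<Sum>k\<in>UNIV. (p k - 1 / m) *\<^sub>R v k)"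
      using norm_triangle_ineq[of "(1 / m) *\<^sub>R (\<Sum>k\<in>UNIV. v k)"] m by (simp add: f_def)
    also have "norm (\<Sum>k\<in>UNIV. (p k - 1 / m) *\<^sub>R v k) \<le> (\<Sum>k\<in>UNIV. r * (h * sqrt (q k)))"
      using p(3) nv r by (intro sum_norm_le) (auto intro!: mult_mono)
    also have "\<dots> = r * h * (\<Sum>k\<in>UNIV. sqrt (q k))" by (simp add: sum_distrib_left mult.assoc)
    also have "\<dots> \<le> r * h * ((3 / 2) * m * sqrt Q)"
      using sumsqrt mS r pos by (intro mult_left_mono) auto
    finally have "norm (\<Sum>k\<in>UNIV. p k *\<^sub>R v k) \<le> f * (1 - m * r) + m * r * f + 3 / 2 * (m * r) * (h * sqrt Q)"
      by (simp add: algebra_simps)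
    also have "m * r * f \<le> m * r * (3 / 2 * (h * sqrt Q))"
      using f_loc m r by (intro mult_left_mono) auto
    finally have "norm (\<Sum>k\<in>UNIV. p k *\<^sub>R v k) \<le> g / sqrt \<kappa>1 * z + 3 * (m * r) * (h * sqrt Q)"
      using f_glob by linarith
    also have "3 * (m * r) * (h * sqrt Q) \<le> 3 * (m * r) * (h * z / sqrt \<kappa>0)"
      using loc m r by (intro mult_left_mono) auto
    finally show ?thesis by (simp add: distrib_right mult.assoc)
  qed
qed


section \<open>Spectral norm and Borel measurability of the estimator\<close>

lemma spec_norm_nonneg: "0 \<le> spec_norm A"
  unfolding spec_norm_def by (intro onorm_pos_le linear_linear[THEN iffD2] matrix_vector_mul_linear)

lemma spec_norm_le_iff: "spec_norm A \<le> c \<longleftrightarrow> (\<forall>v. norm (A *v v) \<le> c * norm v)"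
proof -
  have bl: "bounded_linear ((*v) A)" by (simp add: linear_linear)
  show ?thesis
    unfolding spec_norm_def using onorm[OF bl] onorm_le[of "(*v) A" c]
    by (meson mult_right_mono norm_ge_zero order_trans)
qed

text \<open>An intersection of closed conditions, one for each \<open>v\<close>. It makes the good
  event a preimage of a Borel set.\<close>

lemma closed_spec_norm_le: "closed {A. spec_norm A \<le> c}"
proof -
  have "continuous_on UNIV (\<lambda>A :: real^'n^'m. A *v v)" for v
    unfolding matrix_vector_mult_def by (intro continuous_intros)
  then have "closed {A :: real^'n^'m. norm (A *v v) \<le> c * norm v}" for v
    by (intro closed_Collect_le continuous_intros)
  then show ?thesis unfolding spec_norm_le_iff by (intro closed_Collect_all)
qed

lemma borel_measurable_outer [measurable]:
  fixes f :: "'a \<Rightarrow> real^'k" and g :: "'a \<Rightarrow> real^'n"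
  assumes "f \<in> borel_measurable M" "g \<in> borel_measurable M"
  shows "(\<lambda>x. outer (f x) (g x)) \<in> borel_measurable M"
proof (rule borel_measurable_continuous_Pair[OF assms])
  show "continuous_on UNIV (\<lambda>x :: (real^'k) \<times> (real^'n). outer (fst x) (snd x))"
    unfolding outer_def by (intro continuous_intros)
qed

lemma borel_measurable_matrix_matrix_mult [measurable]:
  fixes f :: "'a \<Rightarrow> real^'n^'k" and g :: "'a \<Rightarrow> real^'l^'n"
  assumes "f \<in> borel_measurable M" "g \<in> borel_measurable M"
  shows "(\<lambda>x. f x ** g x) \<in> borel_measurable M"
proof (rule borel_measurable_continuous_Pair[OF assms])
  show "continuous_on UNIV (\<lambda>x. fst x ** (snd x :: real^'l^'n))"
    unfolding matrix_matrix_mult_def by (intro continuous_intros)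
qed

lemma borel_measurable_matrix_vector_mult [measurable]:
  fixes A :: "real^'n^'k"
  shows "f \<in> borel_measurable M \<Longrightarrow> (\<lambda>x. A *v f x) \<in> borel_measurable M"
  by (rule measurable_compose[OF _ borel_measurable_continuous_onI[OF linear_continuous_on]])
    (simp_all add: linear_linear)

lemma borel_measurable_pinv_symmetric:
  fixes f :: "'a \<Rightarrow> real^'n^'n"
  assumes [measurable]: "f \<in> borel_measurable M" and sym: "\<And>x. transpose (f x) = f x"
  shows "(\<lambda>x. pinv (f x)) \<in> borel_measurable M"
proof (rule borel_measurable_LIMSEQ_metric)
  show "(\<lambda>x. landweber k (f x)) \<in> borel_measurable M" for k
    by (induction k) (auto simp del: landweber.simps simp: landweber.simps[abs_def])
  show "(\<lambda>k. landweber k (f x)) \<longlonglongrightarrow> pinv (f x)" for x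
    by (rule landweber_tendsto_pinv[OF sym])
qed

lemma borel_measurable_consensus [measurable (raw)]:
  fixes f :: "'a \<Rightarrow> 'm::finite \<Rightarrow> 'b::{real_normed_vector, second_countable_topology}"
  assumes "\<And>k. (\<lambda>x. f x k) \<in> borel_measurable M"
  shows "(\<lambda>x. consensus W T (f x) i) \<in> borel_measurable M"
  by (subst consensus_eq_weights) (use assms in measurable)

lemma transpose_consensus:
  fixes f :: "'m::finite \<Rightarrow> real^'n^'n"
  shows "(\<And>k. transpose (f k) = f k) \<Longrightarrow> transpose (consensus W T f i) = consensus W T f i"
  by (subst (1 2) consensus_eq_weights) (simp add: transpose_sum transpose_scaleR)

lemma transpose_beta_acc [simp]: "transpose (beta_acc x t i) = beta_acc x t i"
  by (simp add: beta_acc_def transpose_sum)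

lemma borel_measurable_theta_bar:
  fixes x :: "'m::finite \<Rightarrow> nat \<Rightarrow> 'a \<Rightarrow> real^'n" and y :: "'m \<Rightarrow> nat \<Rightarrow> 'a \<Rightarrow> real^'l"
  assumes [measurable]: "\<And>i j. 1 \<le> j \<Longrightarrow> x i j \<in> borel_measurable M" "\<And>i j. 1 \<le> j \<Longrightarrow> y i j \<in> borel_measurable M"
  shows "(\<lambda>\<omega>. theta_bar W T (\<lambda>i j. y i j \<omega>) (\<lambda>i j. x i j \<omega>) t i) \<in> borel_measurable M"
proof -
  have "(\<lambda>\<omega>. alpha_acc (\<lambda>i j. y i j \<omega>) (\<lambda>i j. x i j \<omega>) t k) \<in> borel_measurable M" for k
    unfolding alpha_acc_def by measurable
  moreover have "(\<lambda>\<omega>. beta_acc (\<lambda>i j. x i j \<omega>) t k) \<in> borel_measurable M" for k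
    unfolding beta_acc_def by measurable
  ultimately show ?thesis
    unfolding theta_bar_def
    by (intro borel_measurable_matrix_matrix_mult borel_measurable_pinv_symmetric
        borel_measurable_consensus transpose_consensus transpose_beta_acc)
qed

section \<open>The estimation error for a fixed realisation\<close>

lemma outer_add_left: "outer (u + u') v = outer u v + outer u' v"
  by (simp add: outer_def vec_eq_iff distrib_right)

lemma outer_matrix_vector_mult: "outer (A *v u) v = A ** outer u v"
  by (simp add: outer_def vec_eq_iff matrix_vector_mult_def matrix_matrix_mult_def sum_distrib_right mult.assoc)

text \<open>Left multiplication by \<open>Theta\<close> commutes with averaging, so with an exact
  inverse the signal part reproduces \<open>Theta\<close> and only averaged noise remains.\<close>

lemma theta_bar_error:
  fixes Theta :: "real^'n^'l" and x :: "'m::finite \<Rightarrow> nat \<Rightarrow> real^'n"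
  assumes inv: "consensus W T (beta_acc x t) i ** pinv (consensus W T (beta_acc x t) i) = mat 1"
  shows "theta_bar W T (\<lambda>i j. Theta *v x i j + e i j) x t i - Theta
    = (\<Sum>k\<in>UNIV. consensus W T (\<lambda>j. of_bool (j = k)) i *\<^sub>R (\<Sum>j=1..t. outer (e k j) (x k j)))
      ** pinv (consensus W T (beta_acc x t) i)"
proof -
  let ?p = "\<lambda>k. consensus W T (\<lambda>j. of_bool (j = k)) i :: real"
  let ?b = "consensus W T (beta_acc x t) i"
  let ?N = "\<Sum>k\<in>UNIV. ?p k *\<^sub>R (\<Sum>j=1..t. outer (e k j) (x k j))"
  have acc: "alpha_acc (\<lambda>i j. Theta *v x i j + e i j) x t k = Theta ** beta_acc x t k + (\<Sum>j=1..t. outer (e k j) (x k j))" for k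
    by (simp add: alpha_acc_def beta_acc_def outer_add_left outer_matrix_vector_mult sum.distrib matrix_matrix_mult_sum)
  have "consensus W T (alpha_acc (\<lambda>i j. Theta *v x i j + e i j) x t) i
      = (\<Sum>k\<in>UNIV. ?p k *\<^sub>R (Theta ** beta_acc x t k)) + ?N"
    by (subst consensus_eq_weights) (simp add: acc scaleR_add_right sum.distrib)
  also have "(\<Sum>k\<in>UNIV. ?p k *\<^sub>R (Theta ** beta_acc x t k)) = Theta ** ?b"
    by (subst (2) consensus_eq_weights) (simp add: matrix_matrix_mult_sum matrix_scalar_ac scalar_matrix_assoc)
  finally have "consensus W T (alpha_acc (\<lambda>i j. Theta *v x i j + e i j) x t) i = Theta ** ?b + ?N" .
  moreover have "(Theta ** ?b + ?N) ** pinv ?b = Theta ** (?b ** pinv ?b) + ?N ** pinv ?b"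
    unfolding matrix_mul_assoc by (simp add: matrix_matrix_mult_def vec_eq_iff distrib_right sum.distrib)
  ultimately show ?thesis
    by (simp add: theta_bar_def inv)
qed

lemma theta_bar_error_bound:
  fixes Theta :: "real^'n^'l" and x :: "'m::finite \<Rightarrow> nat \<Rightarrow> real^'n" and e :: "'m \<Rightarrow> nat \<Rightarrow> real^'l"
    and W :: "real^'m^'m"
  assumes W: "\<And>i j. 0 \<le> W $ i $ j" "W *v (\<chi> i. 1) = (\<chi> i. 1)" "transpose W = W" "rho W < 1"
    and pos: "0 < \<kappa>0" "0 < \<kappa>1" "0 \<le> h" "0 \<le> g"
    and gram: "\<And>k v. \<kappa>0 * (norm v)\<^sup>2 \<le> (\<Sum>j=1..t. (v \<bullet> x k j)\<^sup>2)"
      "\<And>v. \<kappa>1 * (norm v)\<^sup>2 \<le> (\<Sum>k\<in>UNIV. \<Sum>j=1..t. (v \<bullet> x k j)\<^sup>2)"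
    and noise: "\<And>k v. (norm (\<Sum>j=1..t. (v \<bullet> x k j) *\<^sub>R e k j))\<^sup>2 \<le> h\<^sup>2 * (\<Sum>j=1..t. (v \<bullet> x k j)\<^sup>2)"
      "\<And>v. (norm (\<Sum>k\<in>UNIV. \<Sum>j=1..t. (v \<bullet> x k j) *\<^sub>R e k j))\<^sup>2 \<le> g\<^sup>2 * (\<Sum>k\<in>UNIV. \<Sum>j=1..t. (v \<bullet> x k j)\<^sup>2)"
  shows "spec_norm (theta_bar W T (\<lambda>i j. Theta *v x i j + e i j) x t i - Theta)
    \<le> g / sqrt \<kappa>1 + 3 * real CARD('m) * rho W ^ T * h / sqrt \<kappa>0"
proof -
  define p :: "'m \<Rightarrow> real" where "p k = consensus W T (\<lambda>j. of_bool (j = k)) i" for k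
  define b where "b = consensus W T (beta_acc x t) i"
  have b: "b = (\<Sum>k\<in>UNIV. p k *\<^sub>R beta_acc x t k)"
    unfolding b_def p_def by (rule consensus_eq_weights)
  have p0: "0 \<le> p k" for k
    unfolding p_def using W(1) by (intro consensus_nonneg) auto
  have p1: "(\<Sum>k\<in>UNIV. p k) = 1"
    unfolding p_def by (rule consensus_weights_sum[OF W(2)])
  have quad: "w \<bullet> (b *v w) = (\<Sum>k\<in>UNIV. p k * (\<Sum>j=1..t. (w \<bullet> x k j)\<^sup>2))" for w
    by (simp add: b sum_matrix_vector_mult scaleR_matrix_vector_assoc[symmetric] inner_sum_right beta_acc_def
        inner_outer_mult_vec power2_eq_square inner_commute)
  have "0 < w \<bullet> (b *v w)" if "w \<noteq> 0" for w
  proof -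
    have "(\<Sum>k\<in>UNIV. p k * (\<kappa>0 * (norm w)\<^sup>2)) \<le> w \<bullet> (b *v w)"
      unfolding quad using p0 gram(1) by (intro sum_mono mult_left_mono)
    then have "\<kappa>0 * (norm w)\<^sup>2 \<le> w \<bullet> (b *v w)" using p1 by (simp flip: sum_distrib_right)
    moreover have "0 < \<kappa>0 * (norm w)\<^sup>2" using pos that by simp
    ultimately show ?thesis by linarith
  qed
  moreover have "transpose b = b" unfolding b_def by (intro transpose_consensus) simp
  ultimately have inv: "b ** pinv b = mat 1" by (intro positive_definite_mult_pinv)
  have "norm ((theta_bar W T (\<lambda>i j. Theta *v x i j + e i j) x t i - Theta) *v v)
      \<le> (g / sqrt \<kappa>1 + 3 * real CARD('m) * rho W ^ T * h / sqrt \<kappa>0) * norm v" for v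
  proof -
    \<comment> \<open>This trades the pseudoinverse for the equation \<open>b *v w = v\<close>.
      Pairing it with \<open>w\<close> and applying Cauchy-Schwarz gives the only upper bound on the
      weighted Gram form that is used.\<close>
    define w where "w = pinv b *v v"
    have bw: "b *v w = v" by (simp add: w_def matrix_vector_mul_assoc inv)
    have "(theta_bar W T (\<lambda>i j. Theta *v x i j + e i j) x t i - Theta) *v v
        = (\<Sum>k\<in>UNIV. p k *\<^sub>R (\<Sum>j=1..t. (w \<bullet> x k j) *\<^sub>R e k j))"
      unfolding theta_bar_error[OF inv[unfolded b_def]]
      by (simp add: b_def[symmetric] p_def[symmetric] w_def[symmetric] matrix_vector_mul_assoc[symmetric]
          sum_matrix_vector_mult scaleR_matrix_vector_assoc[symmetric] outer_mult_vec inner_commute)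
    moreover have "norm (\<Sum>k\<in>UNIV. p k *\<^sub>R (\<Sum>j=1..t. (w \<bullet> x k j) *\<^sub>R e k j))
        \<le> (g / sqrt \<kappa>1 + 3 * real CARD('m) * rho W ^ T * h / sqrt \<kappa>0) * norm v"
    proof (rule perturbed_average_bound[OF p0 p1 _ gram _ noise pos])
      show "\<bar>p k - 1 / real CARD('m)\<bar> \<le> rho W ^ T" for k
        unfolding p_def by (rule consensus_weights_bound(2)[OF W(3,2,4)])
      show "(\<Sum>k\<in>UNIV. p k * (\<Sum>j=1..t. (w \<bullet> x k j)\<^sup>2)) \<le> norm w * norm v"
        unfolding quad[symmetric] bw by (rule norm_cauchy_schwarz)
    qed auto
    ultimately show ?thesis by simp
  qed
  then show ?thesis by (simp add: spec_norm_le_iff)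
qed

section \<open>Independence of signals and noise\<close>

context prob_space
begin

text \<open>Serves to read off the signals alone, or the noise alone, from independence over the sum
  type.\<close>

lemma indep_sets_reindex:
  assumes inj: "inj_on f I" and indep: "indep_sets F (f ` I)"
  shows "indep_sets (\<lambda>i. F (f i)) I"
proof (rule indep_setsI)
  show "F (f i) \<subseteq> events" if "i \<in> I" for i
    using indep that by (auto simp: indep_sets_def)
  fix A J assume J: "J \<noteq> {}" "J \<subseteq> I" "finite J" and A: "\<forall>j\<in>J. A j \<in> F (f j)"
  have injJ: "inj_on f J" using inj J by (blast intro: inj_on_subset)
  let ?g = "the_inv_into J f"
  have g: "?g (f j) = j" if "j \<in> J" for j using that injJ by (simp add: the_inv_into_f_f)
  have "prob (\<Inter>q\<in>f ` J. A (?g q)) = (\<Prod>q\<in>f ` J. prob (A (?g q)))"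
    using J A g by (intro indep_setsD[OF indep]) auto
  moreover have "(\<Inter>q\<in>f ` J. A (?g q)) = (\<Inter>j\<in>J. A j)" using g by auto
  ultimately show "prob (\<Inter>j\<in>J. A j) = (\<Prod>j\<in>J. prob (A j))"
    by (simp add: prod.reindex[OF injJ] g)
qed

text \<open>\<open>indep_vars\<close> requires a single value type, so signals and noise are padded
  with \<open>undefined\<close> to pairs. Independence is then grouped over the two halves of the
  sum index, and projecting the pairs back gives the product law.\<close>

lemma indep_families_joint_distr:
  fixes X :: "'i \<Rightarrow> 'a \<Rightarrow> 'b::second_countable_topology" and E :: "'i \<Rightarrow> 'a \<Rightarrow> 'c::second_countable_topology"
  assumes indep: "indep_sets (case_sum (\<lambda>p. {X p -` A \<inter> space M | A. A \<in> sets borel})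
      (\<lambda>p. {E p -` A \<inter> space M | A. A \<in> sets borel})) (I <+> I)"
    and X [measurable]: "\<And>p. p \<in> I \<Longrightarrow> X p \<in> borel_measurable M"
    and E [measurable]: "\<And>p. p \<in> I \<Longrightarrow> E p \<in> borel_measurable M"
  shows "distr M (PiM I (\<lambda>_. borel)) (\<lambda>\<omega>. \<lambda>i\<in>I. X i \<omega>) \<Otimes>\<^sub>M distr M (PiM I (\<lambda>_. borel)) (\<lambda>\<omega>. \<lambda>i\<in>I. E i \<omega>)
      = distr M (PiM I (\<lambda>_. borel) \<Otimes>\<^sub>M PiM I (\<lambda>_. borel)) (\<lambda>\<omega>. (\<lambda>i\<in>I. X i \<omega>, \<lambda>i\<in>I. E i \<omega>))"
proof -
  define Y :: "'i + 'i \<Rightarrow> 'a \<Rightarrow> 'b \<times> 'c" where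
    "Y q = (case q of Inl p \<Rightarrow> \<lambda>\<omega>. (X p \<omega>, undefined) | Inr p \<Rightarrow> \<lambda>\<omega>. (undefined, E p \<omega>))" for q
  have "indep_vars (\<lambda>_. borel) Y (I <+> I)"
    unfolding indep_vars_def2
  proof (intro conjI ballI indep_sets_mono_sets[OF indep])
    show "Y q \<in> borel_measurable M" if "q \<in> I <+> I" for q
      using that by (auto simp: Y_def)
    fix q assume q: "q \<in> I <+> I"
    show "{Y q -` A \<inter> space M | A. A \<in> sets borel}
      \<subseteq> case_sum (\<lambda>p. {X p -` A \<inter> space M | A. A \<in> sets borel}) (\<lambda>p. {E p -` A \<inter> space M | A. A \<in> sets borel}) q"
    proof (cases q)
      case (Inl p)
      have "Y q -` A \<inter> space M = X p -` ((\<lambda>a. (a, undefined)) -` A) \<inter> space M" for A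
        by (auto simp: Y_def Inl)
      moreover have "(\<lambda>a. (a, undefined)) -` A \<in> sets borel" if "A \<in> sets borel" for A :: "('b \<times> 'c) set"
        by (rule measurable_sets_borel[OF _ that]) simp
      ultimately show ?thesis by (auto simp: Inl) blast
    next
      case (Inr p)
      have "Y q -` A \<inter> space M = E p -` ((\<lambda>a. (undefined, a)) -` A) \<inter> space M" for A
        by (auto simp: Y_def Inr)
      moreover have "(\<lambda>a. (undefined, a)) -` A \<in> sets borel" if "A \<in> sets borel" for A :: "('b \<times> 'c) set"
        by (rule measurable_sets_borel[OF _ that]) simp
      ultimately show ?thesis by (auto simp: Inr) blast
    qed
  qed
  then have "indep_var (PiM (Inl ` I) (\<lambda>_. borel)) (\<lambda>\<omega>. restrict (\<lambda>q. Y q \<omega>) (Inl ` I))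
      (PiM (Inr ` I) (\<lambda>_. borel)) (\<lambda>\<omega>. restrict (\<lambda>q. Y q \<omega>) (Inr ` I))"
    by (rule indep_var_restrict) auto
  moreover define S T :: "('i + 'i \<Rightarrow> 'b \<times> 'c) measure" where
    "S = PiM (Inl ` I) (\<lambda>_. borel)" and "T = PiM (Inr ` I) (\<lambda>_. borel)"
  moreover define U V where "U = (\<lambda>\<omega>. restrict (\<lambda>q. Y q \<omega>) (Inl ` I))" and "V = (\<lambda>\<omega>. restrict (\<lambda>q. Y q \<omega>) (Inr ` I))"
  ultimately have UV: "U \<in> measurable M S" "V \<in> measurable M T"
      "distr M S U \<Otimes>\<^sub>M distr M T V = distr M (S \<Otimes>\<^sub>M T) (\<lambda>\<omega>. (U \<omega>, V \<omega>))"
    by (simp_all add: indep_var_distribution_eq)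
  define \<phi> where "\<phi> f = (\<lambda>p\<in>I. fst (f (Inl p)))" for f :: "'i + 'i \<Rightarrow> 'b \<times> 'c"
  define \<psi> where "\<psi> f = (\<lambda>p\<in>I. snd (f (Inr p)))" for f :: "'i + 'i \<Rightarrow> 'b \<times> 'c"
  let ?PX = "PiM I (\<lambda>_. borel) :: ('i \<Rightarrow> 'b) measure" and ?PE = "PiM I (\<lambda>_. borel) :: ('i \<Rightarrow> 'c) measure"
  have [measurable]: "fst \<in> borel_measurable (borel :: ('b \<times> 'c) measure)"
      "snd \<in> borel_measurable (borel :: ('b \<times> 'c) measure)"
    by (intro borel_measurable_continuous_onI continuous_intros)+
  note [measurable] = UV(1,2)
  have \<phi> [measurable]: "\<phi> \<in> measurable S ?PX"
    unfolding \<phi>_def S_def by (intro measurable_restrict) (auto intro!: measurable_compose[OF measurable_component_singleton])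
  have \<psi> [measurable]: "\<psi> \<in> measurable T ?PE"
    unfolding \<psi>_def T_def by (intro measurable_restrict) (auto intro!: measurable_compose[OF measurable_component_singleton])
  have \<phi>U: "\<phi> (U \<omega>) = (\<lambda>p\<in>I. X p \<omega>)" and \<psi>V: "\<psi> (V \<omega>) = (\<lambda>p\<in>I. E p \<omega>)" for \<omega>
    by (auto simp: \<phi>_def \<psi>_def U_def V_def Y_def restrict_def)
  have distrs: "distr M ?PX (\<lambda>\<omega>. \<lambda>p\<in>I. X p \<omega>) = distr (distr M S U) ?PX \<phi>"
    "distr M ?PE (\<lambda>\<omega>. \<lambda>p\<in>I. E p \<omega>) = distr (distr M T V) ?PE \<psi>"
    using UV \<phi> \<psi> by (simp_all add: distr_distr comp_def \<phi>U \<psi>V)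
  have "prob_space (distr (distr M T V) ?PE \<psi>)"
    by (intro prob_space.prob_space_distr prob_space_distr UV) (simp add: \<psi>)
  then have "sigma_finite_measure (distr (distr M T V) ?PE \<psi>)"
    by (rule prob_space_imp_sigma_finite)
  then have "distr (distr M S U) ?PX \<phi> \<Otimes>\<^sub>M distr (distr M T V) ?PE \<psi>
      = distr (distr M S U \<Otimes>\<^sub>M distr M T V) (?PX \<Otimes>\<^sub>M ?PE) (\<lambda>(f, g). (\<phi> f, \<psi> g))"
    using \<phi> \<psi> by (intro pair_measure_distr) auto
  also have "\<dots> = distr M (?PX \<Otimes>\<^sub>M ?PE) ((\<lambda>(f, g). (\<phi> f, \<psi> g)) \<circ> (\<lambda>\<omega>. (U \<omega>, V \<omega>)))"
    unfolding UV(3) by (intro distr_distr) measurable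
  also have "(\<lambda>(f, g). (\<phi> f, \<psi> g)) \<circ> (\<lambda>\<omega>. (U \<omega>, V \<omega>)) = (\<lambda>\<omega>. (\<lambda>p\<in>I. X p \<omega>, \<lambda>p\<in>I. E p \<omega>))"
    by (simp add: fun_eq_iff \<phi>U \<psi>V)
  finally show ?thesis unfolding distrs .
qed

end

section \<open>The error bound\<close>

text \<open>Rewrites the net constant in the two shapes that occur in \<open>C1\<close>. The first
  uses \<open>512/147 < 4\<close>, \<open>ln 5 \<le> ln 9\<close> and \<open>N \<ge> 1\<close>; the
  second uses \<open>ln 5 \<le> 1.63\<close>, which gives \<open>512/147 * ln 5 < 8\<close>.\<close>

lemma noise_level_le:
  fixes N d :: real
  assumes N: "N \<ge> 1" and d: "0 < d" "d < 1"
  defines "G \<equiv> sqrt (512 / 147 * (N * ln 5 + ln (1 / d)))"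
  shows "G \<le> 2 * sqrt (N * ln (9 / d))" and "G \<le> 2 * (sqrt (2 * N) + 2 * sqrt (ln (2 / d)))"
proof -
  have ld: "0 < ln (1 / d)" using d by simp
  have l9: "ln (9 / d) = ln 9 + ln (1 / d)" and l2: "ln (2 / d) = ln 2 + ln (1 / d)"
    using d by (simp_all add: ln_div)
  have l95: "ln 5 \<le> ln (9 :: real)" by simp
  have le: "N * ln 5 + ln (1 / d) \<le> N * ln 9 + N * ln (1 / d)"
    using N ld l95 by (intro add_mono mult_left_mono) (auto simp: mult_le_cancel_right1)
  have 1: "512 / 147 * (N * ln 5 + ln (1 / d)) \<le> 4 * (N * ln (9 / d))"
  proof -
    have "0 \<le> N * ln 5 + ln (1 / d)" using N ld by simp
    with le show ?thesis unfolding l9 distrib_left by linarith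
  qed
  have "G \<le> sqrt (4 * (N * ln (9 / d)))" unfolding G_def using 1 by (rule real_sqrt_le_mono)
  then show "G \<le> 2 * sqrt (N * ln (9 / d))" by (simp add: real_sqrt_mult)
  have l2pos: "0 \<le> ln (2 / d)" using d by simp
  have "512 / 147 * (N * ln 5 + ln (1 / d)) \<le> 4 * (2 * N) + 16 * ln (2 / d)"
  proof -
    have "N * ln 5 \<le> N * (163 / 100)" using N ln_5_bounds(2) by (intro mult_left_mono) auto
    moreover have "0 \<le> ln (2 :: real)" by simp
    ultimately show ?thesis unfolding l2 distrib_left using N ld by linarith
  qed
  also have "\<dots> \<le> (2 * (sqrt (2 * N) + 2 * sqrt (ln (2 / d))))\<^sup>2"
    using N l2pos by (simp add: power2_sum power_mult_distrib algebra_simps)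
  finally show "G \<le> 2 * (sqrt (2 * N) + 2 * sqrt (ln (2 / d)))"
    unfolding G_def using N l2pos by (intro real_le_lsqrt) auto
qed

text \<open>With \<open>R\<close> the square root of \<open>1/64 + (L - 1)/4\<close>, the claim
  reads \<open>G * sx * L \<le> 8 * (4 * sx * a + mh * b) * R\<close>. Since
  \<open>L \<le> 1 + 4 * R^2\<close>, one factor \<open>R\<close> is kept and the other is bounded
  by \<open>1/8 + mh / sx\<close>; then \<open>G\<close> is replaced by \<open>2 * a\<close> next to
  \<open>sx\<close> and by \<open>2 * b\<close> next to \<open>mh\<close>. The constant summand is
  absorbed by \<open>1 \<le> 8 * R\<close>.\<close>

lemma main_term_le:
  fixes sx se mh G a b L M :: real
  assumes pos: "0 < sx" "0 < se" "0 \<le> mh" "0 < M" "0 \<le> a" "0 \<le> b" "0 \<le> G"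
    and G: "G \<le> 2 * a" "G \<le> 2 * b" and L: "1 \<le> L" "L \<le> 1 + 4 * mh\<^sup>2 / sx\<^sup>2"
  shows "se * G / sqrt (M * sx\<^sup>2 * (1 / 64 + (L - 1) / 4)) \<le> 8 * se * (4 * sx * a + mh * b) / (sqrt M * sx\<^sup>2 * L)"
proof -
  define R where "R = sqrt (1 / 64 + (L - 1) / 4)"
  have R2: "R\<^sup>2 = 1 / 64 + (L - 1) / 4" using L by (simp add: R_def)
  have R: "1 / 8 \<le> R" unfolding R_def using L by (intro real_le_rsqrt) (simp add: power2_eq_square)
  have R_le: "R \<le> 1 / 8 + mh / sx"
  proof -
    have "1 / 64 + (L - 1) / 4 \<le> 1 / 64 + mh\<^sup>2 / sx\<^sup>2" using L(2) by (simp add: mult.commute)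
    also have "\<dots> \<le> (1 / 8 + mh / sx)\<^sup>2"
      using pos by (simp add: power2_sum power_divide)
    finally show ?thesis unfolding R_def using pos by (intro real_le_lsqrt) auto
  qed
  have "L \<le> 1 + 4 * R\<^sup>2" unfolding R2 by (simp add: field_simps)
  then have "G * sx * L \<le> G * sx * (1 + 4 * R\<^sup>2)"
    using pos by (intro mult_left_mono) auto
  also have "\<dots> = G * sx + 4 * R * (R * sx * G)" by (simp add: power2_eq_square algebra_simps)
  also have "G * sx \<le> 16 * R * sx * a"
  proof -
    have "G * sx \<le> (2 * a) * sx" using G pos by (intro mult_right_mono) auto
    also have "\<dots> \<le> (16 * R * a) * sx" using R pos by (intro mult_right_mono) auto
    finally show ?thesis by (simp add: ac_simps)
  qed
  also have "4 * R * (R * sx * G) \<le> 4 * R * (sx * a / 4 + 2 * mh * b)"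
  proof -
    have "R * sx * G \<le> (1 / 8 + mh / sx) * sx * G"
      using R_le pos by (intro mult_right_mono) auto
    also have "\<dots> = sx * G / 8 + mh * G" using pos by (simp add: field_simps)
    also have "\<dots> \<le> sx * (2 * a) / 8 + mh * (2 * b)"
      using G pos by (intro add_mono divide_right_mono mult_left_mono) auto
    finally have "R * sx * G \<le> sx * a / 4 + 2 * mh * b" by (simp add: ac_simps)
    then show ?thesis using R by (intro mult_left_mono) auto
  qed
  also have "16 * R * sx * a + 4 * R * (sx * a / 4 + 2 * mh * b) \<le> 8 * (4 * sx * a + mh * b) * R"
  proof -
    have "0 \<le> R * sx * a" using R pos by simp
    then show ?thesis by (simp add: algebra_simps)
  qed
  finally have key: "G * sx * L \<le> 8 * (4 * sx * a + mh * b) * R" by simp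
  have "se * G / sqrt (M * sx\<^sup>2 * (1 / 64 + (L - 1) / 4)) = se * G / (sqrt M * sx * R)"
    using pos by (simp add: real_sqrt_mult R_def)
  also have "\<dots> = se * (G * sx * L) / (sqrt M * sx\<^sup>2 * L * R)"
    using pos L R by (simp add: field_simps power2_eq_square)
  also have "\<dots> \<le> se * (8 * (4 * sx * a + mh * b) * R) / (sqrt M * sx\<^sup>2 * L * R)"
    using key pos L R by (intro divide_right_mono mult_left_mono) auto
  also have "\<dots> = 8 * se * (4 * sx * a + mh * b) / (sqrt M * sx\<^sup>2 * L)"
  proof -
    have "se * (8 * u * R) / (w * R) = 8 * se * u / w" for u w
      using R by (simp add: field_simps)
    then show ?thesis .
  qed
  finally show ?thesis .
qed

lemma sum_singleton_Times: "(\<Sum>p\<in>{k} \<times> A. f p) = (\<Sum>j\<in>A. f (k, j))"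
  by (subst sum.cartesian_product') simp

text \<open>\<open>C0\<close> is at least its first summand, where \<open>152 * m / sx^2\<close>
  from \<open>c3\<close> meets \<open>4 * se * sx * a / sqrt t\<close> from \<open>c2\<close>:
  together 608 units of \<open>m * se * a / (sx * sqrt t)\<close>. The left side is at most
  \<open>r\<close> times \<open>48 = 3 * 2 * 8\<close> such units, the \<open>2\<close> from the
  noise level and the \<open>8\<close> from the square root of \<open>1/64\<close>.\<close>

lemma consensus_term_le:
  fixes m n l t sx se mh c1 c2 c3 C0 r d :: real
  assumes pos: "1 \<le> m" "1 \<le> n" "1 \<le> l" "0 < t" "0 < sx" "0 < se" "0 \<le> mh" "0 \<le> r" "0 \<le> c1" and d: "0 < d" "d < 1"
    and c2: "c2 = se * (4 * sx * sqrt ((n + l) * ln (9 / d)) + mh * (sqrt (2 * (l + n)) + sqrt (2 * ln (2 / d))))"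
    and c3: "c3 = 152 * m powr (3/2) * sqrt (5 * n) / sx\<^sup>2 + 64 * m powr (3/2) * sqrt (5 * n) / sx ^ 4 * mh\<^sup>2"
    and C0: "C0 = c3 * (c1 + c2 / sqrt t) + 8 * m powr (3/2) * sqrt l * (c1 + c2 / sqrt t) / sx\<^sup>2
      + r * m powr (3/2) * sqrt l * c3 * (c1 + c2 / sqrt t)"
  shows "3 * m * r * (se * sqrt (512 / 147 * ((n + l) * ln 5 + ln (1 / d)))) / sqrt (t * sx\<^sup>2 / 64) \<le> r * C0"
proof -
  define a where "a = sqrt ((n + l) * ln (9 / d))"
  have a: "0 \<le> a" using pos d by (simp add: a_def)
  have c2_ge: "se * (4 * sx * a) \<le> c2"
    unfolding c2 a_def using pos d by (intro mult_left_mono) auto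
  have "0 \<le> se * (4 * sx * a)" using a pos by simp
  with c2_ge have c2_0: "0 \<le> c2" by linarith
  have m32: "m \<le> m powr (3/2)" using powr_mono[of 1 "3/2" m] pos by simp
  have "1 \<le> sqrt (5 * n)" using pos by simp
  then have "m * 1 \<le> m powr (3/2) * sqrt (5 * n)" using m32 pos by (intro mult_mono) auto
  then have "152 * m / sx\<^sup>2 \<le> 152 * m powr (3/2) * sqrt (5 * n) / sx\<^sup>2"
    by (intro divide_right_mono) auto
  moreover have "0 \<le> 64 * m powr (3/2) * sqrt (5 * n) / sx ^ 4 * mh\<^sup>2" using pos by simp
  ultimately have c3_ge: "152 * m / sx\<^sup>2 \<le> c3" unfolding c3 by linarith
  have "0 \<le> 152 * m / sx\<^sup>2" using pos by simp
  with c3_ge have c3_0: "0 \<le> c3" by linarith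
  define e where "e = c1 + c2 / sqrt t"
  have e: "se * (4 * sx * a) / sqrt t \<le> e"
    unfolding e_def using c2_ge pos divide_right_mono[of _ c2 "sqrt t"] by fastforce
  have e0: "0 \<le> e" using pos c2_0 by (simp add: e_def)
  have "152 * m / sx\<^sup>2 * (se * (4 * sx * a) / sqrt t) \<le> c3 * e"
    using c3_ge e c3_0 a pos by (intro mult_mono) auto
  moreover have "c3 * e \<le> C0"
    unfolding C0 e_def[symmetric] using e0 c3_0 pos by simp
  moreover have "152 * m / sx\<^sup>2 * (se * (4 * sx * a) / sqrt t) = 608 * (m * se * a / (sx * sqrt t))"
    using pos by (simp add: power2_eq_square field_simps)
  ultimately have C0_ge: "608 * (m * se * a / (sx * sqrt t)) \<le> C0" by linarith
  have "sqrt (512 / 147 * ((n + l) * ln 5 + ln (1 / d))) \<le> 2 * a"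
    unfolding a_def using pos d by (intro noise_level_le) auto
  then have "3 * m * r * (se * sqrt (512 / 147 * ((n + l) * ln 5 + ln (1 / d)))) / sqrt (t * sx\<^sup>2 / 64)
      \<le> 3 * m * r * (se * (2 * a)) / sqrt (t * sx\<^sup>2 / 64)"
    using pos by (intro divide_right_mono mult_left_mono) auto
  also have "\<dots> = r * (48 * (m * se * a / (sx * sqrt t)))"
  proof -
    have "sqrt (t * sx\<^sup>2 / 64) = sqrt t * sx / 8"
      using pos by (intro real_sqrt_unique) (simp_all add: power_mult_distrib power_divide)
    then show ?thesis using pos by (simp add: field_simps)
  qed
  also have "\<dots> \<le> r * C0"
  proof (intro mult_left_mono)
    have "0 \<le> m * se * a / (sx * sqrt t)" using pos a by simp
    moreover have "48 * z \<le> C0" if "0 \<le> z" "608 * z \<le> C0" for z using that by linarith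
    ultimately show "48 * (m * se * a / (sx * sqrt t)) \<le> C0" using C0_ge by blast
  qed (use pos in auto)
  finally show ?thesis .
qed

theorem theorem3:
  fixes M :: "'a measure"
    and Theta :: "real^'n^'l"
    and x :: "'m::finite \<Rightarrow> nat \<Rightarrow> 'a \<Rightarrow> real^'n"
    and eta :: "'m \<Rightarrow> nat \<Rightarrow> 'a \<Rightarrow> real^'l"
    and mu :: "'m \<Rightarrow> nat \<Rightarrow> real^'n"
    and sx se mu_hat delta_hat delta :: real
    and W :: "real^'m^'m"
    and E :: "'m \<Rightarrow> 'm \<Rightarrow> bool"
    and zeta S T t :: nat
    and t1 t2 t3 n l m c1 c2 c3 C0 C1 :: real
  assumes prob: "prob_space M"
    and sx_pos: "sx > 0" and se_pos: "se > 0"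
    and x_distr: "\<And>i j. j \<ge> 1 \<Longrightarrow> distributed M lborel (x i j) (gauss_iso_density (mu i j) sx)"
    and eta_distr: "\<And>i j. j \<ge> 1 \<Longrightarrow> distributed M lborel (eta i j) (gauss_iso_density 0 se)"
    and indep_all: "prob_space.indep_sets M
           (case_sum (\<lambda>(i, j). {x i j -` A \<inter> space M | A. A \<in> sets borel})
                     (\<lambda>(i, j). {eta i j -` A \<inter> space M | A. A \<in> sets borel}))
           ((UNIV \<times> {1..}) <+> (UNIV \<times> {1..}))"
    and mu_bdd: "bounded ((\<lambda>(i, j). mu i j) ` (UNIV \<times> {1..}))"
    and mu_hat_def: "mu_hat = (SUP p\<in>UNIV \<times> {1..}. norm (mu (fst p) (snd p)))"
    and E_sym: "\<And>i j. E i j \<Longrightarrow> E j i"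
    and E_conn: "\<And>i j. E\<^sup>*\<^sup>* i j"
    and W_nonneg: "\<And>i j. W $ i $ j \<ge> 0"
    and W_graph: "\<And>i j. i \<noteq> j \<Longrightarrow> \<not> E i j \<Longrightarrow> W $ i $ j = 0"
    and W_stoch: "W *v (\<chi> i. 1) = (\<chi> i. 1)"
    and W_sym: "transpose W = W"
    and W_rho: "rho W < 1"
    and zeta_pos: "zeta \<ge> 1" and T_pos: "T \<ge> 1"
    and delta_hat_pos: "delta_hat > 0" and delta_pos: "delta > 0"
    and n_def: "n = real CARD('n)" and l_def: "l = real CARD('l)" and m_def: "m = real CARD('m)"
    and t1_def: "t1 = 8 * n + 16 * ln (2 / delta_hat)"
    and t2_def: "t2 = (16 * mu_hat * (sqrt (4 * n) + sqrt (2 * ln (2 / delta_hat))) / sx)\<^sup>2"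
    and t3_def: "t3 = 2 * (n + l) * ln (1 / delta_hat)"
    and t_ge: "real t \<ge> max t1 (max t2 t3)"
    and t_comm: "t mod zeta = 0" and t_S: "t \<le> S"
    and c1_def: "c1 = spec_norm Theta * (19 / 8 * sx\<^sup>2 + mu_hat\<^sup>2)"
    and c2_def: "c2 = se * (4 * sx * sqrt ((n + l) * ln (9 / delta_hat))
                    + mu_hat * (sqrt (2 * (l + n)) + sqrt (2 * ln (2 / delta_hat))))"
    and c3_def: "c3 = 152 * m powr (3/2) * sqrt (5 * n) / sx\<^sup>2
                    + 64 * m powr (3/2) * sqrt (5 * n) / sx ^ 4 * mu_hat\<^sup>2"
    and C0_def: "C0 = c3 * (c1 + c2 / sqrt (real t))
                    + 8 * m powr (3/2) * sqrt l * (c1 + c2 / sqrt (real t)) / sx\<^sup>2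
                    + (rho W) ^ T * m powr (3/2) * sqrt l * c3 * (c1 + c2 / sqrt (real t))"
    and C1_def: "C1 = 8 * se * (4 * sx * sqrt ((n + l) * ln (9 / delta))
                    + mu_hat * (sqrt (2 * (l + n)) + 2 * sqrt (ln (2 / delta))))"
  shows "prob_space.prob M
           {\<omega> \<in> space M. \<forall>i.
              spec_norm (theta_bar W T (\<lambda>i j. Theta *v x i j \<omega> + eta i j \<omega>) (\<lambda>i j. x i j \<omega>) t i - Theta)
              \<le> (rho W) ^ T * C0
                 + C1 / (sqrt (m * real t) * sx\<^sup>2 *
                    lambda_min (mat 1 + (4 / (m * real t * sx\<^sup>2)) *\<^sub>R
                       (\<Sum>i\<in>UNIV. \<Sum>j=1..t. outer (mu i j) (mu i j))))}
         \<ge> 1 - 4 * m * delta_hat - 4 * delta"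
proof (cases "1 - 4 * m * delta_hat - 4 * delta \<le> 0")
  case True
  then show ?thesis by (rule order_trans) (rule measure_nonneg)
next
  case False
  interpret prob_space M by (rule prob)
  have n1: "1 \<le> n" and l1: "1 \<le> l" and m1: "1 \<le> m"
    by (simp_all add: n_def l_def m_def Suc_leI)
  have "4 * delta_hat \<le> 4 * m * delta_hat" using m1 delta_hat_pos by simp
  \<comment> \<open>A positive claimed probability forces both parameters below 1, so the logarithms
    that follow are positive.\<close>
  then have dh: "0 < delta_hat" "delta_hat < 1" and d: "0 < delta" "delta < 1"
    using False delta_hat_pos delta_pos by linarith+
  define L2 where "L2 = ln (2 / delta_hat)"
  have L2: "0 < L2" using dh by (simp add: L2_def)
  have t1: "8 * n + 16 * L2 \<le> real t" using t_ge by (simp add: t1_def L2_def)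
  then have t_pos: "0 < real t" using n1 L2 by linarith
  have bdd: "bdd_above ((\<lambda>p. norm (mu (fst p) (snd p))) ` (UNIV \<times> {1..}))"
    using mu_bdd by (auto simp: bounded_iff bdd_above_def)
  have mu_le: "norm (mu i j) \<le> mu_hat" if "1 \<le> j" for i j
    unfolding mu_hat_def using that cSUP_upper[OF _ bdd, of "(i, j)"] by simp
  have mh: "0 \<le> mu_hat" using mu_le[of 1] norm_ge_zero order_trans by blast
  have t2: "256 * mu_hat\<^sup>2 * (4 * n + 2 * L2) \<le> real t * sx\<^sup>2"
  proof -
    have "4 * n + 2 * L2 \<le> (sqrt (4 * n) + sqrt (2 * L2))\<^sup>2"
      using n1 L2 by (simp add: power2_sum)
    then have "256 * mu_hat\<^sup>2 * (4 * n + 2 * L2) \<le> 256 * mu_hat\<^sup>2 * (sqrt (4 * n) + sqrt (2 * L2))\<^sup>2"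
      by (intro mult_left_mono) auto
    also have "\<dots> = t2 * sx\<^sup>2"
      using sx_pos by (simp add: t2_def L2_def power_divide power_mult_distrib)
    also have "\<dots> \<le> real t * sx\<^sup>2" using t_ge by (intro mult_right_mono) auto
    finally show ?thesis .
  qed
  define X where "X p = x (fst p) (snd p)" for p
  define H where "H p = eta (fst p) (snd p)" for p
  define J where "J k = {k} \<times> {1..t}" for k :: 'm
  define I where "I = (UNIV :: 'm set) \<times> {1..t}"
  have X_distr: "distributed M lborel (X p) (gauss_iso_density (mu (fst p) (snd p)) sx)" if "1 \<le> snd p" for p
    unfolding X_def by (rule x_distr[OF that])
  have H_distr: "distributed M lborel (H p) (gauss_iso_density 0 se)" if "1 \<le> snd p" for p
    unfolding H_def by (rule eta_distr[OF that])
  have X_meas: "X p \<in> borel_measurable M" if "1 \<le> snd p" for p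
    using distributed_measurable[OF X_distr[OF that]] by simp
  have H_meas: "H p \<in> borel_measurable M" if "1 \<le> snd p" for p
    using distributed_measurable[OF H_distr[OF that]] by simp
  define F where "F = case_sum (\<lambda>p. {X p -` A \<inter> space M | A. A \<in> sets borel})
      (\<lambda>p. {H p -` A \<inter> space M | A. A \<in> sets borel})"
  have F_indep: "indep_sets F K" if "K \<subseteq> (UNIV \<times> {1..}) <+> (UNIV \<times> {1..})" for K
    using indep_sets_mono_index[OF that] indep_all unfolding F_def X_def H_def case_prod_beta' by simp
  have X_indep: "indep_vars (\<lambda>_. borel) X K" if "K \<subseteq> UNIV \<times> {1..}" for K
  proof -
    have "indep_sets (\<lambda>p. F (Inl p)) K"
      by (rule indep_sets_reindex[where f=Inl, OF _ F_indep]) (use that in auto)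
    then show ?thesis using that X_meas by (auto simp: indep_vars_def2 F_def)
  qed
  have H_indep: "indep_vars (\<lambda>_. borel) H K" if "K \<subseteq> UNIV \<times> {1..}" for K
  proof -
    have "indep_sets (\<lambda>p. F (Inr p)) K"
      by (rule indep_sets_reindex[where f=Inr, OF _ F_indep]) (use that in auto)
    then show ?thesis using that H_meas by (auto simp: indep_vars_def2 F_def)
  qed
  \<comment> \<open>Stated for an arbitrary finite index set, because it is applied both to the
    samples of one agent and to all samples of the network.\<close>
  have noise_event: "\<exists>Q. Q \<in> events \<and> prob Q \<le> e \<and> (\<forall>\<omega>\<in>space M - Q.
      (\<forall>v. \<kappa> * (norm v)\<^sup>2 \<le> (\<Sum>p\<in>K. (v \<bullet> X p \<omega>)\<^sup>2)) \<longrightarrow>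
      (\<forall>w. (norm (\<Sum>p\<in>K. (w \<bullet> X p \<omega>) *\<^sub>R H p \<omega>))\<^sup>2
        \<le> (se * sqrt (512 / 147 * ((n + l) * ln 5 + ln (1 / e))))\<^sup>2 * (\<Sum>p\<in>K. (w \<bullet> X p \<omega>)\<^sup>2)))"
    if K: "K \<subseteq> UNIV \<times> {1..}" "finite K" and e: "0 < e" "e < 1" and kappa: "0 < \<kappa>" for K e \<kappa>
  proof -
    have mX: "(\<lambda>\<omega>. \<lambda>p\<in>K. X p \<omega>) \<in> measurable M (PiM K (\<lambda>_. borel))"
      using K X_meas by (intro measurable_restrict) auto
    have mH: "(\<lambda>\<omega>. \<lambda>p\<in>K. H p \<omega>) \<in> measurable M (PiM K (\<lambda>_. borel))"
      using K H_meas by (intro measurable_restrict) auto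
    have joint: "distr M (PiM K (\<lambda>_. borel)) (\<lambda>\<omega>. \<lambda>p\<in>K. X p \<omega>) \<Otimes>\<^sub>M distr M (PiM K (\<lambda>_. borel)) (\<lambda>\<omega>. \<lambda>p\<in>K. H p \<omega>)
      = distr M (PiM K (\<lambda>_. borel) \<Otimes>\<^sub>M PiM K (\<lambda>_. borel)) (\<lambda>\<omega>. (\<lambda>p\<in>K. X p \<omega>, \<lambda>p\<in>K. H p \<omega>))"
    proof (rule indep_families_joint_distr)
      have "K <+> K \<subseteq> (UNIV \<times> {1..}) <+> (UNIV \<times> {1..})" using K by auto
      from F_indep[OF this] show "indep_sets (case_sum (\<lambda>p. {X p -` A \<inter> space M | A. A \<in> sets borel})
        (\<lambda>p. {H p -` A \<inter> space M | A. A \<in> sets borel})) (K <+> K)" unfolding F_def .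
    qed (use K X_meas H_meas in auto)
    have K0: "0 \<le> (n + l) * ln 5 + ln (1 / e)" using n1 l1 e by simp
    have Hd: "distributed M lborel (H p) (gauss_iso_density 0 se)" if "p \<in> K" for p
      using that K by (intro H_distr) auto
    obtain Q where "Q \<in> events" "prob Q \<le> e"
      "\<And>\<omega> w. \<omega> \<in> space M - Q \<Longrightarrow> (\<And>v. \<kappa> * (norm v)\<^sup>2 \<le> (\<Sum>p\<in>K. (v \<bullet> X p \<omega>)\<^sup>2)) \<Longrightarrow>
        (norm (\<Sum>p\<in>K. (w \<bullet> X p \<omega>) *\<^sub>R H p \<omega>))\<^sup>2
        \<le> se\<^sup>2 * (512 / 147 * ((n + l) * ln 5 + ln (1 / e))) * (\<Sum>p\<in>K. (w \<bullet> X p \<omega>)\<^sup>2)"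
      unfolding n_def l_def
      by (rule self_normalized_random_design[OF K(2) H_indep[OF K(1)] se_pos Hd mX mH joint e(1) less_imp_le[OF e(2)] kappa]) blast+
    then show ?thesis using K0 by (intro exI[of _ Q]) (simp add: power_mult_distrib)
  qed
  have gram_event: "\<exists>Q. Q \<in> events \<and> prob Q \<le> 2 * delta_hat \<and> (\<forall>\<omega>\<in>space M - Q. \<forall>v.
      real t * sx\<^sup>2 / 64 * (norm v)\<^sup>2 + (\<Sum>j=1..t. (v \<bullet> mu k j)\<^sup>2) \<le> (\<Sum>j=1..t. (v \<bullet> x k j \<omega>)\<^sup>2))" for k
  proof -
    have card: "card (J k) = t" by (simp add: J_def card_cartesian_product)
    have sub: "J k \<subseteq> UNIV \<times> {1..}" and fin: "finite (J k)" by (auto simp: J_def)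
    have Xd: "distributed M lborel (X p) (gauss_iso_density (mu (fst p) (snd p)) sx)" if "p \<in> J k" for p
      using that by (intro X_distr) (auto simp: J_def)
    have B: "norm (mu (fst p) (snd p)) \<le> mu_hat" if "p \<in> J k" for p
      using that by (intro mu_le) (auto simp: J_def)
    obtain Q where "Q \<in> events" "prob Q \<le> 2 * delta_hat"
      "\<And>\<omega> v. \<omega> \<in> space M - Q \<Longrightarrow> real (card (J k)) * sx\<^sup>2 / 64 * (norm v)\<^sup>2
        + (\<Sum>p\<in>J k. (v \<bullet> mu (fst p) (snd p))\<^sup>2) \<le> (\<Sum>p\<in>J k. (v \<bullet> X p \<omega>)\<^sup>2)"
      by (rule gauss_iso_gram_lower_bound[OF fin X_indep[OF sub] sx_pos Xd dh B])
        (use t1 t2 in \<open>auto simp: card n_def L2_def\<close>)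
    then show ?thesis
      unfolding card J_def sum_singleton_Times X_def by (intro exI[of _ Q]) simp
  qed
  define Mm where "Mm = mat 1 + (4 / (m * real t * sx\<^sup>2)) *\<^sub>R (\<Sum>i\<in>UNIV. \<Sum>j=1..t. outer (mu i j) (mu i j))"
  define L where "L = lambda_min Mm"
  have Mm_sym: "transpose Mm = Mm"
    by (simp add: Mm_def transpose_def vec_eq_iff mat_def outer_def mult.commute)
  have Mm_quad: "v \<bullet> (Mm *v v) = (norm v)\<^sup>2 + 4 / (m * real t * sx\<^sup>2) * (\<Sum>i\<in>UNIV. \<Sum>j=1..t. (v \<bullet> mu i j)\<^sup>2)" for v
    by (simp add: Mm_def matrix_vector_mult_add_rdistrib scaleR_matrix_vector_assoc[symmetric] sum_matrix_vector_mult
        inner_add_right inner_sum_right inner_outer_mult_vec power2_norm_eq_inner)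
      (simp add: power2_eq_square inner_commute)
  have c_pos: "0 < 4 / (m * real t * sx\<^sup>2)" using m1 t_pos sx_pos by simp
  have L_le_quad: "L * (norm v)\<^sup>2 \<le> v \<bullet> (Mm *v v)" for v
    using lambda_min_quadratic_le[OF Mm_sym, of v] by (simp add: L_def power2_norm_eq_inner)
  \<comment> \<open>Testing the quadratic form of \<open>Mm\<close> at a unit eigenvector of its
    least eigenvalue bounds \<open>L\<close> on both sides.\<close>
  obtain u where u: "norm u = 1" "Mm *v u = L *\<^sub>R u"
    using lambda_min_attained[OF Mm_sym] unfolding L_def by blast
  have L1: "1 \<le> L"
  proof -
    have "L = u \<bullet> (Mm *v u)" using u by (simp add: norm_eq_1)
    moreover have "0 \<le> 4 / (m * real t * sx\<^sup>2) * (\<Sum>i\<in>UNIV. \<Sum>j=1..t. (u \<bullet> mu i j)\<^sup>2)"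
      using c_pos by (intro mult_nonneg_nonneg sum_nonneg) auto
    ultimately show ?thesis unfolding Mm_quad using u(1) by simp
  qed
  have L_le: "L \<le> 1 + 4 * mu_hat\<^sup>2 / sx\<^sup>2"
  proof -
    have "(\<Sum>i\<in>UNIV. \<Sum>j=1..t. (u \<bullet> mu i j)\<^sup>2) \<le> (\<Sum>i\<in>(UNIV :: 'm set). \<Sum>j=1..t. mu_hat\<^sup>2)"
    proof (intro sum_mono)
      fix i :: 'm and j assume "j \<in> {1..t}"
      then have j: "1 \<le> j" by simp
      have "\<bar>u \<bullet> mu i j\<bar> \<le> norm u * norm (mu i j)" by (rule Cauchy_Schwarz_ineq2)
      also have "\<dots> \<le> mu_hat" using mu_le[OF j, of i] by (simp add: u(1))
      finally have "\<bar>u \<bullet> mu i j\<bar> \<le> mu_hat" .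
      then show "(u \<bullet> mu i j)\<^sup>2 \<le> mu_hat\<^sup>2" by (metis abs_ge_zero power2_abs power_mono)
    qed
    then have le: "(\<Sum>i\<in>UNIV. \<Sum>j=1..t. (u \<bullet> mu i j)\<^sup>2) \<le> m * real t * mu_hat\<^sup>2" by (simp add: m_def)
    have "L \<le> 1 + 4 / (m * real t * sx\<^sup>2) * (\<Sum>i\<in>UNIV. \<Sum>j=1..t. (u \<bullet> mu i j)\<^sup>2)"
      using L_le_quad[of u] u unfolding Mm_quad by simp
    also have "\<dots> \<le> 1 + 4 / (m * real t * sx\<^sup>2) * (m * real t * mu_hat\<^sup>2)"
      using le c_pos by (intro add_left_mono mult_left_mono) auto
    also have "\<dots> = 1 + 4 * mu_hat\<^sup>2 / sx\<^sup>2" using m1 t_pos by simp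
    finally show ?thesis .
  qed
  define \<kappa>0 where "\<kappa>0 = real t * sx\<^sup>2 / 64"
  \<comment> \<open>Summing the local Gram bounds gives \<open>m * \<kappa>0\<close> plus the Gram
    form of all means; by the normalisation in \<open>Mm\<close> the latter is at least
    \<open>m * t * sx^2 / 4 * (L - 1)\<close> times the squared norm.\<close>
  define \<kappa>1 where "\<kappa>1 = m * real t * sx\<^sup>2 * (1 / 64 + (L - 1) / 4)"
  have \<kappa>: "0 < \<kappa>0" "0 < \<kappa>1"
  proof -
    have "0 \<le> (L - 1) / 4" using L1 by simp
    then have "0 < 1 / 64 + (L - 1) / 4" by linarith
    then show "0 < \<kappa>0" "0 < \<kappa>1"
      using t_pos sx_pos m1 by (simp_all add: \<kappa>0_def \<kappa>1_def)
  qed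
  define h where "h = se * sqrt (512 / 147 * ((n + l) * ln 5 + ln (1 / delta_hat)))"
  define g where "g = se * sqrt (512 / 147 * ((n + l) * ln 5 + ln (1 / delta)))"
  have "0 \<le> se * sqrt (512 / 147 * ((n + l) * ln 5 + ln (1 / e)))" if "0 < e" "e < 1" for e
  proof -
    have "0 \<le> (n + l) * ln 5 + ln (1 / e)" using n1 l1 that by simp
    then show ?thesis using se_pos by simp
  qed
  then have h0: "0 \<le> h" and g0: "0 \<le> g" unfolding h_def g_def using dh d by blast+
  have "\<exists>Q. \<forall>k. Q k \<in> events \<and> prob (Q k) \<le> 2 * delta_hat \<and> (\<forall>\<omega>\<in>space M - Q k. \<forall>v.
      real t * sx\<^sup>2 / 64 * (norm v)\<^sup>2 + (\<Sum>j=1..t. (v \<bullet> mu k j)\<^sup>2) \<le> (\<Sum>j=1..t. (v \<bullet> x k j \<omega>)\<^sup>2))"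
    by (intro choice allI gram_event)
  then obtain QA where QA: "\<And>k. QA k \<in> events" "\<And>k. prob (QA k) \<le> 2 * delta_hat"
    and gram: "\<And>k \<omega> v. \<omega> \<in> space M - QA k \<Longrightarrow>
      \<kappa>0 * (norm v)\<^sup>2 + (\<Sum>j=1..t. (v \<bullet> mu k j)\<^sup>2) \<le> (\<Sum>j=1..t. (v \<bullet> x k j \<omega>)\<^sup>2)"
    unfolding \<kappa>0_def by blast
  have "\<exists>Q. \<forall>k. Q k \<in> events \<and> prob (Q k) \<le> delta_hat \<and> (\<forall>\<omega>\<in>space M - Q k.
      (\<forall>v. \<kappa>0 * (norm v)\<^sup>2 \<le> (\<Sum>p\<in>J k. (v \<bullet> X p \<omega>)\<^sup>2)) \<longrightarrow>
      (\<forall>w. (norm (\<Sum>p\<in>J k. (w \<bullet> X p \<omega>) *\<^sub>R H p \<omega>))\<^sup>2 \<le> h\<^sup>2 * (\<Sum>p\<in>J k. (w \<bullet> X p \<omega>)\<^sup>2)))"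
    unfolding h_def using dh \<kappa>(1) by (intro choice allI noise_event) (auto simp: J_def)
  then obtain QB where QB: "\<And>k. QB k \<in> events" "\<And>k. prob (QB k) \<le> delta_hat"
    and local_noise: "\<And>k \<omega> w. \<omega> \<in> space M - QB k \<Longrightarrow>
      (\<And>v. \<kappa>0 * (norm v)\<^sup>2 \<le> (\<Sum>j=1..t. (v \<bullet> x k j \<omega>)\<^sup>2)) \<Longrightarrow>
      (norm (\<Sum>j=1..t. (w \<bullet> x k j \<omega>) *\<^sub>R eta k j \<omega>))\<^sup>2 \<le> h\<^sup>2 * (\<Sum>j=1..t. (w \<bullet> x k j \<omega>)\<^sup>2)"
    unfolding J_def sum_singleton_Times X_def H_def fst_conv snd_conv by blast
  have "\<exists>Q. Q \<in> events \<and> prob Q \<le> delta \<and> (\<forall>\<omega>\<in>space M - Q.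
      (\<forall>v. \<kappa>1 * (norm v)\<^sup>2 \<le> (\<Sum>p\<in>I. (v \<bullet> X p \<omega>)\<^sup>2)) \<longrightarrow>
      (\<forall>w. (norm (\<Sum>p\<in>I. (w \<bullet> X p \<omega>) *\<^sub>R H p \<omega>))\<^sup>2 \<le> g\<^sup>2 * (\<Sum>p\<in>I. (w \<bullet> X p \<omega>)\<^sup>2)))"
    unfolding g_def using d \<kappa>(2) by (intro noise_event) (auto simp: I_def)
  then obtain QC where QC: "QC \<in> events" "prob QC \<le> delta"
    and global_noise: "\<And>\<omega> w. \<omega> \<in> space M - QC \<Longrightarrow>
      (\<And>v. \<kappa>1 * (norm v)\<^sup>2 \<le> (\<Sum>k\<in>UNIV. \<Sum>j=1..t. (v \<bullet> x k j \<omega>)\<^sup>2)) \<Longrightarrow>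
      (norm (\<Sum>k\<in>UNIV. \<Sum>j=1..t. (w \<bullet> x k j \<omega>) *\<^sub>R eta k j \<omega>))\<^sup>2
        \<le> g\<^sup>2 * (\<Sum>k\<in>UNIV. \<Sum>j=1..t. (w \<bullet> x k j \<omega>)\<^sup>2)"
    unfolding I_def sum.cartesian_product' X_def H_def fst_conv snd_conv by blast
  define Q where "Q = (\<Union>k. QA k \<union> QB k) \<union> QC"
  have Q: "Q \<in> events" unfolding Q_def using QA QB QC by (intro sets.Un sets.finite_UN) auto
  \<comment> \<open>Each agent spends \<open>2 * delta_hat\<close> on its Gram matrix and
    \<open>delta_hat\<close> on its noise. The network-wide noise adds one \<open>delta\<close>; its
    coercivity follows from the Gram events of the agents.\<close>
  have "prob Q \<le> (\<Sum>k\<in>(UNIV :: 'm set). 3 * delta_hat) + delta"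
  proof -
    have "prob (QA k \<union> QB k) \<le> 3 * delta_hat" for k
      using measure_Un_le[OF QA(1) QB(1), of k k] QA(2)[of k] QB(2)[of k] by linarith
    moreover have "prob (\<Union>k. QA k \<union> QB k) \<le> (\<Sum>k\<in>UNIV. prob (QA k \<union> QB k))"
      using QA QB by (intro measure_UNION_le) auto
    ultimately have "prob (\<Union>k. QA k \<union> QB k) \<le> (\<Sum>k\<in>(UNIV :: 'm set). 3 * delta_hat)"
      by (meson order_trans sum_mono)
    moreover have "(\<Union>k. QA k \<union> QB k) \<in> events" using QA QB by (intro sets.finite_UN) auto
    ultimately show ?thesis
      unfolding Q_def using measure_Un_le[OF _ QC(1), of "\<Union>k. QA k \<union> QB k"] QC(2) by linarith
  qed
  also have "\<dots> \<le> 4 * m * delta_hat + 4 * delta"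
    using delta_hat_pos delta_pos by (simp add: m_def)
  finally have prob_Q: "prob Q \<le> 4 * m * delta_hat + 4 * delta" .
  define c where "c = (rho W) ^ T * C0 + C1 / (sqrt (m * real t) * sx\<^sup>2 * L)"
  define Err where "Err i \<omega> = theta_bar W T (\<lambda>i j. Theta *v x i j \<omega> + eta i j \<omega>) (\<lambda>i j. x i j \<omega>) t i - Theta" for i \<omega>
  define Good where "Good = {\<omega> \<in> space M. \<forall>i. spec_norm (Err i \<omega>) \<le> c}"
  have Good: "Good \<in> events"
  proof -
    have [measurable]: "x i j \<in> borel_measurable M" "eta i j \<in> borel_measurable M" if "1 \<le> j" for i j
      using X_meas[of "(i, j)"] H_meas[of "(i, j)"] that by (simp_all add: X_def H_def)
    have "Err i \<in> borel_measurable M" for i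
      unfolding Err_def by (intro borel_measurable_diff borel_measurable_theta_bar) measurable
    then have "Err i -` {A. spec_norm A \<le> c} \<inter> space M \<in> events" for i
      by (rule measurable_sets) (rule borel_closed[OF closed_spec_norm_le])
    moreover have "{\<omega> \<in> space M. spec_norm (Err i \<omega>) \<le> c} = Err i -` {A. spec_norm A \<le> c} \<inter> space M" for i
      by auto
    ultimately have "{\<omega> \<in> space M. spec_norm (Err i \<omega>) \<le> c} \<in> events" for i
      by (simp only:)
    then have "(\<Inter>i. {\<omega> \<in> space M. spec_norm (Err i \<omega>) \<le> c}) \<in> events"
      by (intro sets.finite_INT) auto
    moreover have "Good = (\<Inter>i. {\<omega> \<in> space M. spec_norm (Err i \<omega>) \<le> c})" by (auto simp: Good_def)
    ultimately show ?thesis by simp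
  qed
  have rho0: "0 \<le> rho W ^ T"
    using consensus_weights_bound(1)[OF W_sym W_stoch W_rho] by simp
  have "space M - Q \<subseteq> Good"
  proof
    fix \<omega> assume \<omega>: "\<omega> \<in> space M - Q"
    then have in_A: "\<omega> \<in> space M - QA k" and in_B: "\<omega> \<in> space M - QB k" and in_C: "\<omega> \<in> space M - QC" for k
      by (auto simp: Q_def)
    have low: "\<kappa>0 * (norm v)\<^sup>2 \<le> (\<Sum>j=1..t. (v \<bullet> x k j \<omega>)\<^sup>2)" for k v
      using gram[OF in_A, of v k] sum_nonneg[of "{1..t}" "\<lambda>j. (v \<bullet> mu k j)\<^sup>2"] by simp
    have low_all: "\<kappa>1 * (norm v)\<^sup>2 \<le> (\<Sum>k\<in>UNIV. \<Sum>j=1..t. (v \<bullet> x k j \<omega>)\<^sup>2)" for v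
    proof -
      define s where "s = (\<Sum>k\<in>UNIV. \<Sum>j=1..t. (v \<bullet> mu k j)\<^sup>2)"
      have "(L - 1) * (norm v)\<^sup>2 \<le> 4 / (m * real t * sx\<^sup>2) * s"
        using L_le_quad[of v] unfolding Mm_quad s_def by (simp add: algebra_simps)
      then have "m * real t * sx\<^sup>2 / 4 * ((L - 1) * (norm v)\<^sup>2) \<le> m * real t * sx\<^sup>2 / 4 * (4 / (m * real t * sx\<^sup>2) * s)"
        using m1 by (intro mult_left_mono) auto
      also have "\<dots> = s" using m1 t_pos sx_pos by simp
      finally have "m * real t * sx\<^sup>2 / 4 * ((L - 1) * (norm v)\<^sup>2) \<le> s" .
      moreover have "(\<Sum>k\<in>(UNIV :: 'm set). \<kappa>0 * (norm v)\<^sup>2) + s \<le> (\<Sum>k\<in>UNIV. \<Sum>j=1..t. (v \<bullet> x k j \<omega>)\<^sup>2)"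
        unfolding s_def sum.distrib[symmetric] by (intro sum_mono gram in_A)
      moreover have "(\<Sum>k\<in>(UNIV :: 'm set). \<kappa>0 * (norm v)\<^sup>2) = m * \<kappa>0 * (norm v)\<^sup>2" by (simp add: m_def)
      moreover have "\<kappa>1 * (norm v)\<^sup>2 = m * \<kappa>0 * (norm v)\<^sup>2 + m * real t * sx\<^sup>2 / 4 * ((L - 1) * (norm v)\<^sup>2)"
        by (simp add: \<kappa>0_def \<kappa>1_def field_simps)
      ultimately show ?thesis by linarith
    qed
    have "spec_norm (Err i \<omega>) \<le> c" for i
    proof -
      have "spec_norm (Err i \<omega>) \<le> g / sqrt \<kappa>1 + 3 * real CARD('m) * rho W ^ T * h / sqrt \<kappa>0"
        unfolding Err_def
        by (rule theta_bar_error_bound[OF W_nonneg W_stoch W_sym W_rho \<kappa> h0 g0 low low_all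
              local_noise[OF in_B low] global_noise[OF in_C low_all]])
      also have "3 * real CARD('m) * rho W ^ T * h / sqrt \<kappa>0 \<le> rho W ^ T * C0"
        unfolding \<kappa>0_def h_def m_def[symmetric]
        by (rule consensus_term_le[OF m1 n1 l1 t_pos sx_pos se_pos mh rho0 _ dh c2_def c3_def C0_def])
          (simp add: c1_def spec_norm_nonneg)
      also have "g / sqrt \<kappa>1 \<le> C1 / (sqrt (m * real t) * sx\<^sup>2 * L)"
        unfolding g_def \<kappa>1_def C1_def add.commute[of l n]
        using m1 n1 l1 t_pos sx_pos se_pos mh d L1 L_le
        by (intro main_term_le noise_level_le) auto
      finally show ?thesis by (simp add: c_def)
    qed
    then show "\<omega> \<in> Good" using \<omega> by (simp add: Good_def)
  qed
  then have "prob (space M - Q) \<le> prob Good" using Good by (intro finite_measure_mono)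
  then have "1 - 4 * m * delta_hat - 4 * delta \<le> prob Good"
    using prob_compl[OF Q] prob_Q by linarith
  then show ?thesis
    unfolding Good_def Err_def c_def L_def Mm_def .
qed

end
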